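(* Let $m,n\ge2$. On the total Fock space $\mathbb F_{m,n}$, the actions of the vertical subalgebras $\mathcal U_m\subset\mathcal E_m(q_1,q_2,q_3)$ and $\check{\mathcal U}_n\subset\mathcal E_n(\check q_1,q_2,\check q_3)$ mutually commute. Here $\mathcal U_m$ (isomorphic to the quantum affine algebra $U_q\widehat{\mathfrak{gl}}_m$) is the subalgebra generated by the currents $E_i(z),F_i(z)$, $1\le i\le m-1$, and $D$; and $\check{\mathcal U}_n$ (isomorphic to $U_q\widehat{\mathfrak{gl}}_n$) is the subalgebra generated by the currents $\check E_l(z),\check F_l(z)$, $1\le l\le n-1$, and $\check D$. The action of all these generators on $\mathbb F_{m,n}$ is given explicitly in the context.
   Context: **Parameters.** $q,d,\check d\in\mathbb C^\times$ (square roots of $q,d,\check d$ fixed); $q_1=q^{-1}d$, $q_2=q^2$, $q_3=q^{-1}d^{-1}$; $\check q_1=q^{-1}\check d$, $\check q_2=q^2$, $\check q_3=q^{-1}\check d^{-1}$. Assume $(q_1,q_2,q_3)$ generic ($q_1^iq_2^jq_3^k=1$ with $i,j,k\in\mathbb Z$ only if $i=j=k$), and the same for $(\check q_1,\check q_2,\check q_3)$. $[x]=(q^x-q^{-x})/(q-q^{-1})$. **Fock space.** Bosons $a^{i,j}_r$ ($r\in\mathbb Z\setminus\{0\}$, $0\le i\le m-1$, $0\le j\le n-1$) satisfy $[a^{i,j}_r,a^{k,l}_s]=\delta_{i,k}\delta_{j,l}\delta_{r+s,0}[r]^2/r$. On the space with basis $|\mathfrak m\rangle$, $\mathfrak m=(\mathfrak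 m_{s,t})\in\mathbb Z^{mn}$, put $e^{\pm\epsilon_{i,j}}|\mathfrak m\rangle=(-1)^{\sum_{s=0}^{i-1}\sum_{t=0}^{n-1}\mathfrak m_{s,t}+\sum_{t=0}^{j-1}\mathfrak m_{i,t}}|\mathfrak m\pm\mathbf 1_{i,j}\rangle$, $\partial_{i,j}|\mathfrak m\rangle=\mathfrak m_{i,j}|\mathfrak m\rangle$, where $\mathbf 1_{i,j}$ is the $(i,j)$ unit vector. $\mathbb F_{m,n}=\mathbb C[\{a^{i,j}_{-r}\}_{r>0}]\otimes\bigoplus_{\mathfrak m}\mathbb C|\mathfrak m\rangle$, where $a^{i,j}_r$ with $r>0$ annihilates $1\otimes|\mathfrak m\rangle$. All operators are extended periodically in $i$ (period $m$) and $j$ (period $n$). The space is graded by $\deg(a^{i_1,j_1}_{-r_1}\cdots a^{i_N,j_N}_{-r_N}|\mathfrak m\rangle)=\sum_{l=1}^Nr_l+\frac12\sum_{s,t}\mathfrak m_{s,t}^2$. Put $\mathsf e_i=\sum_{t=0}^{n-1}\partial_{i,t}$, $\check{\mathsf e}_j=-\sum_{s=0}^{m-1}\partial_{s,j}$. For $r>0$: $b^{i,j}_r=q^r(q_3^ra^{i-1,j}_r-a^{i,j}_r)$, $b^{i,j}_{-r}=q_1^ra^{i-1,j}_{-r}-a^{i,j}_{-r}$, $\check b^{i,j}_r=-q^r(\check q_3^ra^{i,j-1}_r-a^{i,j}_r)$, $\check b^{i,j}_{-r}=-(\check q_1^ra^{i,j-1}_{-r}-a^{i,j}_{-r})$. **Generators.**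 Write $:e^{X(z)}:=\exp(\sum_{r>0}X_{-r}z^r)\exp(\sum_{r>0}X_rz^{-r})$. For $0\le i\le m-1$, $0\le j\le n-1$, $r>0$ let $A^{i,j}_r=-\frac1{[r]}q^{-(n-1)r}\check q_3^{-jr}b^{i,j}_r$, $\ A^{i,j}_{-r}=\frac1{[r]}q^{(n-2)r}\bigl(\check q_3^{jr}b^{i,j}_{-r}+(1-q_2^r)\sum_{t=j+1}^{n-1}\check q_3^{tr}b^{i,t}_{-r}\bigr)$, $B^{i,j}_r=\frac1{[r]}q^r\bigl(\check q_1^{jr}b^{i,j}_r+(1-q_2^{-r})\sum_{t=0}^{j-1}\check q_1^{tr}b^{i,t}_r\bigr)$, $\ B^{i,j}_{-r}=-\frac1{[r]}\check q_1^{-jr}b^{i,j}_{-r}$, $\check A^{i,j}_r=-\frac1{[r]}q^{-(m-1)r}q_3^{-ir}\check b^{i,j}_r$, $\ \check A^{i,j}_{-r}=\frac1{[r]}q^{(m-2)r}\bigl(q_3^{ir}\check b^{i,j}_{-r}+(1-q_2^r)\sum_{s=i+1}^{m-1}q_3^{sr}\check b^{s,j}_{-r}\bigr)$, $\check B^{i,j}_r=\frac1{[r]}q^r\bigl(q_1^{ir}\check b^{i,j}_r+(1-q_2^{-r})\sum_{s=0}^{i-1}q_1^{sr}\check b^{s,j}_r\bigr)$, $\ \check B^{i,j}_{-r}=-\frac1{[r]}q_1^{-ir}\check b^{i,j}_{-r}$. For $1\le i\le m-1$: $U^{i,j}(z)=e^{-\epsilon_{i,j}}e^{\epsilon_{i-1,j}}(q^{n-1-j}z)^{\partial_{i-1,j}-\partial_{i,j}+1}d^{(1/2-i)\mathsf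 e_{i-1}+(1/2+i)\mathsf e_i+i(\partial_{i-1,j}-\partial_{i,j})}q^{-\sum_{t=j+1}^{n-1}(\partial_{i-1,t}-\partial_{i,t})}$, $V^{i,j}(z)=e^{-\epsilon_{i-1,j}}e^{\epsilon_{i,j}}(q^jz)^{-\partial_{i-1,j}+\partial_{i,j}+1}d^{-(1/2-i)\mathsf e_{i-1}-(1/2+i)\mathsf e_i-i(\partial_{i-1,j}-\partial_{i,j})}q^{\sum_{t=0}^{j-1}(\partial_{i-1,t}-\partial_{i,t})}$, $E_i(z)=\sum_{j=0}^{n-1}:e^{A^{i,j}(z)}:U^{i,j}(z)$, $\ F_i(z)=\sum_{j=0}^{n-1}:e^{B^{i,j}(z)}:V^{i,j}(z)$, and $D=q^{\deg}$. For $1\le l\le n-1$: $\check U^{i,l}(z)=e^{\epsilon_{i,l}}e^{-\epsilon_{i,l-1}}(q^{m-1-i}z)^{-\partial_{i,l-1}+\partial_{i,l}+1}\check d^{(1/2-l)\check{\mathsf e}_{l-1}+(1/2+l)\check{\mathsf e}_l-l(\partial_{i,l-1}-\partial_{i,l})}q^{\sum_{s=i+1}^{m-1}(\partial_{s,l-1}-\partial_{s,l})}$, $\check V^{i,l}(z)=e^{\epsilon_{i,l-1}}e^{-\epsilon_{i,l}}(q^iz)^{\partial_{i,l-1}-\partial_{i,l}+1}\check d^{-(1/2-l)\check{\mathsf e}_{l-1}-(1/2+l)\check{\mathsf e}_l+l(\partial_{i,l-1}-\partial_{i,l})}q^{-\sum_{s=0}^{i-1}(\partial_{s,l-1}-\partial_{s,l})}$,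 $\check E_l(z)=\sum_{i=0}^{m-1}:e^{\check A^{i,l}(z)}:\check U^{i,l}(z)$, $\ \check F_l(z)=\sum_{i=0}^{m-1}:e^{\check B^{i,l}(z)}:\check V^{i,l}(z)$, and $\check D=q^{\deg}$. These are the images of the corresponding generators of the quantum toroidal algebras $\mathcal E_m(q_1,q_2,q_3)$ of type $\mathfrak{gl}_m$ (acting at level $n$, i.e. with its central element $C$ acting as $q^n$) and $\mathcal E_n(\check q_1,q_2,\check q_3)$ of type $\mathfrak{gl}_n$ (acting at level $m$) on $\mathbb F_{m,n}$.
   Formalization: Since D and Ď both act as q^deg, D does not commute with Ě_l(z), F̌_l(z), nor Ď with E_i(z), F_i(z); proved instead: the algebras generated by the currents alone commute, D commutes with Ď, and D, Ď rescale the z^k coefficient of the other side's currents by q^k. *)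

theory Defs
  imports Complex_Main "HOL-Library.Poly_Mapping" "HOL-Library.Function_Algebras"
begin

text \<open>
  A basis state is a pair \<open>(\<mu>, M)\<close>: \<open>\<mu> (i, j, r)\<close> is the exponent of the variable
  \<open>a\<^bsup>i,j\<^esup>\<^bsub>-r\<^esub>\<close> (\<open>r > 0\<close>) in a monomial, and \<open>M\<close> is the lattice point labelling the ket.
  Indices range over all of \<open>int\<close> in the types; the Fock space of a given size is the
  subspace \<open>Fock\<close> below.
\<close>

type_synonym lattice = "int \<times> int \<Rightarrow>\<^sub>0 int"
type_synonym state = "(int \<times> int \<times> int \<Rightarrow>\<^sub>0 nat) \<times> lattice"
type_synonym vec = "state \<Rightarrow>\<^sub>0 complex"
type_synonym oper = "vec \<Rightarrow> vec"

text \<open>A current \<open>X\<close> stands for the formal series \<open>\<Sum>k. X k z\<^sup>k\<close> (note the sign of the exponent).\<close>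

type_synonym current = "int \<Rightarrow> oper"

definition ket :: "state \<Rightarrow> vec" where
  "ket b = Poly_Mapping.single b 1"

definition scale :: "complex \<Rightarrow> vec \<Rightarrow> vec" where
  "scale c v = Poly_Mapping.map ((*) c) v"

definition oscale :: "complex \<Rightarrow> oper \<Rightarrow> oper"  (infixr \<open>*\<^sub>o\<close> 72) where
  "c *\<^sub>o X = (\<lambda>v. scale c (X v))"

text \<open>Linear extension of a map given on basis states.\<close>

definition linext :: "(state \<Rightarrow> vec) \<Rightarrow> oper" where
  "linext f v = (\<Sum>b\<in>Poly_Mapping.keys v. scale (Poly_Mapping.lookup v b) (f b))"

lemma lookup_scale [simp]: "Poly_Mapping.lookup (scale c v) b = c * Poly_Mapping.lookup v b"
  by (simp add: scale_def Poly_Mapping.map.rep_eq when_def)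

lemma scale_zero_right [simp]: "scale c 0 = 0"
  by (rule poly_mapping_eqI) simp

lemma scale_zero_left [simp]: "scale 0 v = 0"
  by (rule poly_mapping_eqI) simp

lemma scale_one [simp]: "scale 1 v = v"
  by (rule poly_mapping_eqI) simp

lemma scale_scale [simp]: "scale c (scale c' v) = scale (c * c') v"
  by (rule poly_mapping_eqI) simp

lemma scale_add_right: "scale c (v + w) = scale c v + scale c w"
  by (rule poly_mapping_eqI) (simp add: lookup_add algebra_simps)

lemma scale_add_left: "scale (c + c') v = scale c v + scale c' v"
  by (rule poly_mapping_eqI) (simp add: lookup_add algebra_simps)

lemma linext_ket [simp]: "linext f (ket b) = f b"
  by (simp add: linext_def ket_def)

lemma linext_superset:
  assumes "finite S" "Poly_Mapping.keys v \<subseteq> S"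
  shows "linext f v = (\<Sum>b\<in>S. scale (Poly_Mapping.lookup v b) (f b))"
  unfolding linext_def
  by (rule sum.mono_neutral_left) (use assms in \<open>auto simp: in_keys_iff\<close>)

lemma linext_add: "linext f (v + w) = linext f v + linext f w"
proof -
  let ?S = "Poly_Mapping.keys v \<union> Poly_Mapping.keys w"
  have "Poly_Mapping.keys (v + w) \<subseteq> ?S" by (rule Poly_Mapping.keys_add)
  then show ?thesis
    by (simp add: linext_superset[of ?S] lookup_add scale_add_left sum.distrib)
qed

lemma linext_scale: "linext f (scale c v) = scale c (linext f v)"
proof -
  have "Poly_Mapping.keys (scale c v) \<subseteq> Poly_Mapping.keys v"
    by (auto simp: in_keys_iff)
  moreover have "scale c (sum g S) = (\<Sum>b\<in>S. scale c (g b))" for g and S :: "state set"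
    by (induction S rule: infinite_finite_induct) (auto simp: scale_add_right)
  ultimately show ?thesis
    by (simp add: linext_superset[of "Poly_Mapping.keys v"])
qed

definition diag :: "(lattice \<Rightarrow> complex) \<Rightarrow> oper" where
  "diag f = linext (\<lambda>(\<mu>, M). scale (f M) (ket (\<mu>, M)))"

text \<open>
  Products and exponentials of currents are computed pointwise on vectors.  In all uses below,
  only finitely many terms are nonzero on any given vector, so that \<open>Sum_any\<close> is a genuine sum.
\<close>

definition cmult :: "current \<Rightarrow> current \<Rightarrow> current"  (infixl \<open>\<odot>\<close> 70) where
  "(X \<odot> Y) k v = Sum_any (\<lambda>p. X (k - p) (Y p v))"

primrec cpower :: "current \<Rightarrow> nat \<Rightarrow> current" where
  "cpower X 0 = (\<lambda>k. if k = 0 then id else 0)"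
| "cpower X (Suc N) = X \<odot> cpower X N"

definition cexp :: "current \<Rightarrow> current" where
  "cexp X k v = Sum_any (\<lambda>N. scale (1 / fact N) (cpower X N k v))"

text \<open>
  The normally ordered exponential of a family of modes \<open>X r\<close>, \<open>r \<noteq> 0\<close>; the mode \<open>X r\<close> is the
  coefficient of \<open>z\<^bsup>-r\<^esup>\<close>.
\<close>

definition nexp :: "(int \<Rightarrow> oper) \<Rightarrow> current" where
  "nexp X = cexp (\<lambda>k. if k > 0 then X (- k) else 0) \<odot> cexp (\<lambda>k. if k < 0 then X (- k) else 0)"

text \<open>The series \<open>(c z)\<^sup>N\<close> for an integer-valued function \<open>N\<close> of the lattice operators.\<close>

definition zpow :: "complex \<Rightarrow> (lattice \<Rightarrow> int) \<Rightarrow> current" where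
  "zpow c N k = diag (\<lambda>M. if N M = k then c powi k else 0)"

text \<open>The unital algebra of operators generated by a set.\<close>

inductive_set op_algebra :: "oper set \<Rightarrow> oper set" for G :: "oper set" where
  gen: "X \<in> G \<Longrightarrow> X \<in> op_algebra G"
| one: "id \<in> op_algebra G"
| add: "X \<in> op_algebra G \<Longrightarrow> Y \<in> op_algebra G \<Longrightarrow> X + Y \<in> op_algebra G"
| scalar: "X \<in> op_algebra G \<Longrightarrow> c *\<^sub>o X \<in> op_algebra G"
| comp: "X \<in> op_algebra G \<Longrightarrow> Y \<in> op_algebra G \<Longrightarrow> X \<circ> Y \<in> op_algebra G"

definition generic :: "complex \<Rightarrow> complex \<Rightarrow> complex \<Rightarrow> bool" where
  "generic x y z \<longleftrightarrow>
    (\<forall>i j k :: int. x powi i * y powi j * z powi k = 1 \<longrightarrow> i = j \<and> j = k)"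

text \<open>
  The parameters are the sizes \<open>m, n\<close> and the fixed square roots \<open>sq, sd, sdc\<close> of \<open>q\<close>, \<open>d\<close> and
  \<open>d\<close> with a check accent.  A suffix \<open>c\<close> in a name stands for a check accent.  Half-integral powers of
  \<open>q, d, dc\<close> are integral powers of the square roots, with doubled exponents.
\<close>

locale toroidal_fock =
  fixes m n :: int and sq sd sdc :: complex
begin

definition q :: complex where "q = sq ^ 2"
definition d :: complex where "d = sd ^ 2"
definition dc :: complex where "dc = sdc ^ 2"

definition q1 :: complex where "q1 = inverse q * d"
definition q2 :: complex where "q2 = q ^ 2"
definition q3 :: complex where "q3 = inverse q * inverse d"
definition q1c :: complex where "q1c = inverse q * dc"
definition q3c :: complex where "q3c = inverse q * inverse dc"

definition qint :: "int \<Rightarrow> complex" where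
  "qint x = (q powi x - q powi (- x)) / (q - inverse q)"

definition Fock :: "vec set" where
  "Fock = {v. \<forall>(\<mu>, M) \<in> Poly_Mapping.keys v.
      Poly_Mapping.keys \<mu> \<subseteq> {0..<m} \<times> {0..<n} \<times> {1..} \<and>
      Poly_Mapping.keys M \<subseteq> {0..<m} \<times> {0..<n}}"

text \<open>
  \<open>a i j (-r)\<close> multiplies by the variable \<open>a\<^bsup>i,j\<^esup>\<^bsub>-r\<^esub>\<close>; \<open>a i j r\<close> is \<open>[r]\<^sup>2 / r\<close> times the partial
  derivative with respect to that variable.
\<close>

definition a :: "int \<Rightarrow> int \<Rightarrow> int \<Rightarrow> oper" where
  "a i j r = linext (\<lambda>(\<mu>, M).
     let x = Poly_Mapping.single (i mod m, j mod n, \<bar>r\<bar>) (1::nat) in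
     if r < 0 then ket (\<mu> + x, M)
     else scale (qint r ^ 2 / of_int r * of_nat (Poly_Mapping.lookup \<mu> (i mod m, j mod n, r)))
            (ket (\<mu> - x, M)))"

definition del :: "int \<Rightarrow> int \<Rightarrow> lattice \<Rightarrow> int" where
  "del i j M = Poly_Mapping.lookup M (i mod m, j mod n)"

text \<open>The operator \<open>e\<^bsup>\<sigma>\<epsilon>\<^esup>\<close> with \<open>\<epsilon> = \<epsilon>\<^bsub>i,j\<^esub>\<close>, for \<open>\<sigma> = 1\<close> and \<open>\<sigma> = -1\<close>.\<close>

definition eeps :: "int \<Rightarrow> int \<Rightarrow> int \<Rightarrow> oper" where
  "eeps \<sigma> i j = linext (\<lambda>(\<mu>, M).
     scale ((-1) powi ((\<Sum>s=0..i mod m - 1. \<Sum>t=0..n - 1. del s t M) +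
                       (\<Sum>t=0..j mod n - 1. del i t M)))
       (ket (\<mu>, M + Poly_Mapping.single (i mod m, j mod n) \<sigma>)))"

definition e :: "int \<Rightarrow> lattice \<Rightarrow> int" where
  "e i M = (\<Sum>t=0..n - 1. del i t M)"

definition ec :: "int \<Rightarrow> lattice \<Rightarrow> int" where
  "ec j M = - (\<Sum>s=0..m - 1. del s j M)"

definition twice_deg :: "state \<Rightarrow> int" where
  "twice_deg = (\<lambda>(\<mu>, M).
     2 * (\<Sum>(i, j, r)\<in>Poly_Mapping.keys \<mu>. int (Poly_Mapping.lookup \<mu> (i, j, r)) * r) +
     (\<Sum>s=0..m - 1. \<Sum>t=0..n - 1. (del s t M) ^ 2))"

definition D :: oper where
  "D = linext (\<lambda>b. scale (sq powi twice_deg b) (ket b))"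

definition Dc :: oper where
  "Dc = linext (\<lambda>b. scale (sq powi twice_deg b) (ket b))"

definition b :: "int \<Rightarrow> int \<Rightarrow> int \<Rightarrow> oper" where
  "b i j r = (if r > 0 then q powi r *\<^sub>o (q3 powi r *\<^sub>o a (i - 1) j r - a i j r)
              else q1 powi (- r) *\<^sub>o a (i - 1) j r - a i j r)"

definition bc :: "int \<Rightarrow> int \<Rightarrow> int \<Rightarrow> oper" where
  "bc i j r = (if r > 0 then (- (q powi r)) *\<^sub>o (q3c powi r *\<^sub>o a i (j - 1) r - a i j r)
               else (- 1) *\<^sub>o (q1c powi (- r) *\<^sub>o a i (j - 1) r - a i j r))"

text \<open>
  The families below are indexed by all \<open>r \<noteq> 0\<close>; the value at \<open>r = 0\<close> is never used.
\<close>

definition A :: "int \<Rightarrow> int \<Rightarrow> int \<Rightarrow> oper" where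
  "A i j r =
     (if r > 0 then (- (1 / qint r) * q powi (- (n - 1) * r) * q3c powi (- j * r)) *\<^sub>o b i j r
      else let p = - r in
        (1 / qint p * q powi ((n - 2) * p)) *\<^sub>o
          (q3c powi (j * p) *\<^sub>o b i j (- p) +
           (1 - q2 powi p) *\<^sub>o (\<Sum>t=j + 1..n - 1. q3c powi (t * p) *\<^sub>o b i t (- p))))"

definition B :: "int \<Rightarrow> int \<Rightarrow> int \<Rightarrow> oper" where
  "B i j r =
     (if r > 0 then
        (1 / qint r * q powi r) *\<^sub>o
          (q1c powi (j * r) *\<^sub>o b i j r +
           (1 - q2 powi (- r)) *\<^sub>o (\<Sum>t=0..j - 1. q1c powi (t * r) *\<^sub>o b i t r))
      else let p = - r in (- (1 / qint p) * q1c powi (- j * p)) *\<^sub>o b i j (- p))"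

definition Ac :: "int \<Rightarrow> int \<Rightarrow> int \<Rightarrow> oper" where
  "Ac i j r =
     (if r > 0 then (- (1 / qint r) * q powi (- (m - 1) * r) * q3 powi (- i * r)) *\<^sub>o bc i j r
      else let p = - r in
        (1 / qint p * q powi ((m - 2) * p)) *\<^sub>o
          (q3 powi (i * p) *\<^sub>o bc i j (- p) +
           (1 - q2 powi p) *\<^sub>o (\<Sum>s=i + 1..m - 1. q3 powi (s * p) *\<^sub>o bc s j (- p))))"

definition Bc :: "int \<Rightarrow> int \<Rightarrow> int \<Rightarrow> oper" where
  "Bc i j r =
     (if r > 0 then
        (1 / qint r * q powi r) *\<^sub>o
          (q1 powi (i * r) *\<^sub>o bc i j r +
           (1 - q2 powi (- r)) *\<^sub>o (\<Sum>s=0..i - 1. q1 powi (s * r) *\<^sub>o bc s j r))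
      else let p = - r in (- (1 / qint p) * q1 powi (- i * p)) *\<^sub>o bc i j (- p))"

definition U :: "int \<Rightarrow> int \<Rightarrow> current" where
  "U i j = (\<lambda>k.
     eeps (- 1) i j \<circ> eeps 1 (i - 1) j \<circ>
     zpow (q powi (n - 1 - j)) (\<lambda>M. del (i - 1) j M - del i j M + 1) k \<circ>
     diag (\<lambda>M. sd powi ((1 - 2 * i) * e (i - 1) M + (1 + 2 * i) * e i M
                          + 2 * i * (del (i - 1) j M - del i j M))) \<circ>
     diag (\<lambda>M. q powi (- (\<Sum>t=j + 1..n - 1. del (i - 1) t M - del i t M))))"

definition V :: "int \<Rightarrow> int \<Rightarrow> current" where
  "V i j = (\<lambda>k.
     eeps (- 1) (i - 1) j \<circ> eeps 1 i j \<circ>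
     zpow (q powi j) (\<lambda>M. - del (i - 1) j M + del i j M + 1) k \<circ>
     diag (\<lambda>M. sd powi (- (1 - 2 * i) * e (i - 1) M - (1 + 2 * i) * e i M
                          - 2 * i * (del (i - 1) j M - del i j M))) \<circ>
     diag (\<lambda>M. q powi (\<Sum>t=0..j - 1. del (i - 1) t M - del i t M)))"

definition Uc :: "int \<Rightarrow> int \<Rightarrow> current" where
  "Uc i l = (\<lambda>k.
     eeps 1 i l \<circ> eeps (- 1) i (l - 1) \<circ>
     zpow (q powi (m - 1 - i)) (\<lambda>M. - del i (l - 1) M + del i l M + 1) k \<circ>
     diag (\<lambda>M. sdc powi ((1 - 2 * l) * ec (l - 1) M + (1 + 2 * l) * ec l M
                           - 2 * l * (del i (l - 1) M - del i l M))) \<circ>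
     diag (\<lambda>M. q powi (\<Sum>s=i + 1..m - 1. del s (l - 1) M - del s l M)))"

definition Vc :: "int \<Rightarrow> int \<Rightarrow> current" where
  "Vc i l = (\<lambda>k.
     eeps 1 i (l - 1) \<circ> eeps (- 1) i l \<circ>
     zpow (q powi i) (\<lambda>M. del i (l - 1) M - del i l M + 1) k \<circ>
     diag (\<lambda>M. sdc powi (- (1 - 2 * l) * ec (l - 1) M - (1 + 2 * l) * ec l M
                           + 2 * l * (del i (l - 1) M - del i l M))) \<circ>
     diag (\<lambda>M. q powi (- (\<Sum>s=0..i - 1. del s (l - 1) M - del s l M))))"

definition E :: "int \<Rightarrow> current" where
  "E i = (\<Sum>j=0..n - 1. nexp (A i j) \<odot> U i j)"

definition F :: "int \<Rightarrow> current" where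
  "F i = (\<Sum>j=0..n - 1. nexp (B i j) \<odot> V i j)"

definition Ec :: "int \<Rightarrow> current" where
  "Ec l = (\<Sum>i=0..m - 1. nexp (Ac i l) \<odot> Uc i l)"

definition Fc :: "int \<Rightarrow> current" where
  "Fc l = (\<Sum>i=0..m - 1. nexp (Bc i l) \<odot> Vc i l)"

text \<open>
  The algebras generated by the coefficients of the currents.  The grading operators \<open>D\<close> and \<open>Dc\<close>
  are kept apart: both are \<open>q\<^bsup>deg\<^esup>\<close>, which rescales the spectral parameter of the currents of both
  algebras (\<open>D E(z) D\<^bsup>-1\<^esup> = E(q z)\<close>) and hence does not commute with their nonzero modes.
\<close>

definition Um_currents :: "oper set" where
  "Um_currents = op_algebra (\<Union>i\<in>{1..m - 1}. range (E i) \<union> range (F i))"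

definition Un_currents :: "oper set" where
  "Un_currents = op_algebra (\<Union>l\<in>{1..n - 1}. range (Ec l) \<union> range (Fc l))"

lemma heisenberg:
  assumes "0 \<le> i" "i < m" "0 \<le> j" "j < n" "0 \<le> k" "k < m" "0 \<le> l" "l < n" "r > 0" "s > 0"
  shows "a i j r (a k l (- s) (ket x)) - a k l (- s) (a i j r (ket x)) =
    scale (if i = k \<and> j = l \<and> r = s then qint r ^ 2 / of_int r else 0) (ket x)"
proof (cases x)
  case (Pair \<mu> M)
  let ?x = "Poly_Mapping.single (i, j, r) (1::nat)"
  let ?y = "Poly_Mapping.single (k, l, s) (1::nat)"
  show ?thesis
  proof (cases "i = k \<and> j = l \<and> r = s")
    case True
    have "Poly_Mapping.lookup \<mu> (i, j, r) = 0 \<or> \<mu> - ?x + ?x = \<mu>"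
      by (auto intro!: poly_mapping_eqI simp: lookup_add lookup_minus lookup_single when_def)
    moreover have "scale (c / z) w - scale (c' / z) w = scale ((c - c') / z) w" for c c' z w
      by (rule poly_mapping_eqI) (simp add: lookup_minus algebra_simps diff_divide_distrib)
    ultimately show ?thesis using True assms
      by (auto simp: Pair a_def Let_def lookup_add linext_scale lookup_single add.commute
          distrib_left)
  next
    case False
    then have "\<mu> + ?y - ?x = \<mu> - ?x + ?y \<or> Poly_Mapping.lookup \<mu> (i, j, r) = 0"
      by (auto intro!: poly_mapping_eqI simp: lookup_add lookup_minus lookup_single when_def)
    then show ?thesis using False assms
      by (auto simp: Pair a_def Let_def lookup_add linext_scale lookup_single when_def)
  qed
qed

lemma Fock_zero: "0 \<in> Fock"
  by (simp add: Fock_def)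

lemma Fock_add: "v \<in> Fock \<Longrightarrow> w \<in> Fock \<Longrightarrow> v + w \<in> Fock"
  using Poly_Mapping.keys_add[of v w] unfolding Fock_def by blast

lemma Fock_scale: "v \<in> Fock \<Longrightarrow> scale c v \<in> Fock"
  unfolding Fock_def by (auto simp: in_keys_iff)

lemma Fock_sum: "(\<And>x. x \<in> S \<Longrightarrow> f x \<in> Fock) \<Longrightarrow> sum f S \<in> Fock"
  by (induction S rule: infinite_finite_induct) (auto simp: Fock_zero Fock_add)

text \<open>The operators of both algebras act on the Fock space.\<close>

definition preserves :: "oper \<Rightarrow> bool" where
  "preserves X \<longleftrightarrow> (\<forall>v\<in>Fock. X v \<in> Fock)"

lemma preserves_zero: "preserves 0"
  by (simp add: preserves_def Fock_zero)

lemma preserves_id: "preserves id"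
  by (simp add: preserves_def)

lemma preserves_add: "preserves X \<Longrightarrow> preserves Y \<Longrightarrow> preserves (X + Y)"
  by (simp add: preserves_def Fock_add)

lemma preserves_oscale: "preserves X \<Longrightarrow> preserves (c *\<^sub>o X)"
  by (simp add: preserves_def Fock_scale oscale_def)

lemma preserves_diff: "preserves X \<Longrightarrow> preserves Y \<Longrightarrow> preserves (X - Y)"
proof -
  assume *: "preserves X" "preserves Y"
  have "X - Y = X + (- 1) *\<^sub>o Y"
    by (rule ext, rule poly_mapping_eqI) (simp add: oscale_def lookup_add lookup_minus)
  with * show ?thesis by (metis preserves_add preserves_oscale)
qed

lemma preserves_comp: "preserves X \<Longrightarrow> preserves Y \<Longrightarrow> preserves (X \<circ> Y)"
  by (simp add: preserves_def)

lemma preserves_sum: "(\<And>x. x \<in> S \<Longrightarrow> preserves (f x)) \<Longrightarrow> preserves (sum f S)"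
  by (induction S rule: infinite_finite_induct) (auto simp: preserves_zero preserves_add)

lemma preserves_linext:
  assumes "\<And>\<mu> M. Poly_Mapping.keys \<mu> \<subseteq> {0..<m} \<times> {0..<n} \<times> {1..} \<Longrightarrow>
    Poly_Mapping.keys M \<subseteq> {0..<m} \<times> {0..<n} \<Longrightarrow> f (\<mu>, M) \<in> Fock"
  shows "preserves (linext f)"
  unfolding preserves_def linext_def
proof (intro ballI Fock_sum Fock_scale)
  fix v x assume "v \<in> Fock" "x \<in> Poly_Mapping.keys v"
  then have "Poly_Mapping.keys (fst x) \<subseteq> {0..<m} \<times> {0..<n} \<times> {1..}"
    "Poly_Mapping.keys (snd x) \<subseteq> {0..<m} \<times> {0..<n}"
    by (fastforce simp: Fock_def)+
  then show "f x \<in> Fock"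
    using assms[of "fst x" "snd x"] by simp
qed

lemma preserves_cmult:
  "(\<And>k. preserves (X k)) \<Longrightarrow> (\<And>k. preserves (Y k)) \<Longrightarrow> preserves ((X \<odot> Y) k)"
  unfolding preserves_def cmult_def Sum_any.expand_set by (auto intro!: Fock_sum)

lemma preserves_cexp: "(\<And>k. preserves (X k)) \<Longrightarrow> preserves (cexp X k)"
proof -
  assume *: "\<And>k. preserves (X k)"
  have "preserves (cpower X N k)" for N k
    by (induction N arbitrary: k) (auto simp: preserves_id preserves_zero preserves_cmult *)
  then show ?thesis
    unfolding preserves_def cexp_def Sum_any.expand_set by (auto intro!: Fock_sum Fock_scale)
qed

lemma ket_Fock:
  "Poly_Mapping.keys \<mu> \<subseteq> {0..<m} \<times> {0..<n} \<times> {1..} \<Longrightarrow>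
    Poly_Mapping.keys M \<subseteq> {0..<m} \<times> {0..<n} \<Longrightarrow> ket (\<mu>, M) \<in> Fock"
  by (simp add: Fock_def ket_def)

lemma preserves_diag: "preserves (diag f)"
  unfolding diag_def by (rule preserves_linext) (simp add: Fock_scale ket_Fock)

lemma preserves_D: "preserves D" "preserves Dc"
  unfolding D_def Dc_def by (rule preserves_linext; simp add: Fock_scale ket_Fock)+

end

locale toroidal_fock_pos = toroidal_fock +
  assumes m_pos: "m > 0" and n_pos: "n > 0"
begin

lemma preserves_eeps: "preserves (eeps \<sigma> i j)"
proof -
  have *: "Poly_Mapping.keys (M + Poly_Mapping.single (i mod m, j mod n) \<sigma>) \<subseteq> {0..<m} \<times> {0..<n}"
    if "Poly_Mapping.keys M \<subseteq> {0..<m} \<times> {0..<n}" for M :: lattice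
  proof -
    have "Poly_Mapping.keys (M + Poly_Mapping.single (i mod m, j mod n) \<sigma>)
      \<subseteq> Poly_Mapping.keys M \<union> {(i mod m, j mod n)}"
      using Poly_Mapping.keys_add[of M "Poly_Mapping.single (i mod m, j mod n) \<sigma>"]
      by (auto split: if_splits)
    then show ?thesis using that m_pos n_pos by fastforce
  qed
  show ?thesis
    unfolding eeps_def by (rule preserves_linext) (simp add: Fock_scale ket_Fock *)
qed

lemma preserves_a:
  assumes "r \<noteq> 0"
  shows "preserves (a i j r)"
proof -
  let ?x = "Poly_Mapping.single (i mod m, j mod n, \<bar>r\<bar>) (1::nat)"
  have plus: "Poly_Mapping.keys (\<mu> + ?x) \<subseteq> {0..<m} \<times> {0..<n} \<times> {1..}"
    if "Poly_Mapping.keys \<mu> \<subseteq> {0..<m} \<times> {0..<n} \<times> {1..}" for \<mu>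
  proof -
    have "Poly_Mapping.keys (\<mu> + ?x) \<subseteq> Poly_Mapping.keys \<mu> \<union> {(i mod m, j mod n, \<bar>r\<bar>)}"
      using Poly_Mapping.keys_add[of \<mu> ?x] by simp
    moreover have "(i mod m, j mod n, \<bar>r\<bar>) \<in> {0..<m} \<times> {0..<n} \<times> {1..}"
      using assms m_pos n_pos by simp
    ultimately show ?thesis using that by blast
  qed
  have minus: "Poly_Mapping.keys (\<mu> - ?x) \<subseteq> {0..<m} \<times> {0..<n} \<times> {1..}"
    if "Poly_Mapping.keys \<mu> \<subseteq> {0..<m} \<times> {0..<n} \<times> {1..}" for \<mu>
  proof -
    have "Poly_Mapping.keys (\<mu> - ?x) \<subseteq> Poly_Mapping.keys \<mu>"
      by (auto simp: in_keys_iff lookup_minus)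
    then show ?thesis using that by blast
  qed
  show ?thesis
    unfolding a_def Let_def
    by (rule preserves_linext)
       (simp only: prod.case split: if_split, intro conjI impI Fock_scale ket_Fock plus minus)
qed

lemma preserves_b: "r \<noteq> 0 \<Longrightarrow> preserves (b i j r)" "r \<noteq> 0 \<Longrightarrow> preserves (bc i j r)"
  unfolding b_def bc_def by (auto intro!: preserves_oscale preserves_diff preserves_a)

lemma preserves_modes:
  assumes "r \<noteq> 0"
  shows "preserves (A i j r)" "preserves (B i j r)" "preserves (Ac i j r)" "preserves (Bc i j r)"
  unfolding A_def B_def Ac_def Bc_def Let_def
  using assms by (auto intro!: preserves_oscale preserves_add preserves_sum preserves_b)

lemma preserves_nexp: "(\<And>r. r \<noteq> 0 \<Longrightarrow> preserves (X r)) \<Longrightarrow> preserves (nexp X k)"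
  unfolding nexp_def by (auto intro!: preserves_cmult preserves_cexp simp: preserves_zero)

lemma preserves_zero_modes:
  "preserves (U i j k)" "preserves (V i j k)" "preserves (Uc i j k)" "preserves (Vc i j k)"
  unfolding U_def V_def Uc_def Vc_def zpow_def
  by (auto intro!: preserves_comp preserves_eeps preserves_diag simp del: o_apply)

lemma sum_current: "(\<Sum>x\<in>S. f x) (k::int) = (\<Sum>x\<in>S. f x k :: oper)"
  by (induction S rule: infinite_finite_induct) auto

lemma preserves_currents:
  "preserves (E i k)" "preserves (F i k)" "preserves (Ec l k)" "preserves (Fc l k)"
  unfolding E_def F_def Ec_def Fc_def sum_current
  by (auto intro!: preserves_sum preserves_cmult preserves_nexp preserves_modes
      preserves_zero_modes)

lemma preserves_op_algebra:
  "X \<in> op_algebra G \<Longrightarrow> (\<And>Y. Y \<in> G \<Longrightarrow> preserves Y) \<Longrightarrow> preserves X"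
  by (induction rule: op_algebra.induct)
     (auto intro: preserves_id preserves_add preserves_oscale preserves_comp)

lemma preserves_Um_currents: "X \<in> Um_currents \<Longrightarrow> preserves X"
  unfolding Um_currents_def by (erule preserves_op_algebra) (auto simp: preserves_currents)

lemma preserves_Un_currents: "X \<in> Un_currents \<Longrightarrow> preserves X"
  unfolding Un_currents_def by (erule preserves_op_algebra) (auto simp: preserves_currents)

end

end

theory Submission
  imports Defs
begin

text \<open>
  Every coefficient of \<open>E\<close>, \<open>F\<close> is a sum over \<open>j\<close> of coefficients of vertex operators
  \<open>W\<^sub>j(z)\<close>, and every coefficient of \<open>Ec\<close>, \<open>Fc\<close> is a sum over \<open>k\<close> of coefficients of vertex
  operators \<open>W'\<^sub>k(w)\<close>.  Moving the annihilators of one vertex operator past the creators of the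
  other costs a factor \<open>(1 - c w/z)\<^sup>\<nu>\<close>, and the lattice parts supply \<open>z\<^sup>\<nu>\<close> up to a constant, where
  \<open>\<nu>\<close> is the inner product of the two lattice shifts and hence \<open>0\<close>, \<open>1\<close> or \<open>-1\<close>.

  \<^item> If \<open>\<nu> = 0\<close>, there is no contraction and the vertex operators commute.
  \<^item> If \<open>\<nu> = 1\<close>, both orders of multiplication give the same polynomial factor \<open>z - c w\<close> times the
    same normally ordered product, so they commute as well.
  \<^item> If \<open>\<nu> = -1\<close>, the two orders give the two opposite expansions of \<open>1/(z - c w)\<close>.  The commutator
    is therefore a delta function supported at \<open>z = c w\<close>, multiplied by the normally ordered product
    at that point, and this is again a normally ordered exponential, of the modes \<open>fused\<close>.

  For given rows and columns exactly two pairs \<open>(j, k)\<close> have \<open>\<nu> = -1\<close>.  They have the same pole \<open>c\<close>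
  and the same fused modes (\<open>fused_pole\<close>): the difference of the two sets of modes for neighbouring
  \<open>j\<close> and the difference for neighbouring \<open>k\<close> are multiples of one and the same combination \<open>\<Omega>\<close>
  of the oscillators at the four corners of a square.  The sign rules of the lattice operators make
  the two contributions opposite (\<open>\<sigma>_pole\<close>), so they cancel (\<open>pole_pair_cancel\<close>).

  All four combinations of \<open>E\<close>, \<open>F\<close> with \<open>Ec\<close>, \<open>Fc\<close> are treated at once: the sign \<open>sg = 1\<close> stands for
  \<open>E\<close> or \<open>Ec\<close>, the sign \<open>sg = -1\<close> for \<open>F\<close> or \<open>Fc\<close>.

  The delta function argument needs honest sums.  The coefficients of the exponentials are
  controlled by the recursion \<open>is_exp\<close>, which turns statements about them into inductions, and
  a filtration by energy shows that only finitely many annihilation terms act nontrivially on a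
  given vector.  The relations with \<open>D\<close> hold because each mode and each zero mode is homogeneous.
\<close>

section \<open>Linear operators\<close>

lemma vector_space_scale: "vector_space scale"
  by unfold_locales (auto simp: scale_add_right scale_add_left)

interpretation vec: vector_space scale
  by (rule vector_space_scale)

abbreviation lin :: "oper \<Rightarrow> bool" where
  "lin \<equiv> module_hom scale scale"

lemma linI:
  "(\<And>v w. X (v + w) = X v + X w) \<Longrightarrow> (\<And>c v. X (scale c v) = scale c (X v)) \<Longrightarrow> lin X"
  by (simp add: module_hom_iff vec.module_axioms)

lemma sum_apply: "(\<Sum>x\<in>S. f x) v = (\<Sum>x\<in>S. f x v :: vec)"
  by (induction S rule: infinite_finite_induct) auto

lemma lin_linext [simp]: "lin (linext f)"
  by (intro linI linext_add linext_scale)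

lemma lin_id [simp]: "lin id"
  by (intro linI) auto

lemma lin_zero [simp]: "lin 0"
  by (intro linI) auto

lemma lin_add: "lin X \<Longrightarrow> lin Y \<Longrightarrow> lin (X + Y)"
  by (intro linI) (auto simp: module_hom.add module_hom.scale scale_add_right)

lemma lin_diff: "lin X \<Longrightarrow> lin Y \<Longrightarrow> lin (X - Y)"
  by (intro linI) (auto simp: module_hom.add module_hom.scale vec.scale_right_diff_distrib)

lemma lin_oscale: "lin X \<Longrightarrow> lin (c *\<^sub>o X)"
  by (intro linI) (auto simp: oscale_def module_hom.add module_hom.scale scale_add_right mult.commute)

lemma lin_comp: "lin X \<Longrightarrow> lin Y \<Longrightarrow> lin (X \<circ> Y)"
  by (intro linI) (auto simp: module_hom.add module_hom.scale)

lemma lin_sum: "(\<And>x. x \<in> S \<Longrightarrow> lin (f x)) \<Longrightarrow> lin (\<Sum>x\<in>S. f x)"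
  by (induction S rule: infinite_finite_induct) (auto intro: lin_add)

text \<open>
  Kets form a basis, so identities between linear operators can be checked on them.
\<close>

lemma linext_ket_id: "linext ket v = v"
proof (rule poly_mapping_eqI)
  fix b
  have "Poly_Mapping.lookup (linext ket v) b =
      (\<Sum>x\<in>Poly_Mapping.keys v. Poly_Mapping.lookup (scale (Poly_Mapping.lookup v x) (ket x)) b)"
    unfolding linext_def by (induction "Poly_Mapping.keys v" rule: infinite_finite_induct) (auto simp: lookup_sum)
  also have "\<dots> = Poly_Mapping.lookup v b"
    by (auto simp: ket_def lookup_single when_def in_keys_iff if_distrib[of "\<lambda>x. _ * x"] cong: if_cong)
  finally show "Poly_Mapping.lookup (linext ket v) b = Poly_Mapping.lookup v b" .
qed

lemma lin_expand:
  assumes "lin X"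
  shows "X v = (\<Sum>b\<in>Poly_Mapping.keys v. scale (Poly_Mapping.lookup v b) (X (ket b)))"
proof -
  have "X v = X (linext ket v)" by (simp only: linext_ket_id)
  then show ?thesis
    unfolding linext_def by (simp only: module_hom.sum[OF assms] module_hom.scale[OF assms])
qed

lemma lin_eqI:
  assumes "lin X" "lin Y" "\<And>b. X (ket b) = Y (ket b)"
  shows "X v = Y v"
  using lin_expand[OF assms(1), of v] lin_expand[OF assms(2), of v] by (simp only: assms(3))

section \<open>Exponentials of modes\<close>

text \<open>
  \<open>S k\<close> is the coefficient of \<open>z\<^sup>k\<close> in the exponential of \<open>\<Sum>r>0. X r z\<^sup>r\<close>, for commuting \<open>X r\<close>.  The
  recursion is the comparison of coefficients in \<open>z S'(z) = (\<Sum>r. r X r z\<^sup>r) S(z)\<close>.  The upper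
  summation bound is left free, since terms with \<open>r > k\<close> vanish: sums for different \<open>k\<close> can then
  share their range.
\<close>

definition is_exp :: "(int \<Rightarrow> oper) \<Rightarrow> (int \<Rightarrow> oper) \<Rightarrow> bool" where
  "is_exp X S \<longleftrightarrow> S 0 = id \<and> (\<forall>k<0. S k = 0) \<and>
     (\<forall>k K v. k \<le> K \<longrightarrow> scale (of_int k) (S k v) = (\<Sum>r=1..K. scale (of_int r) (X r (S (k - r) v))))"

lemma is_exp_0: "is_exp X S \<Longrightarrow> S 0 = id"
  and is_exp_neg: "is_exp X S \<Longrightarrow> k < 0 \<Longrightarrow> S k = 0"
  and is_exp_rec: "is_exp X S \<Longrightarrow> k \<le> K \<Longrightarrow>
    scale (of_int k) (S k v) = (\<Sum>r=1..K. scale (of_int r) (X r (S (k - r) v)))"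
  by (auto simp: is_exp_def)

text \<open>
  By the recursion, \<open>S k\<close> is a polynomial in the modes in which every monomial has total degree
  \<open>k\<close>.  So any property that is additive in the degree passes from the modes to \<open>S k\<close>.
\<close>

lemma is_exp_induct [consumes 1, case_names zero id add scale mult]:
  assumes S: "is_exp X S"
    and zero: "\<And>j. P j 0" and id: "P 0 id"
    and add: "\<And>j Y Z. P j Y \<Longrightarrow> P j Z \<Longrightarrow> P j (Y + Z)"
    and scale: "\<And>j c Y. P j Y \<Longrightarrow> P j (c *\<^sub>o Y)"
    and mult: "\<And>r j Y. r > 0 \<Longrightarrow> P j Y \<Longrightarrow> P (r + j) (X r \<circ> Y)"
  shows "P k (S k)"
proof (cases "k \<le> 0")
  case True
  then consider "k = 0" | "k < 0" by linarith
  then show ?thesis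
    by cases (simp_all only: is_exp_0[OF S] is_exp_neg[OF S] zero id)
next
  case False
  then have "0 \<le> k" by simp
  then show ?thesis
  proof (induction k rule: measure_induct_rule[of nat])
    case (less k)
    show ?case
    proof (cases "k = 0")
      case True
      then show ?thesis by (simp only: is_exp_0[OF S] id)
    next
      case False
      with less have k: "k > 0" by simp
      have "S k = (\<Sum>r=1..k. (of_int r / of_int k) *\<^sub>o (X r \<circ> S (k - r)))"
      proof
        fix v
        have "scale (1 / of_int k) (scale (of_int k) (S k v)) =
            scale (1 / of_int k) (\<Sum>r=1..k. scale (of_int r) (X r (S (k - r) v)))"
          using is_exp_rec[OF S order.refl] by simp
        then show "S k v = (\<Sum>r=1..k. (of_int r / of_int k) *\<^sub>o (X r \<circ> S (k - r))) v"
          using k by (simp add: sum_apply oscale_def vec.scale_sum_right)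
      qed
      moreover have "P k (\<Sum>r\<in>R. (of_int r / of_int k) *\<^sub>o (X r \<circ> S (k - r)))"
        if "R \<subseteq> {1..k}" for R
      proof -
        have "finite R" using that finite_subset by blast
        then show ?thesis using that
        proof induction
          case empty then show ?case by (simp only: sum.empty zero)
        next
          case (insert r R)
          then have r: "1 \<le> r" "r \<le> k" by auto
          have "P (k - r) (S (k - r))"
            using less(1)[of "k - r"] r by auto
          then have "P k (X r \<circ> S (k - r))"
            using mult[of r "k - r"] r by simp
          moreover have "P k (\<Sum>r\<in>R. (of_int r / of_int k) *\<^sub>o (X r \<circ> S (k - r)))"
            using insert by blast
          ultimately show ?case
            unfolding sum.insert[OF insert.hyps] by (intro add scale)
        qed
      qed
      ultimately show ?thesis by simp
    qed
  qed
qed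

text \<open>Reindexing that forgets the ranges as soon as both contain the support.\<close>

lemma sum_shift_support:
  fixes f :: "int \<Rightarrow> 'a::comm_monoid_add"
  assumes "finite A" "finite B" "\<And>s. s \<notin> A \<Longrightarrow> f s = 0" "\<And>t. t \<notin> B \<Longrightarrow> f (t - r) = 0"
  shows "sum f A = (\<Sum>t\<in>B. f (t - r))"
proof -
  let ?C = "(\<lambda>t. t - r) ` B"
  have "s \<notin> ?C \<Longrightarrow> f s = 0" for s
    using assms(4)[of "s + r"] by force
  then have "sum f (A \<union> ?C) = sum f ?C"
    using assms by (intro sum.mono_neutral_right) auto
  moreover have "sum f (A \<union> ?C) = sum f A"
    using assms by (intro sum.mono_neutral_right) auto
  moreover have "sum f ?C = (\<Sum>t\<in>B. f (t - r))"
    by (subst sum.reindex) (auto simp: inj_on_def)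
  ultimately show ?thesis by simp
qed

lemma is_exp_unique:
  assumes S: "is_exp X S" and S': "is_exp X S'"
  shows "S = S'"
proof
  fix k
  show "S k = S' k"
  proof (induction "nat k" arbitrary: k rule: less_induct)
    case less
    show ?case
    proof (cases "k \<le> 0")
      case True
      then show ?thesis using S S' by (cases "k = 0") (auto simp: is_exp_def)
    next
      case False
      show ?thesis
      proof
        fix v
        have "scale (of_int k) (S k v) = scale (of_int k) (S' k v)"
          unfolding is_exp_rec[OF S order.refl] is_exp_rec[OF S' order.refl]
          by (intro sum.cong refl) (use less False in auto)
        then show "S k v = S' k v" using False by simp
      qed
    qed
  qed
qed

lemma is_exp_lin:
  assumes "is_exp X S" "\<And>r. r > 0 \<Longrightarrow> lin (X r)"
  shows "lin (S k)"
  using assms(1)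
  by (induction rule: is_exp_induct)
     (simp_all only: lin_zero lin_id lin_add lin_oscale lin_comp assms(2))

lemma is_exp_commute:
  assumes "is_exp X S" "lin Z" "\<And>r v. r > 0 \<Longrightarrow> Z (X r v) = X r (Z v)"
  shows "Z (S k v) = S k (Z v)"
  using assms(1)
  by (induction arbitrary: v rule: is_exp_induct)
     (auto simp: assms(3) module_hom.add[OF assms(2)] module_hom.scale[OF assms(2)]
       module_hom.zero[OF assms(2)] oscale_def)

lemma is_exp_rescale:
  assumes S: "is_exp X S" and X: "\<And>r. r > 0 \<Longrightarrow> lin (X r)" and c: "c \<noteq> 0"
  shows "is_exp (\<lambda>r. (c powi r) *\<^sub>o X r) (\<lambda>k. (c powi k) *\<^sub>o S k)"
  unfolding is_exp_def
proof (intro conjI allI impI)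
  show "c powi 0 *\<^sub>o S 0 = id" using S by (auto simp: is_exp_def oscale_def)
next
  fix k :: int assume "k < 0"
  then show "c powi k *\<^sub>o S k = 0" using S by (auto simp: is_exp_def oscale_def)
next
  fix k K :: int and v assume k: "k \<le> K"
  have "scale (c powi k) (scale (of_int k) (S k v)) =
      (\<Sum>r=1..K. scale (of_int r) ((c powi r *\<^sub>o X r) ((c powi (k - r) *\<^sub>o S (k - r)) v)))"
    unfolding is_exp_rec[OF S k] vec.scale_sum_right
  proof (intro sum.cong refl)
    fix r assume "r \<in> {1..K}"
    then show "scale (c powi k) (scale (of_int r) (X r (S (k - r) v))) =
        scale (of_int r) ((c powi r *\<^sub>o X r) ((c powi (k - r) *\<^sub>o S (k - r)) v))"
      using c by (simp add: oscale_def module_hom.scale[OF X] mult_ac flip: power_int_add)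
  qed
  then show "scale (of_int k) ((c powi k *\<^sub>o S k) v) =
      (\<Sum>r=1..K. scale (of_int r) ((c powi r *\<^sub>o X r) ((c powi (k - r) *\<^sub>o S (k - r)) v)))"
    by (simp add: oscale_def mult_ac)
qed

text \<open>
  The exponential of a sum of commuting series is the product of the exponentials.
\<close>

lemma is_exp_mult:
  assumes S: "is_exp X S" and X: "\<And>r. r > 0 \<Longrightarrow> lin (X r)"
    and R: "is_exp Y R" and Y: "\<And>r. r > 0 \<Longrightarrow> lin (Y r)"
    and XY: "\<And>r s v. r > 0 \<Longrightarrow> s > 0 \<Longrightarrow> X r (Y s v) = Y s (X r v)"
  shows "is_exp (\<lambda>r. X r + Y r) (\<lambda>k v. \<Sum>p=0..k. S p (R (k - p) v))"
proof -
  have S0: "S p v = 0" if "p < 0" for p v using is_exp_neg[OF S that] by simp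
  have R0: "R p v = 0" if "p < 0" for p v using is_exp_neg[OF R that] by simp
  have linS: "lin (S p)" for p by (rule is_exp_lin[OF S X])
  note [simp] = module_hom.zero[OF linS] module_hom.zero[OF X]
  have conv: "(\<Sum>p=0..k. S p (R (k - p) v)) = (\<Sum>p=0..K. S p (R (k - p) v))" if "k \<le> K" for k K v
    by (rule sum.mono_neutral_left) (use that in \<open>auto simp: R0\<close>)
  have YS: "S p (Y r v) = Y r (S p v)" if "r > 0" for p r v
    using is_exp_commute[OF S Y[OF that]] XY that by metis
  show ?thesis
    unfolding is_exp_def
  proof (intro conjI allI impI)
    show "(\<lambda>v. \<Sum>p=0..0. S p (R (0 - p) v)) = id"
      using is_exp_0[OF S] is_exp_0[OF R] by (auto simp: fun_eq_iff)
  next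
    fix k :: int assume "k < 0"
    then show "(\<lambda>v. \<Sum>p=0..k. S p (R (k - p) v)) = 0" by (auto simp: fun_eq_iff)
  next
    fix k K :: int and v assume k: "k \<le> K"
    have 1: "scale (of_int p) (S p (R (k - p) v)) =
       (\<Sum>r=1..K. scale (of_int r) (X r (S (p - r) (R (k - p) v))))" if "p \<in> {0..K}" for p
      using is_exp_rec[OF S, of p K] that by simp
    have 2: "scale (of_int (k - p)) (S p (R (k - p) v)) =
       (\<Sum>r=1..K. scale (of_int r) (Y r (S p (R (k - r - p) v))))" if "p \<in> {0..K}" for p
    proof -
      have "scale (of_int (k - p)) (S p (R (k - p) v)) = S p (scale (of_int (k - p)) (R (k - p) v))"
        by (simp only: module_hom.scale[OF linS])
      also have "\<dots> = S p (\<Sum>r=1..K. scale (of_int r) (Y r (R (k - p - r) v)))"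
        using is_exp_rec[OF R, of "k - p" K] that k by simp
      also have "\<dots> = (\<Sum>r=1..K. scale (of_int r) (Y r (S p (R (k - r - p) v))))"
        unfolding module_hom.sum[OF linS]
        by (intro sum.cong refl) (simp add: module_hom.scale[OF linS] YS algebra_simps)
      finally show ?thesis .
    qed
    have "scale (of_int k) (\<Sum>p=0..k. S p (R (k - p) v)) =
        (\<Sum>p=0..K. scale (of_int p) (S p (R (k - p) v)) + scale (of_int (k - p)) (S p (R (k - p) v)))"
      by (simp add: conv[OF k] vec.scale_sum_right flip: scale_add_left)
    also have "\<dots> = (\<Sum>p=0..K. \<Sum>r=1..K. scale (of_int r) (X r (S (p - r) (R (k - p) v)))) +
        (\<Sum>p=0..K. \<Sum>r=1..K. scale (of_int r) (Y r (S p (R (k - r - p) v))))"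
      unfolding sum.distrib using 1 2 by simp
    also have "\<dots> = (\<Sum>r=1..K. (\<Sum>p=0..K. scale (of_int r) (X r (S (p - r) (R (k - p) v)))) +
        (\<Sum>p=0..K. scale (of_int r) (Y r (S p (R (k - r - p) v)))))"
      by (simp add: sum.distrib sum.swap[of _ "{0..K}"])
    also have "\<dots> = (\<Sum>r=1..K. scale (of_int r) ((X r + Y r) (\<Sum>p=0..k-r. S p (R (k - r - p) v))))"
    proof (intro sum.cong refl)
      fix r assume r: "r \<in> {1..K}"
      then have "r > 0" by simp
      note l = X[OF this] Y[OF this]
      have "(\<Sum>p=0..K. scale (of_int r) (X r (S p (R (k - r - p) v)))) =
         (\<Sum>p=0..K. scale (of_int r) (X r (S (p - r) (R (k - r - (p - r)) v))))"
        using r k by (intro sum_shift_support) (auto simp: S0 R0 module_hom.zero[OF l(1)])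
      then show "(\<Sum>p=0..K. scale (of_int r) (X r (S (p - r) (R (k - p) v)))) +
        (\<Sum>p=0..K. scale (of_int r) (Y r (S p (R (k - r - p) v)))) =
        scale (of_int r) ((X r + Y r) (\<Sum>p=0..k-r. S p (R (k - r - p) v)))"
        using r k by (subst conv[of _ K])
          (auto simp: module_hom.sum[OF l(1)] module_hom.sum[OF l(2)] vec.scale_sum_right scale_add_right)
    qed
    finally show "scale (of_int k) (\<Sum>p=0..k. S p (R (k - p) v)) =
      (\<Sum>r=1..K. scale (of_int r) ((X r + Y r) (\<Sum>p=0..k-r. S p (R (k - r - p) v))))" .
  qed
qed

lemma cmult_positive:
  assumes "\<And>k. k \<le> 0 \<Longrightarrow> X k = 0" "\<And>k. lin (X k)" "\<And>k. k < 0 \<Longrightarrow> P k = 0" "k \<le> K"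
  shows "(X \<odot> P) k v = (\<Sum>r=1..K. X r (P (k - r) v))"
proof -
  have "(X \<odot> P) k v = (\<Sum>p\<in>{k-K..k-1}. X (k - p) (P p v))"
    unfolding cmult_def
  proof (rule Sum_any.expand_superset)
    show "{p. X (k - p) (P p v) \<noteq> 0} \<subseteq> {k - K..k - 1}"
    proof
      fix p assume p: "p \<in> {p. X (k - p) (P p v) \<noteq> 0}"
      then have "\<not> k - p \<le> 0" using assms(1)[of "k - p"] by auto
      moreover have "\<not> p < 0" using p assms(3)[of p] module_hom.zero[OF assms(2)] by auto
      ultimately show "p \<in> {k - K..k - 1}" using assms(4) by simp
    qed
  qed simp
  also have "\<dots> = (\<Sum>r=1..K. X r (P (k - r) v))"
    by (rule sum.reindex_bij_witness[of _ "\<lambda>r. k - r" "\<lambda>p. k - p"]) auto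
  finally show ?thesis .
qed

text \<open>
  Differentiation of the power series: for commuting modes, \<open>z d/dz\<close> of the \<open>(N+1)\<close>-st power is
  \<open>N+1\<close> times the \<open>N\<close>-th power times the derivative of the series.  The factor \<open>N+1\<close> cancels against
  the factorial, and the supports in positive degree make all sums finite.
\<close>

lemma is_exp_cexp:
  assumes X0: "\<And>k. k \<le> 0 \<Longrightarrow> X k = 0" and linX: "\<And>k. lin (X k)"
    and comm: "\<And>r s v. X r (X s v) = X s (X r v)"
  shows "is_exp X (cexp X)"
proof -
  have XX0: "X r 0 = 0" for r by (rule module_hom.zero[OF linX])
  have neg: "k < int N \<Longrightarrow> cpower X N k = 0" for N k
  proof (induction N arbitrary: k)
    case (Suc N)
    have "cpower X (Suc N) k v = 0" for v
    proof -
      have "cpower X (Suc N) k v = (\<Sum>r=1..\<bar>k\<bar>. X r (cpower X N (k - r) v))"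
        unfolding cpower.simps by (rule cmult_positive) (use X0 linX Suc in auto)
      also have "\<dots> = (\<Sum>r=1..\<bar>k\<bar>. 0)"
        by (intro sum.cong refl) (use Suc in \<open>auto simp: XX0\<close>)
      finally show ?thesis by simp
    qed
    then show ?case by (simp add: fun_eq_iff)
  qed simp
  have Suc: "cpower X (Suc N) k v = (\<Sum>r=1..K. X r (cpower X N (k - r) v))" if "k \<le> K" for N k K v
    unfolding cpower.simps by (rule cmult_positive[OF X0 linX neg that]) auto
  have rec: "k \<le> K \<Longrightarrow> scale (of_int k) (cpower X (Suc N) k v) =
      scale (of_nat (Suc N)) (\<Sum>r=1..K. scale (of_int r) (X r (cpower X N (k - r) v)))" for N k K v
  proof (induction N arbitrary: k)
    case 0
    have "scale (of_int k) (cpower X (Suc 0) k v) =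
        (\<Sum>r=1..K. scale (of_int k) (X r (cpower X 0 (k - r) v)))"
      unfolding Suc[OF 0] vec.scale_sum_right ..
    also have "\<dots> = (\<Sum>r=1..K. scale (of_int r) (X r (cpower X 0 (k - r) v)))"
      by (intro sum.cong refl) (auto simp: XX0)
    finally show ?case by simp
  next
    case (Suc N)
    let ?Y = "\<lambda>r. scale (of_int r) (X r (cpower X (Suc N) (k - r) v))"
    have "scale (of_int k) (cpower X (Suc (Suc N)) k v) =
        (\<Sum>r=1..K. ?Y r + X r (scale (of_int (k - r)) (cpower X (Suc N) (k - r) v)))"
      unfolding \<open>\<And>N k K v. k \<le> K \<Longrightarrow> cpower X (Suc N) k v = _\<close>[OF Suc.prems] vec.scale_sum_right
      by (intro sum.cong refl) (simp only: module_hom.scale[OF linX] flip: scale_add_left, simp)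
    also have "\<dots> = (\<Sum>r=1..K. ?Y r) + (\<Sum>r=1..K. \<Sum>s=1..K.
        scale (of_nat (Suc N) * of_int s) (X s (X r (cpower X N (k - s - r) v))))"
      unfolding sum.distrib
    proof (intro arg_cong2[of _ _ _ _ "(+)"] refl sum.cong)
      fix r assume "r \<in> {1..K}"
      then have "k - r \<le> K" using Suc.prems by simp
      then show "X r (scale (of_int (k - r)) (cpower X (Suc N) (k - r) v)) = (\<Sum>s=1..K.
        scale (of_nat (Suc N) * of_int s) (X s (X r (cpower X N (k - s - r) v))))"
        unfolding Suc.IH[OF \<open>k - r \<le> K\<close>] module_hom.scale[OF linX] module_hom.sum[OF linX]
          vec.scale_sum_right scale_scale
        by (intro sum.cong refl) (simp only: comm[of r] diff_diff_eq add.commute[of r])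
    qed
    also have "(\<Sum>r=1..K. \<Sum>s=1..K.
        scale (of_nat (Suc N) * of_int s) (X s (X r (cpower X N (k - s - r) v)))) =
        (\<Sum>s=1..K. \<Sum>r=1..K.
        scale (of_nat (Suc N) * of_int s) (X s (X r (cpower X N (k - s - r) v))))"
      by (rule sum.swap)
    also have "\<dots> = (\<Sum>s=1..K. scale (of_nat (Suc N)) (?Y s))"
    proof (intro sum.cong refl)
      fix s assume "s \<in> {1..K}"
      then have "k - s \<le> K" using Suc.prems by simp
      show "(\<Sum>r=1..K. scale (of_nat (Suc N) * of_int s) (X s (X r (cpower X N (k - s - r) v)))) =
          scale (of_nat (Suc N)) (?Y s)"
        unfolding \<open>\<And>N k K v. k \<le> K \<Longrightarrow> cpower X (Suc N) k v = _\<close>[OF \<open>k - s \<le> K\<close>]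
          module_hom.sum[OF linX] vec.scale_sum_right scale_scale ..
    qed
    finally show ?case
      by (simp only: of_nat_Suc[of "Suc N"] scale_add_left scale_one vec.scale_sum_right sum.distrib)
  qed
  have fin: "cexp X k v = (\<Sum>N\<le>M. scale (1 / fact N) (cpower X N k v))" if "k \<le> int M" for k M v
    unfolding cexp_def
  proof (rule Sum_any.expand_superset)
    show "{N. scale (1 / fact N) (cpower X N k v) \<noteq> 0} \<subseteq> {..M}"
    proof
      fix N assume N: "N \<in> {N. scale (1 / fact N) (cpower X N k v) \<noteq> 0}"
      then have "\<not> k < int N" using neg[of k N] by auto
      then show "N \<in> {..M}" using that by simp
    qed
  qed simp
  show ?thesis
    unfolding is_exp_def
  proof (intro conjI allI impI)
    show "cexp X 0 = id" using fin[of 0 0] by (simp add: fun_eq_iff)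
  next
    fix k :: int assume "k < 0"
    then show "cexp X k = 0" using fin[of k 0] by (simp add: fun_eq_iff)
  next
    fix k K :: int and v assume k: "k \<le> K"
    define M where "M = nat \<bar>K\<bar>"
    have "scale (of_int k) (cexp X k v) =
        (\<Sum>N\<le>Suc M. scale (1 / fact N) (scale (of_int k) (cpower X N k v)))"
      using fin[of k "Suc M"] k by (simp add: M_def vec.scale_sum_right mult.commute del: sum.atMost_Suc)
    also have "\<dots> = (\<Sum>N\<le>M. scale (1 / fact (Suc N)) (scale (of_int k) (cpower X (Suc N) k v)))"
      unfolding sum.atMost_Suc_shift by simp
    also have "\<dots> = (\<Sum>N\<le>M. \<Sum>r=1..K. scale (of_int r) (X r (scale (1 / fact N) (cpower X N (k - r) v))))"
    proof (intro sum.cong refl)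
      fix N
      have "1 / fact (Suc N) * of_nat (Suc N) = (1 / fact N :: complex)"
        by (simp add: field_simps del: of_nat_Suc)
      then have "scale (1 / fact (Suc N)) (scale (of_int k) (cpower X (Suc N) k v)) =
          scale (1 / fact N) (\<Sum>r=1..K. scale (of_int r) (X r (cpower X N (k - r) v)))"
        unfolding rec[OF k] by (simp only: scale_scale)
      then show "scale (1 / fact (Suc N)) (scale (of_int k) (cpower X (Suc N) k v)) =
          (\<Sum>r=1..K. scale (of_int r) (X r (scale (1 / fact N) (cpower X N (k - r) v))))"
        by (simp only: vec.scale_sum_right module_hom.scale[OF linX] scale_scale mult.commute)
    qed
    also have "\<dots> = (\<Sum>r=1..K. \<Sum>N\<le>M. scale (of_int r) (X r (scale (1 / fact N) (cpower X N (k - r) v))))"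
      by (rule sum.swap)
    also have "\<dots> = (\<Sum>r=1..K. scale (of_int r) (X r (cexp X (k - r) v)))"
    proof (intro sum.cong refl)
      fix r assume "r \<in> {1..K}"
      then have "k - r \<le> int M" using k by (simp add: M_def)
      then show "(\<Sum>N\<le>M. scale (of_int r) (X r (scale (1 / fact N) (cpower X N (k - r) v)))) =
          scale (of_int r) (X r (cexp X (k - r) v))"
        by (simp only: fin module_hom.sum[OF linX] vec.scale_sum_right)
    qed
    finally show "scale (of_int k) (cexp X k v) = (\<Sum>r=1..K. scale (of_int r) (X r (cexp X (k - r) v)))" .
  qed
qed

lemma Sum_any_uminus: "Sum_any (\<lambda>p::int. f (- p)) = Sum_any f"
  by (rule Sum_any.reindex_cong[of uminus, symmetric]) (auto simp: fun_eq_iff intro: bij_uminus)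

lemma cmult_uminus: "((\<lambda>k. X (- k)) \<odot> (\<lambda>k. Y (- k))) k = (X \<odot> Y) (- k)"
proof
  fix v
  have "((\<lambda>k. X (- k)) \<odot> (\<lambda>k. Y (- k))) k v = Sum_any (\<lambda>p. X (- k - (- p)) (Y (- p) v))"
    unfolding cmult_def by (simp add: algebra_simps)
  then show "((\<lambda>k. X (- k)) \<odot> (\<lambda>k. Y (- k))) k v = (X \<odot> Y) (- k) v"
    unfolding cmult_def using Sum_any_uminus[of "\<lambda>p. X (- k - p) (Y p v)"] by simp
qed

text \<open>
  Carries results on series in \<open>z\<close> over to series in \<open>z\<^sup>-\<^sup>1\<close>, the annihilation parts.
\<close>

lemma cexp_uminus: "cexp (\<lambda>k. X (- k)) k = cexp X (- k)"
proof -
  have "cpower (\<lambda>k. X (- k)) N k = cpower X N (- k)" for N k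
  proof (induction N arbitrary: k)
    case (Suc N)
    then have "cpower (\<lambda>k. X (- k)) N = (\<lambda>k. cpower X N (- k))" by auto
    then show ?case by (simp add: cmult_uminus)
  qed auto
  then show ?thesis unfolding cexp_def by simp
qed

section \<open>Contraction of two exponentials\<close>

text \<open>
  A mode that has a scalar commutator with the exponent acts on the exponential as a derivation,
  so its commutator with \<open>S(z)\<close> is \<open>g z\<^sup>r S(z)\<close>.
\<close>

lemma is_exp_commutator:
  assumes S: "is_exp Y S" and Y: "\<And>s. s > 0 \<Longrightarrow> lin (Y s)" and Z: "lin Z" and r: "r > 0"
    and ZY: "\<And>s v. s > 0 \<Longrightarrow> Z (Y s v) = Y s (Z v) + (if s = r then scale g v else 0)"
  shows "Z (S l v) = S l (Z v) + scale g (S (l - r) v)"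
proof (induction "nat l" arbitrary: l rule: less_induct)
  case less
  have S0: "S p v = 0" if "p < 0" for p v using is_exp_neg[OF S that] by simp
  consider "l < 0" | "l = 0" | "l > 0" by linarith
  then show ?case
  proof cases
    case 1 then show ?thesis using r by (simp add: S0 module_hom.zero[OF Z])
  next
    case 2 then show ?thesis using r by (simp add: S0 is_exp_0[OF S])
  next
    case 3
    have "scale (of_int l) (Z (S l v)) = (\<Sum>s=1..l. scale (of_int s) (Z (Y s (S (l - s) v))))"
      using is_exp_rec[OF S order.refl, of l v]
      by (metis (no_types, lifting) module_hom.scale[OF Z] module_hom.sum[OF Z] sum.cong)
    also have "\<dots> = (\<Sum>s=1..l. scale (of_int s) (Y s (S (l - s) (Z v))) +
       scale g (scale (of_int s) (Y s (S (l - r - s) v))) +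
       (if s = r then scale (g * of_int r) (S (l - r) v) else 0))"
    proof (intro sum.cong refl)
      fix s assume s: "s \<in> {1..l}"
      then have "Z (S (l - s) v) = S (l - s) (Z v) + scale g (S (l - s - r) v)"
        using less by simp
      then show "scale (of_int s) (Z (Y s (S (l - s) v))) = scale (of_int s) (Y s (S (l - s) (Z v))) +
       scale g (scale (of_int s) (Y s (S (l - r - s) v))) +
       (if s = r then scale (g * of_int r) (S (l - r) v) else 0)"
        using s by (simp add: ZY module_hom.add[OF Y] module_hom.scale[OF Y] scale_add_right
            algebra_simps)
    qed
    also have "\<dots> = scale (of_int l) (S l (Z v)) + scale g (\<Sum>s=1..l. scale (of_int s) (Y s (S (l - r - s) v))) +
       (if r \<le> l then scale (g * of_int r) (S (l - r) v) else 0)"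
      using r is_exp_rec[OF S order.refl, of l "Z v"] by (simp add: sum.distrib vec.scale_sum_right)
    also have "(\<Sum>s=1..l. scale (of_int s) (Y s (S (l - r - s) v))) = scale (of_int (l - r)) (S (l - r) v)"
      using r by (intro is_exp_rec[OF S, symmetric]) simp
    also have "scale (of_int l) (S l (Z v)) + scale g (scale (of_int (l - r)) (S (l - r) v)) +
       (if r \<le> l then scale (g * of_int r) (S (l - r) v) else 0) =
       scale (of_int l) (S l (Z v) + scale g (S (l - r) v))"
      by (rule poly_mapping_eqI) (auto simp: S0 lookup_add algebra_simps)
    finally show ?thesis using 3 by simp
  qed
qed

text \<open>
  The scalar analogue of \<open>is_exp\<close>: the generating function of \<open>f\<close> is \<open>exp (\<Sum>r>0. g r x\<^sup>r)\<close>.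
\<close>

definition scalar_exp :: "(int \<Rightarrow> complex) \<Rightarrow> (int \<Rightarrow> complex) \<Rightarrow> bool" where
  "scalar_exp g f \<longleftrightarrow> f 0 = 1 \<and> (\<forall>s<0. f s = 0) \<and>
     (\<forall>s K. s \<le> K \<longrightarrow> of_int s * f s = (\<Sum>r=1..K. of_int r * g r * f (s - r)))"

text \<open>
  The coefficients of \<open>T(z) S(w) = f(w/z) S(w) T(z)\<close>, where \<open>T\<close> is a series in \<open>z\<^sup>-\<^sup>1\<close>.  Induction
  on \<open>k\<close> along the recursion for \<open>T\<close>: commuting a mode \<open>X r\<close> through \<open>S\<close> reproduces the recursion
  for \<open>T\<close> and in addition the one for \<open>f\<close>.
\<close>

lemma exp_contraction:
  assumes T: "is_exp X T" and X: "\<And>r. r > 0 \<Longrightarrow> lin (X r)"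
    and S: "is_exp Y S" and Y: "\<And>r. r > 0 \<Longrightarrow> lin (Y r)"
    and XY: "\<And>r s v. r > 0 \<Longrightarrow> s > 0 \<Longrightarrow> X r (Y s v) = Y s (X r v) + (if r = s then scale (g r) v else 0)"
    and f: "scalar_exp g f" and k: "k \<le> K"
  shows "T k (S l v) = (\<Sum>s=0..K. scale (f s) (S (l - s) (T (k - s) v)))"
  using k
proof (induction "nat k" arbitrary: k rule: less_induct)
  case less
  have T0: "T p v = 0" if "p < 0" for p v using is_exp_neg[OF T that] by simp
  have linS: "lin (S l)" for l by (rule is_exp_lin[OF S Y])
  note SZ = module_hom.zero[OF linS]
  have f0: "f 0 = 1" and fneg: "\<And>s. s < 0 \<Longrightarrow> f s = 0"
    and frec: "\<And>s K. s \<le> K \<Longrightarrow> of_int s * f s = (\<Sum>r=1..K. of_int r * g r * f (s - r))"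
    using f by (auto simp: scalar_exp_def)
  have XS: "X r (S l v) = S l (X r v) + scale (g r) (S (l - r) v)" if "r > 0" for r l v
    by (rule is_exp_commutator[OF S Y X[OF that] that]) (use XY[OF that] in auto)
  consider "k < 0" | "k = 0" | "k > 0" by linarith
  then show ?case
  proof cases
    case 1 then show ?thesis by (simp add: T0 SZ)
  next
    case 2
    have "(\<Sum>s=0..K. scale (f s) (S (l - s) (T (k - s) v))) =
        (\<Sum>s\<in>{0}. scale (f s) (S (l - s) (T (k - s) v)))"
      by (rule sum.mono_neutral_right) (use less 2 in \<open>auto simp: T0 SZ\<close>)
    then show ?thesis using 2 by (simp add: f0 is_exp_0[OF T])
  next
    case 3
    let ?g = "\<lambda>t. S (l - t) (T (k - t) v)"
    have "scale (of_int k) (T k (S l v)) = (\<Sum>r=1..K. scale (of_int r) (X r (T (k - r) (S l v))))"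
      by (rule is_exp_rec[OF T less.prems])
    also have "\<dots> = (\<Sum>r=1..K. \<Sum>s=0..K.
       scale (f s) (S (l - s) (scale (of_int r) (X r (T (k - s - r) v)))) +
       scale (of_int r * g r * f s) (?g (s + r)))"
    proof (intro sum.cong refl)
      fix r assume r: "r \<in> {1..K}"
      then have r0: "r > 0" by simp
      have "T (k - r) (S l v) = (\<Sum>s=0..K. scale (f s) (S (l - s) (T (k - r - s) v)))"
        using less r 3 by simp
      then show "scale (of_int r) (X r (T (k - r) (S l v))) = (\<Sum>s=0..K.
       scale (f s) (S (l - s) (scale (of_int r) (X r (T (k - s - r) v)))) +
       scale (of_int r * g r * f s) (?g (s + r)))"
        using r0 by (simp add: module_hom.sum[OF X] module_hom.scale[OF X] module_hom.scale[OF linS]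
            XS vec.scale_sum_right scale_add_right algebra_simps)
    qed
    also have "\<dots> = (\<Sum>s=0..K. scale (f s) (S (l - s) (\<Sum>r=1..K. scale (of_int r) (X r (T (k - s - r) v))))) +
       (\<Sum>r=1..K. \<Sum>s=0..K. scale (of_int r * g r * f s) (?g (s + r)))"
      by (simp add: sum.distrib module_hom.sum[OF linS] vec.scale_sum_right sum.swap[of _ "{0..K}"])
    also have "(\<Sum>s=0..K. scale (f s) (S (l - s) (\<Sum>r=1..K. scale (of_int r) (X r (T (k - s - r) v))))) =
       (\<Sum>s=0..K. scale (of_int (k - s) * f s) (?g s))"
    proof (intro sum.cong refl)
      fix s assume "s \<in> {0..K}"
      then have "k - s \<le> K" using less.prems by simp
      show "scale (f s) (S (l - s) (\<Sum>r=1..K. scale (of_int r) (X r (T (k - s - r) v)))) =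
         scale (of_int (k - s) * f s) (?g s)"
        unfolding is_exp_rec[OF T \<open>k - s \<le> K\<close>, symmetric] module_hom.scale[OF linS] scale_scale
        by (simp only: mult.commute)
    qed
    also have "(\<Sum>r=1..K. \<Sum>s=0..K. scale (of_int r * g r * f s) (?g (s + r))) =
       (\<Sum>r=1..K. \<Sum>t=0..K. scale (of_int r * g r * f (t - r)) (?g t))"
    proof (rule sum.cong[OF refl])
      fix r assume r: "r \<in> {1..K}"
      have "(\<Sum>s=0..K. scale (of_int r * g r * f s) (?g (s + r))) =
         (\<Sum>t=0..K. scale (of_int r * g r * f (t - r)) (?g (t - r + r)))"
        by (rule sum_shift_support[where f = "\<lambda>s. scale (of_int r * g r * f s) (?g (s + r))"])
          (use r less.prems in \<open>auto simp: fneg T0 SZ\<close>)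
      then show "(\<Sum>s=0..K. scale (of_int r * g r * f s) (?g (s + r))) =
         (\<Sum>t=0..K. scale (of_int r * g r * f (t - r)) (?g t))" by simp
    qed
    also have "\<dots> = (\<Sum>t=0..K. scale (\<Sum>r=1..K. of_int r * g r * f (t - r)) (?g t))"
      by (simp add: vec.scale_sum_left sum.swap[of _ "{0..K}"])
    also have "\<dots> = (\<Sum>t=0..K. scale (of_int t * f t) (?g t))"
      by (intro sum.cong refl) (simp add: frec[symmetric])
    also have "(\<Sum>s=0..K. scale (of_int (k - s) * f s) (?g s)) + \<dots> =
       scale (of_int k) (\<Sum>s=0..K. scale (f s) (?g s))"
      unfolding vec.scale_sum_right sum.distrib[symmetric] scale_add_left[symmetric] scale_scale
      by (rule sum.cong[OF refl]) (simp add: algebra_simps)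
    finally show ?thesis using 3 by simp
  qed
qed

section \<open>The energy filtration\<close>

definition weighted_sum :: "('a \<Rightarrow> int) \<Rightarrow> ('a \<Rightarrow>\<^sub>0 nat) \<Rightarrow> int" where
  "weighted_sum g \<mu> = (\<Sum>x\<in>Poly_Mapping.keys \<mu>. int (Poly_Mapping.lookup \<mu> x) * g x)"

lemma weighted_sum_superset:
  assumes "finite S" "Poly_Mapping.keys \<mu> \<subseteq> S"
  shows "weighted_sum g \<mu> = (\<Sum>x\<in>S. int (Poly_Mapping.lookup \<mu> x) * g x)"
  unfolding weighted_sum_def
  by (rule sum.mono_neutral_left) (use assms in \<open>auto simp: in_keys_iff\<close>)

lemma weighted_sum_add: "weighted_sum g (\<mu> + \<nu>) = weighted_sum g \<mu> + weighted_sum g \<nu>"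
proof -
  let ?S = "Poly_Mapping.keys \<mu> \<union> Poly_Mapping.keys \<nu>"
  have "Poly_Mapping.keys (\<mu> + \<nu>) \<subseteq> ?S" by (rule Poly_Mapping.keys_add)
  then show ?thesis
    by (simp add: weighted_sum_superset[of ?S] lookup_add sum.distrib algebra_simps)
qed

lemma weighted_sum_single: "weighted_sum g (Poly_Mapping.single x k) = int k * g x"
  by (simp add: weighted_sum_def)

lemma remove_single:
  assumes "Poly_Mapping.lookup \<mu> x > 0"
  shows "\<mu> - Poly_Mapping.single x (1::nat) + Poly_Mapping.single x 1 = \<mu>"
  using assms by (intro poly_mapping_eqI) (auto simp: lookup_add lookup_minus lookup_single when_def)

lemma weighted_sum_remove:
  assumes "Poly_Mapping.lookup \<mu> x > 0"
  shows "weighted_sum g (\<mu> - Poly_Mapping.single x 1) = weighted_sum g \<mu> - g x"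
  using arg_cong[OF remove_single[OF assms], of "weighted_sum g"]
  by (simp add: weighted_sum_add weighted_sum_single)

text \<open>
  The index \<open>r\<close> of a variable is truncated at \<open>0\<close>, so that every state has nonnegative
  energy.
\<close>

definition energy_le :: "int \<Rightarrow> vec set" where
  "energy_le K = {v. \<forall>(\<mu>, M) \<in> Poly_Mapping.keys v. weighted_sum (\<lambda>(i, j, r). max r 0) \<mu> \<le> K}"

lemma energy_le_mono: "v \<in> energy_le K \<Longrightarrow> K \<le> L \<Longrightarrow> v \<in> energy_le L"
  unfolding energy_le_def by fastforce

lemma energy_le_zero: "0 \<in> energy_le K"
  by (simp add: energy_le_def)

lemma energy_le_add: "v \<in> energy_le K \<Longrightarrow> w \<in> energy_le K \<Longrightarrow> v + w \<in> energy_le K"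
  using Poly_Mapping.keys_add[of v w] unfolding energy_le_def by blast

lemma energy_le_scale: "v \<in> energy_le K \<Longrightarrow> scale c v \<in> energy_le K"
  unfolding energy_le_def by (auto simp: in_keys_iff)

lemma subspace_energy_le: "vec.subspace (energy_le K)"
  by (intro vec.subspaceI energy_le_zero energy_le_add energy_le_scale)

lemma energy_le_neg:
  assumes "v \<in> energy_le K" "K < 0" shows "v = 0"
proof -
  have "weighted_sum (\<lambda>(i, j, r). max r 0) \<mu> \<ge> 0" for \<mu> :: "int \<times> int \<times> int \<Rightarrow>\<^sub>0 nat"
    unfolding weighted_sum_def by (intro sum_nonneg) auto
  then have "\<not> weighted_sum (\<lambda>(i, j, r). max r 0) \<mu> \<le> K" for \<mu> :: "int \<times> int \<times> int \<Rightarrow>\<^sub>0 nat"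
    using assms(2) by (meson dual_order.trans not_le)
  then have "Poly_Mapping.keys v = {}"
    using assms(1) unfolding energy_le_def by blast
  then show ?thesis by simp
qed

text \<open>The lower bound \<open>L\<close> allows one cutoff to serve several vectors.\<close>

lemma energy_le_exists: obtains K where "v \<in> energy_le K" "L \<le> K"
proof -
  let ?S = "insert L ((\<lambda>(\<mu>, M). weighted_sum (\<lambda>(i, j, r). max r 0) \<mu>) ` Poly_Mapping.keys v)"
  have "v \<in> energy_le (Max ?S)" unfolding energy_le_def by (auto intro!: Max_ge rev_image_eqI)
  moreover have "L \<le> Max ?S" by (rule Max_ge) auto
  ultimately show ?thesis by (rule that)
qed

section \<open>Normally ordered exponentials\<close>

text \<open>
  The last condition, that \<open>X r\<close> lowers the energy by \<open>r\<close>, makes the annihilation part of the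
  exponential locally finite.
\<close>

definition modes :: "(int \<Rightarrow> oper) \<Rightarrow> bool" where
  "modes X \<longleftrightarrow> (\<forall>r. r \<noteq> 0 \<longrightarrow> lin (X r)) \<and>
     (\<forall>r s v. r * s > 0 \<longrightarrow> X r (X s v) = X s (X r v)) \<and>
     (\<forall>r>0. \<forall>K. \<forall>v\<in>energy_le K. X r v \<in> energy_le (K - r))"

definition creation :: "(int \<Rightarrow> oper) \<Rightarrow> int \<Rightarrow> oper" where
  "creation X = cexp (\<lambda>k. if k > 0 then X (- k) else 0)"

text \<open>
  The index is the negated exponent of \<open>z\<close>, so that both parts are supported in nonnegative degree.
\<close>

definition annihilation :: "(int \<Rightarrow> oper) \<Rightarrow> int \<Rightarrow> oper" where
  "annihilation X p = cexp (\<lambda>k. if k < 0 then X (- k) else 0) (- p)"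

lemma modes_lin: "modes X \<Longrightarrow> r \<noteq> 0 \<Longrightarrow> lin (X r)"
  by (simp add: modes_def)

lemma modes_commute: "modes X \<Longrightarrow> r * s > 0 \<Longrightarrow> X r (X s v) = X s (X r v)"
  unfolding modes_def by blast

lemma modes_zero: "modes X \<Longrightarrow> r \<noteq> 0 \<Longrightarrow> X r 0 = 0"
  by (rule module_hom.zero[OF modes_lin])

lemma is_exp_cong:
  assumes "is_exp X S" "\<And>r. r > 0 \<Longrightarrow> X r = Y r"
  shows "is_exp Y S"
  using assms unfolding is_exp_def by (auto intro!: sum.cong)

lemma is_exp_creation:
  assumes "modes X" shows "is_exp (\<lambda>r. X (- r)) (creation X)"
  unfolding creation_def
  by (rule is_exp_cong[OF is_exp_cexp]) (use assms modes_zero[OF assms] in \<open>auto simp: modes_def\<close>)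

lemma is_exp_annihilation:
  assumes "modes X" shows "is_exp X (annihilation X)"
proof -
  have "annihilation X p = cexp (\<lambda>k. if k > 0 then X k else 0) p" for p
    using cexp_uminus[of "\<lambda>k. if k > 0 then X k else 0" "- p"]
    by (simp add: annihilation_def)
  then have "annihilation X = cexp (\<lambda>k. if k > 0 then X k else 0)" by auto
  then show ?thesis
    by (simp, intro is_exp_cong[OF is_exp_cexp]) (use assms modes_zero[OF assms] in \<open>auto simp: modes_def\<close>)
qed

lemma creation_neg: "modes X \<Longrightarrow> k < 0 \<Longrightarrow> creation X k v = 0"
  using is_exp_neg[OF is_exp_creation] by simp

lemma annihilation_neg: "modes X \<Longrightarrow> k < 0 \<Longrightarrow> annihilation X k v = 0"
  using is_exp_neg[OF is_exp_annihilation] by simp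

lemma lin_creation: "modes X \<Longrightarrow> lin (creation X k)"
  by (rule is_exp_lin[OF is_exp_creation]) (auto simp: modes_lin)

lemma lin_annihilation: "modes X \<Longrightarrow> lin (annihilation X k)"
  by (rule is_exp_lin[OF is_exp_annihilation]) (auto simp: modes_lin)

lemma annihilation_energy:
  assumes "modes X" "v \<in> energy_le K"
  shows "annihilation X p v \<in> energy_le (K - p)"
  using is_exp_annihilation[OF assms(1)] assms(2)
proof (induction arbitrary: K v rule: is_exp_induct)
  case (mult r j Y)
  then have "X r (Y v) \<in> energy_le (K - j - r)"
    using assms(1) by (auto simp: modes_def)
  then show ?case by (simp add: algebra_simps)
qed (auto simp: energy_le_zero energy_le_add energy_le_scale oscale_def)

lemma annihilation_eq_0:
  assumes "modes X" "v \<in> energy_le K" "p > K"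
  shows "annihilation X p v = 0"
  by (rule energy_le_neg[OF annihilation_energy[OF assms(1,2)]]) (use assms in auto)

lemma nexp_Sum_any: "nexp X k v = Sum_any (\<lambda>p. creation X (k + p) (annihilation X p v))"
  using Sum_any_uminus[of "\<lambda>p. creation X (k - p) (annihilation X (- p) v)"]
  by (simp add: nexp_def cmult_def creation_def annihilation_def)

lemma nexp_finite:
  assumes "modes X" "v \<in> energy_le K" "K \<le> L"
  shows "nexp X k v = (\<Sum>p=0..L. creation X (k + p) (annihilation X p v))"
  unfolding nexp_Sum_any
proof (rule Sum_any.expand_superset)
  show "{p. creation X (k + p) (annihilation X p v) \<noteq> 0} \<subseteq> {0..L}"
  proof
    fix p assume p: "p \<in> {p. creation X (k + p) (annihilation X p v) \<noteq> 0}"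
    then have "annihilation X p v \<noteq> 0"
      using module_hom.zero[OF lin_creation[OF assms(1)]] by auto
    then show "p \<in> {0..L}"
      using annihilation_neg[OF assms(1), of p] annihilation_eq_0[OF assms(1,2), of p] assms(3) by force
  qed
qed simp

lemma lin_nexp:
  assumes X: "modes X" shows "lin (nexp X k)"
proof (rule linI)
  fix v w
  obtain K where K: "v \<in> energy_le K" by (rule energy_le_exists)
  obtain L where L: "w \<in> energy_le L" "K \<le> L" by (rule energy_le_exists)
  have vw: "v \<in> energy_le L" "v + w \<in> energy_le L"
    using energy_le_mono[OF K L(2)] L energy_le_add by auto
  show "nexp X k (v + w) = nexp X k v + nexp X k w"
    by (simp add: nexp_finite[OF X vw(1) order.refl] nexp_finite[OF X vw(2) order.refl]
        nexp_finite[OF X L(1) order.refl] module_hom.add[OF lin_creation[OF X]]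
        module_hom.add[OF lin_annihilation[OF X]] sum.distrib)
next
  fix c v
  obtain K where K: "v \<in> energy_le K" by (rule energy_le_exists)
  show "nexp X k (scale c v) = scale c (nexp X k v)"
    by (simp add: nexp_finite[OF X K order.refl] nexp_finite[OF X energy_le_scale[OF K] order.refl]
        module_hom.scale[OF lin_creation[OF X]] module_hom.scale[OF lin_annihilation[OF X]]
        vec.scale_sum_right)
qed

lemma nexp_commute:
  assumes X: "modes X" and Z: "lin Z" "\<And>r v. r \<noteq> 0 \<Longrightarrow> Z (X r v) = X r (Z v)"
  shows "Z (nexp X k v) = nexp X k (Z v)"
proof -
  obtain K where K: "v \<in> energy_le K" by (rule energy_le_exists)
  obtain L where L: "Z v \<in> energy_le L" "K \<le> L" by (rule energy_le_exists)
  have "Z (creation X k v) = creation X k (Z v)" for k v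
    by (rule is_exp_commute[OF is_exp_creation[OF X]]) (use Z in auto)
  moreover have "Z (annihilation X k v) = annihilation X k (Z v)" for k v
    by (rule is_exp_commute[OF is_exp_annihilation[OF X]]) (use Z in auto)
  ultimately show ?thesis
    by (simp add: nexp_finite[OF X K L(2)] nexp_finite[OF X L(1) order.refl] module_hom.sum[OF Z(1)])
qed

text \<open>
  The index \<open>r\<close> runs over positive and negative values, so \<open>h\<close> records the contractions for both
  orders of multiplication.
\<close>

definition pairing :: "(int \<Rightarrow> oper) \<Rightarrow> (int \<Rightarrow> oper) \<Rightarrow> (int \<Rightarrow> complex) \<Rightarrow> bool" where
  "pairing X Y h \<longleftrightarrow> (\<forall>r s v. r \<noteq> 0 \<longrightarrow> s \<noteq> 0 \<longrightarrow>
     X r (Y s v) = Y s (X r v) + (if r + s = 0 then scale (h r) v else 0))"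

lemma pairingD: "pairing X Y h \<Longrightarrow> r \<noteq> 0 \<Longrightarrow> s \<noteq> 0 \<Longrightarrow>
    X r (Y s v) = Y s (X r v) + (if r + s = 0 then scale (h r) v else 0)"
  by (auto simp: pairing_def)

lemma pairing_swap:
  assumes "pairing X Y h" shows "pairing Y X (\<lambda>r. - h (- r))"
  unfolding pairing_def
proof (intro allI impI)
  fix r s :: int and v assume rs: "r \<noteq> 0" "s \<noteq> 0"
  show "Y r (X s v) = X s (Y r v) + (if r + s = 0 then scale (- h (- r)) v else 0)"
  proof (cases "r + s = 0")
    case True
    then have "s = - r" by simp
    then show ?thesis using pairingD[OF assms rs(2,1), of v] by (simp add: vec.scale_minus_left)
  next
    case False
    then show ?thesis using pairingD[OF assms rs(2,1), of v] by (simp add: add.commute)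
  qed
qed

lemma creation_commute:
  assumes X: "modes X" and Y: "modes Y" and XY: "pairing X Y h"
  shows "creation X k (creation Y l v) = creation Y l (creation X k v)"
proof (rule is_exp_commute[OF is_exp_creation[OF Y] lin_creation[OF X]])
  fix r :: int and v assume r: "r > 0"
  have "Y (- r) (creation X k v) = creation X k (Y (- r) v)"
    by (rule is_exp_commute[OF is_exp_creation[OF X] modes_lin[OF Y]])
       (use r pairingD[OF XY, of "- _" "- r"] in auto)
  then show "creation X k (Y (- r) v) = Y (- r) (creation X k v)" ..
qed

lemma annihilation_commute:
  assumes X: "modes X" and Y: "modes Y" and XY: "pairing X Y h"
  shows "annihilation X k (annihilation Y l v) = annihilation Y l (annihilation X k v)"
proof (rule is_exp_commute[OF is_exp_annihilation[OF Y] lin_annihilation[OF X]])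
  fix r :: int and v assume r: "r > 0"
  have "Y r (annihilation X k v) = annihilation X k (Y r v)"
    by (rule is_exp_commute[OF is_exp_annihilation[OF X] modes_lin[OF Y]])
       (use r pairingD[OF XY, of _ r] in auto)
  then show "annihilation X k (Y r v) = Y r (annihilation X k v)" ..
qed

text \<open>
  The coefficient of \<open>z\<^sup>k w\<^sup>l\<close> in the normally ordered product of two exponentials, applied to \<open>u\<close>.
  The truncation at \<open>K\<close> is harmless when \<open>u\<close> has energy at most \<open>K\<close>.
\<close>

definition nexp2 :: "(int \<Rightarrow> oper) \<Rightarrow> (int \<Rightarrow> oper) \<Rightarrow> int \<Rightarrow> vec \<Rightarrow> int \<Rightarrow> int \<Rightarrow> vec" where
  "nexp2 X Y K u k l = (\<Sum>p=0..K. \<Sum>p'=0..K.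
     creation X (k + p) (creation Y (l + p') (annihilation X p (annihilation Y p' u))))"

lemma nexp2_swap:
  assumes "modes X" "modes Y" "pairing X Y h"
  shows "nexp2 X Y K u k l = nexp2 Y X K u l k"
  unfolding nexp2_def
  by (subst sum.swap) (simp only: creation_commute[OF assms] annihilation_commute[OF assms])

lemma nexp2_eq_0:
  assumes "modes X" "modes Y" "k < - K \<or> l < - K"
  shows "nexp2 X Y K u k l = 0"
  unfolding nexp2_def
  by (intro sum.neutral ballI)
     (use assms in \<open>auto simp: creation_neg module_hom.zero[OF lin_creation]\<close>)

text \<open>
  The product of two normally ordered exponentials is \<open>f(w/z)\<close> times their joint normal ordering.
  The sum over \<open>s\<close> is finite because the degree of the joint normal ordering in \<open>w\<close> is bounded
  below.
\<close>

lemma nexp_product: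
  assumes X: "modes X" and Y: "modes Y" and XY: "pairing X Y h"
    and f: "scalar_exp h f" and u: "u \<in> energy_le K" and L: "l + K \<le> L"
  shows "nexp X k (nexp Y l u) = (\<Sum>s=0..L. scale (f s) (nexp2 X Y K u (k + s) (l - s)))"
proof -
  note [simp] = module_hom.sum[OF lin_creation[OF X]] module_hom.sum[OF lin_creation[OF Y]]
    module_hom.sum[OF lin_annihilation[OF X]] module_hom.zero[OF lin_creation[OF X]]
    module_hom.zero[OF lin_creation[OF Y]] module_hom.scale[OF lin_creation[OF X]]
  obtain P where P: "nexp Y l u \<in> energy_le P" "\<bar>K\<bar> + \<bar>L\<bar> \<le> P"
    by (rule energy_le_exists)
  let ?C = "creation X" and ?D = "creation Y" and ?T = "annihilation X" and ?R = "annihilation Y"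
  have contr: "?T p (?D j v) = (\<Sum>s=0..P. scale (f s) (?D (j - s) (?T (p - s) v)))" if "p \<le> P" for p j v
    by (rule exp_contraction[OF is_exp_annihilation[OF X] _ is_exp_creation[OF Y] _ _ f that])
       (auto simp: modes_lin X Y pairingD[OF XY])
  have "nexp X k (nexp Y l u) = (\<Sum>p=0..P. ?C (k + p) (?T p (\<Sum>p'=0..K. ?D (l + p') (?R p' u))))"
    by (subst nexp_finite[OF X P(1) order.refl]) (simp only: nexp_finite[OF Y u order.refl])
  also have "\<dots> = (\<Sum>p=0..P. \<Sum>p'=0..K. \<Sum>s=0..P.
      scale (f s) (?C (k + p) (?D (l + p' - s) (?T (p - s) (?R p' u)))))"
    by (intro sum.cong refl) (simp add: contr)
  also have "\<dots> = (\<Sum>p'=0..K. \<Sum>p=0..P. \<Sum>s=0..P.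
      scale (f s) (?C (k + p) (?D (l + p' - s) (?T (p - s) (?R p' u)))))"
    by (rule sum.swap)
  also have "\<dots> = (\<Sum>p'=0..K. \<Sum>s=0..P. \<Sum>p=0..P.
      scale (f s) (?C (k + p) (?D (l + p' - s) (?T (p - s) (?R p' u)))))"
    by (rule sum.cong[OF refl]) (rule sum.swap)
  also have "\<dots> = (\<Sum>p'=0..K. \<Sum>s=0..P. \<Sum>p=0..K.
      scale (f s) (?C (k + s + p) (?D (l - s + p') (?T p (?R p' u)))))"
  proof (rule sum.cong[OF refl], rule sum.cong[OF refl])
    fix p' s assume p': "p' \<in> {0..K}" and s: "s \<in> {0..P}"
    let ?h = "\<lambda>p. scale (f s) (?C (k + s + p) (?D (l - s + p') (?T p (?R p' u))))"
    have R: "?R p' u \<in> energy_le K"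
      by (rule energy_le_mono[OF annihilation_energy[OF Y u]]) (use p' in auto)
    show "(\<Sum>p=0..P. scale (f s) (?C (k + p) (?D (l + p' - s) (?T (p - s) (?R p' u))))) =
        (\<Sum>p=0..K. ?h p)"
    \<comment> \<open>For \<open>s > L\<close> all creation indices are negative; otherwise the range is long enough to shift.\<close>
    proof (cases "s \<le> L")
      case True
      have "(\<Sum>p=0..K. ?h p) = (\<Sum>p=0..P. ?h (p - s))"
        by (rule sum_shift_support)
           (use s P True in \<open>auto simp: annihilation_neg X annihilation_eq_0[OF X R]\<close>)
      then show ?thesis by (simp add: algebra_simps)
    next
      case False
      then have "l + p' - s < 0" "l - s + p' < 0" using L p' by auto
      then show ?thesis by (simp add: creation_neg[OF Y])
    qed
  qed
  also have "\<dots> = (\<Sum>s=0..P. \<Sum>p'=0..K. \<Sum>p=0..K.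
      scale (f s) (?C (k + s + p) (?D (l - s + p') (?T p (?R p' u)))))"
    by (rule sum.swap)
  also have "\<dots> = (\<Sum>s=0..P. scale (f s) (nexp2 X Y K u (k + s) (l - s)))"
    unfolding nexp2_def vec.scale_sum_right by (rule sum.cong[OF refl]) (rule sum.swap)
  also have "\<dots> = (\<Sum>s=0..L. scale (f s) (nexp2 X Y K u (k + s) (l - s)))"
    by (rule sum.mono_neutral_right) (use P L in \<open>auto intro!: nexp2_eq_0[OF X Y]\<close>)
  finally show ?thesis .
qed

lemma scalar_exp_one: "scalar_exp (\<lambda>r. 0) (\<lambda>s. if s = 0 then 1 else 0)"
  by (auto simp: scalar_exp_def)

text \<open>\<open>exp (- \<Sum>r. (c x)\<^sup>r / r) = 1 - c x\<close>.\<close>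

lemma scalar_exp_linear:
  assumes "c \<noteq> 0"
  shows "scalar_exp (\<lambda>r. - (c powi r / of_int r)) (\<lambda>s. if s = 0 then 1 else if s = 1 then - c else 0)"
  unfolding scalar_exp_def
proof (intro conjI allI impI)
  fix s K :: int assume s: "s \<le> K"
  let ?f = "\<lambda>s::int. if s = 0 then 1 else if s = 1 then - c else 0"
  have c: "c * c powi (s - 1) = c powi s"
    using assms power_int_add[of c 1 "s - 1"] by simp
  have "(\<Sum>r=1..K. of_int r * - (c powi r / of_int r) * ?f (s - r)) =
      (\<Sum>r=1..K. (if r = s then - (c powi s) else 0) + (if r = s - 1 then c powi s else 0))"
  proof (intro sum.cong refl)
    fix r assume "r \<in> {1..K}"
    then show "of_int r * - (c powi r / of_int r) * ?f (s - r) =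
        (if r = s then - (c powi s) else 0) + (if r = s - 1 then c powi s else 0)"
    proof -
      consider "r = s" | "r = s - 1" | "s - r \<noteq> 0" "s - r \<noteq> 1" by linarith
      then show ?thesis
        by cases (use \<open>r \<in> {1..K}\<close> c in \<open>auto simp: mult.commute\<close>)
    qed
  qed
  also have "\<dots> = of_int s * ?f s"
    using s by (auto simp: sum.distrib)
  finally show "of_int s * ?f s = (\<Sum>r=1..K. of_int r * - (c powi r / of_int r) * ?f (s - r))" ..
qed auto

text \<open>\<open>exp (\<Sum>r. (c x)\<^sup>r / r) = 1 / (1 - c x)\<close>.\<close>

lemma scalar_exp_geometric:
  assumes "c \<noteq> 0"
  shows "scalar_exp (\<lambda>r. c powi r / of_int r) (\<lambda>s. if s \<ge> 0 then c powi s else 0)"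
  unfolding scalar_exp_def
proof (intro conjI allI impI)
  fix s K :: int assume s: "s \<le> K"
  have "(\<Sum>r=1..K. of_int r * (c powi r / of_int r) * (if s - r \<ge> 0 then c powi (s - r) else 0)) =
     (\<Sum>r=1..K. if r \<le> s then c powi s else 0)"
    by (intro sum.cong refl) (use assms in \<open>auto simp flip: power_int_add\<close>)
  also have "\<dots> = (\<Sum>r=1..s. c powi s)"
    by (rule sum.mono_neutral_cong_right) (use s in auto)
  also have "\<dots> = of_int s * (if s \<ge> 0 then c powi s else 0)" by simp
  finally show "of_int s * (if s \<ge> 0 then c powi s else 0) =
    (\<Sum>r=1..K. of_int r * (c powi r / of_int r) * (if s - r \<ge> 0 then c powi (s - r) else 0))" ..
qed auto

section \<open>Delta functions and the three commutation laws\<close>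

text \<open>
  The modes of the normally ordered product of the exponentials of \<open>X\<close> and \<open>Y\<close> at the arguments
  \<open>c w\<close> and \<open>w\<close>: the coefficients of \<open>w\<^sup>-\<^sup>r\<close> in \<open>X(c w) + Y(w)\<close>.
\<close>

definition fused :: "complex \<Rightarrow> (int \<Rightarrow> oper) \<Rightarrow> (int \<Rightarrow> oper) \<Rightarrow> int \<Rightarrow> oper" where
  "fused c X Y r = (c powi (- r)) *\<^sub>o X r + Y r"

lemma modes_fused:
  assumes X: "modes X" and Y: "modes Y" and XY: "pairing X Y h"
  shows "modes (fused c X Y)"
  unfolding modes_def
proof (intro conjI allI impI ballI)
  fix r :: int assume "r \<noteq> 0"
  then show "lin (fused c X Y r)"
    unfolding fused_def by (intro lin_add lin_oscale modes_lin X Y)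
next
  fix r s :: int and v assume rs: "r * s > 0"
  then have nz: "r \<noteq> 0" "s \<noteq> 0" "r + s \<noteq> 0" "s + r \<noteq> 0"
    by (auto simp: zero_less_mult_iff)
  have [simp]: "X r (X s v) = X s (X r v)" "Y r (Y s v) = Y s (Y r v)"
    by (rule modes_commute[OF X rs] modes_commute[OF Y rs])+
  note [simp] = module_hom.add[OF modes_lin[OF X]] module_hom.add[OF modes_lin[OF Y]]
    module_hom.scale[OF modes_lin[OF X]] module_hom.scale[OF modes_lin[OF Y]]
  have "X r (Y s v) = Y s (X r v)" "X s (Y r v) = Y r (X s v)"
    using pairingD[OF XY, of r s] pairingD[OF XY, of s r] nz by auto
  then show "fused c X Y r (fused c X Y s v) = fused c X Y s (fused c X Y r v)"
    using nz by (simp add: fused_def oscale_def scale_add_right mult.commute add_ac)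
next
  fix r K :: int and v assume "r > 0" "v \<in> energy_le K"
  then show "fused c X Y r v \<in> energy_le (K - r)"
    using X Y by (auto simp: fused_def oscale_def modes_def intro!: energy_le_add energy_le_scale)
qed

lemma creation_fused:
  assumes X: "modes X" and Y: "modes Y" and XY: "pairing X Y h" and c: "c \<noteq> 0"
  shows "creation (fused c X Y) k v =
    (\<Sum>p=0..k. scale (c powi p) (creation X p (creation Y (k - p) v)))"
proof -
  have "is_exp (\<lambda>r. c powi r *\<^sub>o X (- r) + Y (- r))
     (\<lambda>k v. \<Sum>p=0..k. (c powi p *\<^sub>o creation X p) (creation Y (k - p) v))"
  proof (rule is_exp_mult[OF is_exp_rescale[OF is_exp_creation[OF X] _ c] _ is_exp_creation[OF Y]])
    fix r s :: int and v assume "r > 0" "s > 0"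
    then show "(c powi r *\<^sub>o X (- r)) (Y (- s) v) = Y (- s) ((c powi r *\<^sub>o X (- r)) v)"
      using pairingD[OF XY, of "- r" "- s" v]
      by (simp add: oscale_def module_hom.scale[OF modes_lin[OF Y]])
  qed (simp_all add: lin_oscale modes_lin X Y)
  moreover have "is_exp (\<lambda>r. c powi r *\<^sub>o X (- r) + Y (- r)) (creation (fused c X Y))"
    using is_exp_creation[OF modes_fused[OF X Y XY, of c]] by (simp add: fused_def)
  ultimately have "creation (fused c X Y) =
      (\<lambda>k v. \<Sum>p=0..k. (c powi p *\<^sub>o creation X p) (creation Y (k - p) v))"
    using is_exp_unique by blast
  then show ?thesis by (simp add: oscale_def)
qed

lemma annihilation_fused:
  assumes X: "modes X" and Y: "modes Y" and XY: "pairing X Y h" and c: "c \<noteq> 0"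
  shows "annihilation (fused c X Y) k v =
    (\<Sum>p=0..k. scale (c powi (- p)) (annihilation X p (annihilation Y (k - p) v)))"
proof -
  have c': "inverse c \<noteq> 0" and pc: "inverse c powi r = c powi (- r)" for r
    using c by (simp_all add: power_int_minus power_int_inverse)
  have "is_exp (\<lambda>r. c powi (- r) *\<^sub>o X r + Y r)
     (\<lambda>k v. \<Sum>p=0..k. (c powi (- p) *\<^sub>o annihilation X p) (annihilation Y (k - p) v))"
    unfolding pc[symmetric]
  proof (rule is_exp_mult[OF is_exp_rescale[OF is_exp_annihilation[OF X] _ c'] _ is_exp_annihilation[OF Y]])
    fix r s :: int and v assume "r > 0" "s > 0"
    then show "(inverse c powi r *\<^sub>o X r) (Y s v) = Y s ((inverse c powi r *\<^sub>o X r) v)"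
      using pairingD[OF XY, of r s v]
      by (simp add: oscale_def module_hom.scale[OF modes_lin[OF Y]])
  qed (simp_all add: lin_oscale modes_lin X Y)
  moreover have "is_exp (\<lambda>r. c powi (- r) *\<^sub>o X r + Y r) (annihilation (fused c X Y))"
    by (rule is_exp_cong[OF is_exp_annihilation[OF modes_fused[OF X Y XY, of c]]])
       (simp add: fused_def)
  ultimately have "annihilation (fused c X Y) =
      (\<lambda>k v. \<Sum>p=0..k. (c powi (- p) *\<^sub>o annihilation X p) (annihilation Y (k - p) v))"
    using is_exp_unique by blast
  then show ?thesis by (simp add: oscale_def)
qed

text \<open>
  Summing \<open>c\<^sup>p\<close> times the coefficient of \<open>z\<^sup>p w\<^sup>t\<^sup>-\<^sup>p\<close> substitutes \<open>z = c w\<close> and extracts the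
  coefficient of \<open>w\<^sup>t\<close>.  On normally ordered exponentials the substitution is performed in the
  exponents.
\<close>

lemma nexp2_delta:
  assumes X: "modes X" and Y: "modes Y" and XY: "pairing X Y h" and c: "c \<noteq> 0"
    and u: "u \<in> energy_le K" and K: "0 \<le> K"
  shows "(\<Sum>p=-K..t+K. scale (c powi p) (nexp2 X Y K u p (t - p))) = nexp (fused c X Y) t u"
proof -
  let ?C = "creation X" and ?D = "creation Y" and ?T = "annihilation X" and ?R = "annihilation Y"
  let ?CZ = "creation (fused c X Y)" and ?TZ = "annihilation (fused c X Y)"
  note Z = modes_fused[OF X Y XY, of c]
  note zero = module_hom.zero[OF lin_creation[OF X]] module_hom.zero[OF lin_creation[OF Y]]
    module_hom.zero[OF lin_creation[OF Z]] module_hom.zero[OF lin_annihilation[OF X]]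
  have "(\<Sum>p=-K..t+K. scale (c powi p) (nexp2 X Y K u p (t - p))) =
      (\<Sum>p=-K..t+K. \<Sum>a=0..K. \<Sum>b=0..K.
        scale (c powi p) (?C (p + a) (?D (t - p + b) (?T a (?R b u)))))"
    unfolding nexp2_def vec.scale_sum_right ..
  also have "\<dots> = (\<Sum>a=0..K. \<Sum>p=-K..t+K. \<Sum>b=0..K.
        scale (c powi p) (?C (p + a) (?D (t - p + b) (?T a (?R b u)))))"
    by (rule sum.swap)
  also have "\<dots> = (\<Sum>a=0..K. \<Sum>b=0..K. \<Sum>p=-K..t+K.
        scale (c powi p) (?C (p + a) (?D (t - p + b) (?T a (?R b u)))))"
    by (rule sum.cong[OF refl]) (rule sum.swap)
  also have "\<dots> = (\<Sum>a=0..K. \<Sum>b=0..K. ?CZ (t + a + b) (scale (c powi (- a)) (?T a (?R b u))))"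
  proof (rule sum.cong[OF refl], rule sum.cong[OF refl])
    fix a b assume a: "a \<in> {0..K}" and b: "b \<in> {0..K}"
    let ?w = "?T a (?R b u)"
    let ?f = "\<lambda>p. scale (c powi p) (?C (p + a) (?D (t - p + b) ?w))"
    have "sum ?f {-K..t+K} = (\<Sum>q=0..t+a+b. ?f (q - a))"
      by (rule sum_shift_support)
         (use a b in \<open>auto simp: not_le zero creation_neg[OF X] creation_neg[OF Y]\<close>)
    also have "\<dots> = (\<Sum>q=0..t+a+b. scale (c powi q)
        (?C q (?D (t + a + b - q) (scale (c powi (- a)) ?w))))"
      using c by (intro sum.cong refl) (simp add: module_hom.scale[OF lin_creation[OF X]]
        module_hom.scale[OF lin_creation[OF Y]] algebra_simps power_int_diff power_int_minus field_simps)
    finally show "sum ?f {-K..t+K} = ?CZ (t + a + b) (scale (c powi (- a)) ?w)"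
      by (simp add: creation_fused[OF X Y XY c])
  qed
  also have "\<dots> = (\<Sum>a=0..K. \<Sum>e=0..2*K. ?CZ (t + e) (scale (c powi (- a)) (?T a (?R (e - a) u))))"
  proof (rule sum.cong[OF refl])
    fix a assume a: "a \<in> {0..K}"
    let ?f = "\<lambda>b. ?CZ (t + a + b) (scale (c powi (- a)) (?T a (?R b u)))"
    have "sum ?f {0..K} = (\<Sum>e=0..2*K. ?f (e - a))"
      by (rule sum_shift_support)
         (use a in \<open>auto simp: not_le zero annihilation_neg[OF Y] annihilation_eq_0[OF Y u]\<close>)
    then show "sum ?f {0..K} =
        (\<Sum>e=0..2*K. ?CZ (t + e) (scale (c powi (- a)) (?T a (?R (e - a) u))))"
      by (simp add: algebra_simps)
  qed
  also have "\<dots> = (\<Sum>e=0..2*K. \<Sum>a=0..K. ?CZ (t + e) (scale (c powi (- a)) (?T a (?R (e - a) u))))"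
    by (rule sum.swap)
  also have "\<dots> = (\<Sum>e=0..2*K. ?CZ (t + e) (?TZ e u))"
  proof (rule sum.cong[OF refl])
    fix e assume "e \<in> {0..2*K}"
    let ?f = "\<lambda>a. scale (c powi (- a)) (?T a (?R (e - a) u))"
    have "?f a = 0" if "a \<in> {0..K} \<union> {0..e}" "a \<notin> {0..K} \<inter> {0..e}" for a
    proof (cases "a > e")
      case True
      then show ?thesis by (simp add: zero annihilation_neg[OF Y])
    next
      case False
      then have "?R (e - a) u \<in> energy_le K" "a > K"
        using energy_le_mono[OF annihilation_energy[OF Y u, of "e - a"]] that by auto
      then show ?thesis by (simp add: annihilation_eq_0[OF X])
    qed
    then have *: "\<forall>a\<in>{0..K} - {0..K} \<inter> {0..e}. ?f a = 0" "\<forall>a\<in>{0..e} - {0..K} \<inter> {0..e}. ?f a = 0"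
      by blast+
    have "sum ?f {0..K} = sum ?f ({0..K} \<inter> {0..e})" "sum ?f {0..e} = sum ?f ({0..K} \<inter> {0..e})"
      by (rule sum.mono_neutral_right[OF _ _ *(1)] sum.mono_neutral_right[OF _ _ *(2)]; simp)+
    then show "(\<Sum>a=0..K. ?CZ (t + e) (scale (c powi (- a)) (?T a (?R (e - a) u)))) =
        ?CZ (t + e) (?TZ e u)"
      by (simp add: annihilation_fused[OF X Y XY c] flip: module_hom.sum[OF lin_creation[OF Z]])
  qed
  also have "\<dots> = nexp (fused c X Y) t u"
    by (rule nexp_finite[OF Z u, symmetric]) (use K in simp)
  finally show ?thesis .
qed

text \<open>
  With these scalars, moving \<open>X\<close> past \<open>Y\<close> costs \<open>(1 - c w/z)\<^sup>\<nu>\<close>.  The condition covers both signs of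
  \<open>r\<close>, so moving \<open>Y\<close> past \<open>X\<close> costs \<open>(1 - z/(c w))\<^sup>\<nu>\<close>.
\<close>

definition vertex_pairing :: "(int \<Rightarrow> oper) \<Rightarrow> (int \<Rightarrow> oper) \<Rightarrow> int \<Rightarrow> complex \<Rightarrow> bool" where
  "vertex_pairing X Y \<nu> c \<longleftrightarrow> pairing X Y (\<lambda>r. - (of_int \<nu> * c powi r / of_int r))"

lemma vertex_pairing_swap:
  assumes "vertex_pairing X Y \<nu> c"
  shows "vertex_pairing Y X \<nu> (inverse c)"
proof -
  have "pairing X Y h \<Longrightarrow> h' = (\<lambda>r. - h (- r)) \<Longrightarrow> pairing Y X h'" for h h'
    using pairing_swap by simp
  from this[OF assms[unfolded vertex_pairing_def]] show ?thesis
    unfolding vertex_pairing_def by (simp add: fun_eq_iff power_int_minus power_int_inverse)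
qed

lemma nexp_commute_0:
  assumes X: "modes X" and Y: "modes Y" and XY: "vertex_pairing X Y 0 c"
  shows "nexp X k (nexp Y l u) = nexp Y l (nexp X k u)"
proof -
  obtain K where u: "u \<in> energy_le K" and K: "0 \<le> K" by (rule energy_le_exists)
  have *: "nexp X k (nexp Y l u) = nexp2 X Y K u k l"
    if "modes X" "modes Y" "vertex_pairing X Y 0 c" for X Y k l c
  proof -
    have p: "pairing X Y (\<lambda>r. 0)" using that(3) by (simp add: vertex_pairing_def)
    have "nexp X k (nexp Y l u) = (\<Sum>s=0..max 0 (l+K). scale (if s = 0 then 1 else 0) (nexp2 X Y K u (k + s) (l - s)))"
      by (rule nexp_product[OF that(1,2) p scalar_exp_one u]) simp
    also have "\<dots> = (\<Sum>s\<in>{0}. scale (if s = 0 then 1 else 0) (nexp2 X Y K u (k + s) (l - s)))"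
      by (rule sum.mono_neutral_right) auto
    finally show ?thesis by simp
  qed
  show ?thesis
    using *[OF X Y XY] *[OF Y X vertex_pairing_swap[OF XY]]
      nexp2_swap[OF X Y XY[unfolded vertex_pairing_def]] by simp
qed

text \<open>
  Both sides are coefficients of \<open>z - c w\<close> times the joint normal ordering.
\<close>

lemma nexp_commute_1:
  assumes X: "modes X" and Y: "modes Y" and XY: "vertex_pairing X Y 1 c" and c: "c \<noteq> 0"
  shows "nexp X (k - 1) (nexp Y l u) = scale (- c) (nexp Y (l - 1) (nexp X k u))"
proof -
  obtain K where u: "u \<in> energy_le K" and K: "0 \<le> K" by (rule energy_le_exists)
  have *: "nexp X k (nexp Y l u) = nexp2 X Y K u k l - scale c (nexp2 X Y K u (k + 1) (l - 1))"
    if "modes X" "modes Y" "vertex_pairing X Y 1 c" "c \<noteq> 0" for X Y k l c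
  proof -
    have p: "pairing X Y (\<lambda>r. - (c powi r / of_int r))" using that(3) by (simp add: vertex_pairing_def)
    let ?f = "\<lambda>s. scale (if s = 0 then 1 else if s = 1 then - c else 0) (nexp2 X Y K u (k + s) (l - s))"
    have "nexp X k (nexp Y l u) = (\<Sum>s=0..max 1 (l+K). ?f s)"
      by (rule nexp_product[OF that(1,2) p scalar_exp_linear[OF that(4)] u]) simp
    also have "\<dots> = (\<Sum>s\<in>{0,1}. ?f s)"
      by (rule sum.mono_neutral_right) auto
    finally show ?thesis by (simp add: vec.scale_minus_left)
  qed
  have **: "nexp Y (l - 1) (nexp X k u) =
      nexp2 X Y K u k (l - 1) - scale (inverse c) (nexp2 X Y K u (k - 1) l)"
    using *[OF Y X vertex_pairing_swap[OF XY], of "l - 1" k] c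
      nexp2_swap[OF X Y XY[unfolded vertex_pairing_def]] by simp
  show ?thesis
    unfolding ** using c *[OF X Y XY c, of "k - 1" l]
    by (simp add: vec.scale_right_diff_distrib vec.scale_minus_left)
qed

text \<open>
  The expansions of \<open>1/(z - c w)\<close> in \<open>w/z\<close> and of \<open>1/(c w - z)\<close> in \<open>z/w\<close> add up to the series
  \<open>\<Sum>p. (c w)\<^sup>p z\<^sup>-\<^sup>p\<^sup>-\<^sup>1\<close> over all integers \<open>p\<close>, a delta function.
\<close>

lemma nexp_commutator_minus_1:
  assumes X: "modes X" and Y: "modes Y" and XY: "vertex_pairing X Y (- 1) c" and c: "c \<noteq> 0"
  shows "scale c (nexp X (k + 1) (nexp Y l u)) + nexp Y (l + 1) (nexp X k u) =
    scale (c powi (- k)) (nexp (fused c X Y) (k + l + 1) u)"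
proof -
  obtain K where u: "u \<in> energy_le K" and K: "0 \<le> K" by (rule energy_le_exists)
  note XY' = XY[unfolded vertex_pairing_def]
  let ?G = "nexp2 X Y K u"
  have *: "nexp X k (nexp Y l u) = (\<Sum>s=0..L. scale (c powi s) (nexp2 X Y K u (k + s) (l - s)))"
    if "modes X" "modes Y" "vertex_pairing X Y (- 1) c" "c \<noteq> 0" "l + K \<le> L" for X Y k l c L
  proof -
    have p: "pairing X Y (\<lambda>r. c powi r / of_int r)" using that(3) by (simp add: vertex_pairing_def)
    have "nexp X k (nexp Y l u) = (\<Sum>s=0..L. scale (if s \<ge> 0 then c powi s else 0) (nexp2 X Y K u (k + s) (l - s)))"
      by (rule nexp_product[OF that(1,2) p scalar_exp_geometric[OF that(4)] u that(5)])
    then show ?thesis by simp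
  qed
  \<comment> \<open>Any bound beyond the support of both geometric series will do.\<close>
  define L where "L = \<bar>k\<bar> + \<bar>l\<bar> + \<bar>K\<bar> + 1"
  let ?f = "\<lambda>p. scale (c powi p) (?G (k + p) (l + 1 - p))"
  have "nexp X (k + 1) (nexp Y l u) = (\<Sum>s=0..L. scale (c powi s) (?G (k + 1 + s) (l - s)))"
    by (rule *[OF X Y XY c]) (simp add: L_def)
  then have "scale c (nexp X (k + 1) (nexp Y l u)) = (\<Sum>s=0..L. ?f (s + 1))"
    using c by (simp add: vec.scale_sum_right power_int_add algebra_simps)
  also have "\<dots> = sum ?f {1..L+1}"
    by (rule sum.reindex_bij_witness[of _ "\<lambda>p. p - 1" "\<lambda>s. s + 1"]) auto
  finally have 1: "scale c (nexp X (k + 1) (nexp Y l u)) = sum ?f {1..L+1}" .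
  have "nexp Y (l + 1) (nexp X k u) =
      (\<Sum>s=0..L. scale (inverse c powi s) (nexp2 Y X K u (l + 1 + s) (k - s)))"
    by (rule *[OF Y X vertex_pairing_swap[OF XY]]) (use c in \<open>simp_all add: L_def\<close>)
  also have "\<dots> = (\<Sum>s=0..L. ?f (- s))"
    by (simp add: nexp2_swap[OF X Y XY'] power_int_minus power_int_inverse)
  also have "\<dots> = sum ?f {-L..0}"
    by (rule sum.reindex_bij_witness[of _ uminus uminus]) auto
  finally have 2: "nexp Y (l + 1) (nexp X k u) = sum ?f {-L..0}" .
  have "{-L..L+1} = {1..L+1} \<union> {-L..0}" by (auto simp: L_def)
  then have "sum ?f {-L..L+1} = sum ?f {1..L+1} + sum ?f {-L..0}"
    by (simp add: sum.union_disjoint)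
  moreover have "sum ?f {-L..L+1} = (\<Sum>p=-K..(k+l+1)+K. ?f (p - k))"
    by (rule sum_shift_support) (auto simp: L_def not_le intro!: nexp2_eq_0[OF X Y])
  moreover have "\<dots> = (\<Sum>p=-K..(k+l+1)+K. scale (c powi (- k)) (scale (c powi p) (?G p (k + l + 1 - p))))"
    using c by (intro sum.cong refl) (simp add: algebra_simps flip: power_int_add)
  moreover have "\<dots> = scale (c powi (- k)) (nexp (fused c X Y) (k + l + 1) u)"
    unfolding nexp2_delta[OF X Y XY' c u K, symmetric] vec.scale_sum_right ..
  ultimately show ?thesis using 1 2 by simp
qed

section \<open>Commutators of vertex operators\<close>

text \<open>
  The zero modes act on a lattice weight by scalars that depend on the weight, so products of vertex
  operators are compared on one weight at a time.
\<close>

definition weight_space :: "lattice \<Rightarrow> vec set" where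
  "weight_space M = {v. \<forall>b\<in>Poly_Mapping.keys v. snd b = M}"

lemma ket_weight_space: "ket (\<mu>, M) \<in> weight_space M"
  by (simp add: weight_space_def ket_def)

lemma ket_weight_space_snd: "ket b \<in> weight_space (snd b)"
  by (simp add: weight_space_def ket_def)

lemma subspace_weight_space: "vec.subspace (weight_space M)"
proof (rule vec.subspaceI)
  fix v w assume "v \<in> weight_space M" "w \<in> weight_space M"
  then show "v + w \<in> weight_space M"
    using Poly_Mapping.keys_add[of v w] unfolding weight_space_def by blast
qed (auto simp: weight_space_def in_keys_iff)

lemma linext_in_subspace:
  assumes "vec.subspace S" "\<And>b. b \<in> Poly_Mapping.keys v \<Longrightarrow> f b \<in> S"
  shows "linext f v \<in> S"
  unfolding linext_def by (intro vec.subspace_sum vec.subspace_scale assms)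

lemma lin_eqI_weight_space:
  assumes "lin X" "lin Y" "\<And>\<mu>. X (ket (\<mu>, M)) = Y (ket (\<mu>, M))" and v: "v \<in> weight_space M"
  shows "X v = Y v"
proof -
  have *: "X (ket b) = Y (ket b)" if "b \<in> Poly_Mapping.keys v" for b
    using v that assms(3)[of "fst b"] by (auto simp: weight_space_def)
  show ?thesis
    using lin_expand[OF assms(1), of v] lin_expand[OF assms(2), of v] * by simp
qed

lemma nexp_in_subspace:
  assumes X: "modes X" and S: "vec.subspace S" "\<And>r w. r \<noteq> 0 \<Longrightarrow> w \<in> S \<Longrightarrow> X r w \<in> S"
    and v: "v \<in> S"
  shows "nexp X k v \<in> S"
proof -
  have C: "creation X j w \<in> S" if "w \<in> S" for j w
    using is_exp_creation[OF X] that
    by (induction arbitrary: w rule: is_exp_induct)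
       (auto simp: oscale_def S(2) intro: vec.subspace_0 vec.subspace_add vec.subspace_scale S(1))
  have T: "annihilation X j w \<in> S" if "w \<in> S" for j w
    using is_exp_annihilation[OF X] that
    by (induction arbitrary: w rule: is_exp_induct)
       (auto simp: oscale_def S(2) intro: vec.subspace_0 vec.subspace_add vec.subspace_scale S(1))
  obtain K where K: "v \<in> energy_le K" by (rule energy_le_exists)
  show ?thesis
    unfolding nexp_finite[OF X K order.refl] by (intro vec.subspace_sum S(1) C T v)
qed

text \<open>
  A vertex operator: a normally ordered exponential of \<open>X\<close>, times a lattice operator \<open>\<sigma>\<close> that shifts
  the weight by \<open>\<delta>\<close>, times the scalar \<open>f M\<close> and the power of \<open>z\<close> with exponent \<open>N M\<close> on vectors of
  weight \<open>M\<close>.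
\<close>

locale vertex_op =
  fixes X :: "int \<Rightarrow> oper" and \<sigma> :: oper and \<delta> :: lattice
    and f :: "lattice \<Rightarrow> complex" and N :: "lattice \<Rightarrow> int" and W :: current
  assumes modes: "modes X"
    and X_weight: "r \<noteq> 0 \<Longrightarrow> v \<in> weight_space M \<Longrightarrow> X r v \<in> weight_space M"
    and lin_\<sigma>: "lin \<sigma>"
    and \<sigma>_weight: "v \<in> weight_space M \<Longrightarrow> \<sigma> v \<in> weight_space (M + \<delta>)"
    and W_eq: "v \<in> weight_space M \<Longrightarrow> W k v = scale (f M) (nexp X (k - N M) (\<sigma> v))"
begin

lemma nexp_weight: "v \<in> weight_space M \<Longrightarrow> nexp X k v \<in> weight_space M"
  by (rule nexp_in_subspace[OF modes subspace_weight_space X_weight])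

lemma W_weight: "v \<in> weight_space M \<Longrightarrow> W k v \<in> weight_space (M + \<delta>)"
  by (simp add: W_eq vec.subspace_scale[OF subspace_weight_space] nexp_weight \<sigma>_weight)

end

text \<open>
  The integer \<open>\<nu>\<close> occurs in three places, which have to match for the commutation laws: in the
  contraction, in the powers of \<open>z\<close> (as the inner product of the shifts) and in the sign rule for the
  lattice operators.
\<close>

locale vertex_op_pair = W: vertex_op X \<sigma> \<delta> f N W + W': vertex_op X' \<sigma>' \<delta>' f' N' W'
  for X \<sigma> \<delta> f N W X' \<sigma>' \<delta>' f' N' W' +
  fixes \<nu> :: int and c :: complex
  assumes pairing: "vertex_pairing X X' \<nu> c" and c: "c \<noteq> 0"
    and \<sigma>X': "r \<noteq> 0 \<Longrightarrow> \<sigma> (X' r v) = X' r (\<sigma> v)"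
    and \<sigma>'X: "r \<noteq> 0 \<Longrightarrow> \<sigma>' (X r v) = X r (\<sigma>' v)"
    and N_shift: "N (M + \<delta>') = N M + \<nu>" and N'_shift: "N' (M + \<delta>) = N' M + \<nu>"
    and \<sigma>_swap: "\<sigma>' (\<sigma> v) = scale ((- 1) powi \<nu>) (\<sigma> (\<sigma>' v))"
    and f_swap: "f' M * f (M + \<delta>') = c powi (- \<nu>) * (f M * f' (M + \<delta>))"
begin

text \<open>
  Both orders are brought to the same scalar \<open>f M * f' (M + \<delta>)\<close> and the same lattice operator.
\<close>

lemma WW':
  assumes "v \<in> weight_space M"
  shows "W k (W' l v) = scale (c powi (- \<nu>) * (f M * f' (M + \<delta>)))
    (nexp X (k - N M - \<nu>) (nexp X' (l - N' M) (\<sigma> (\<sigma>' v))))"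
  unfolding f_swap[symmetric]
  by (subst W.W_eq[OF W'.W_weight[OF assms]], subst W'.W_eq[OF assms])
     (simp add: module_hom.scale[OF W.lin_\<sigma>] module_hom.scale[OF lin_nexp[OF W.modes]]
      nexp_commute[OF W'.modes W.lin_\<sigma> \<sigma>X'] N_shift algebra_simps)

lemma W'W:
  assumes "v \<in> weight_space M"
  shows "W' l (W k v) = scale ((- 1) powi \<nu> * (f M * f' (M + \<delta>)))
    (nexp X' (l - N' M - \<nu>) (nexp X (k - N M) (\<sigma> (\<sigma>' v))))"
  by (subst W'.W_eq[OF W.W_weight[OF assms]], subst W.W_eq[OF assms])
     (simp add: module_hom.scale[OF W'.lin_\<sigma>] module_hom.scale[OF lin_nexp[OF W'.modes]]
      module_hom.scale[OF lin_nexp[OF W.modes]] nexp_commute[OF W.modes W'.lin_\<sigma> \<sigma>'X]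
      N'_shift \<sigma>_swap algebra_simps)

lemma commute:
  assumes "\<nu> = 0 \<or> \<nu> = 1" "v \<in> weight_space M"
  shows "W k (W' l v) = W' l (W k v)"
proof (cases "\<nu> = 0")
  case True
  then show ?thesis
    using nexp_commute_0[OF W.modes W'.modes] pairing WW'[OF assms(2)] W'W[OF assms(2)] by simp
next
  case False
  then have \<nu>: "\<nu> = 1" using assms by simp
  show ?thesis
    using nexp_commute_1[OF W.modes W'.modes pairing[unfolded \<nu>] c, of "k - N M" "l - N' M" "\<sigma> (\<sigma>' v)"]
      WW'[OF assms(2), of k l] W'W[OF assms(2), of l k] c
    by (simp add: \<nu> vec.scale_minus_left)
qed

text \<open>
  The right-hand side depends on the two vertex operators only through their fused modes, the
  composition of their lattice operators, the sum of their exponents of \<open>z\<close> and a scalar.  This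
  makes the commutators of different pairs comparable.
\<close>

lemma commutator:
  assumes "\<nu> = - 1" "v \<in> weight_space M"
  shows "W k (W' l v) - W' l (W k v) = scale (f M * f' (M + \<delta>) * c powi (N M - k))
    (nexp (fused c X X') (k + l + 1 - (N M + N' M)) (\<sigma> (\<sigma>' v)))"
proof -
  have "W k (W' l v) - W' l (W k v) = scale (f M * f' (M + \<delta>))
     (scale c (nexp X (k - N M + 1) (nexp X' (l - N' M) (\<sigma> (\<sigma>' v)))) +
      nexp X' (l - N' M + 1) (nexp X (k - N M) (\<sigma> (\<sigma>' v))))"
    using WW'[OF assms(2), of k l] W'W[OF assms(2), of l k]
    by (simp add: assms(1) scale_add_right vec.scale_minus_left mult_ac)
  also have "\<dots> = scale (f M * f' (M + \<delta>) * c powi (N M - k))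
    (nexp (fused c X X') (k + l + 1 - (N M + N' M)) (\<sigma> (\<sigma>' v)))"
    by (subst nexp_commutator_minus_1[OF W.modes W'.modes pairing[unfolded assms(1)] c])
       (simp add: algebra_simps)
  finally show ?thesis .
qed

end

section \<open>Sign rules of the lattice operators\<close>

lemma neg_one_powi_square: "(- 1) powi k * (- 1) powi k = (1 :: complex)"
  by (simp flip: power_int_mult_distrib)

context toroidal_fock
begin

text \<open>
  The sign exponent of \<open>eeps\<close> at a position \<open>(i, j)\<close> inside the rectangle.
\<close>

definition cocycle :: "int \<Rightarrow> int \<Rightarrow> lattice \<Rightarrow> int" where
  "cocycle i j M = (\<Sum>s=0..i - 1. \<Sum>t=0..n - 1. Poly_Mapping.lookup M (s, t)) +
     (\<Sum>t=0..j - 1. Poly_Mapping.lookup M (i, t))"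

lemma eeps_ket:
  assumes "0 \<le> i" "i < m" "0 \<le> j" "j < n"
  shows "eeps \<sigma> i j (ket (\<mu>, M)) =
    scale ((- 1) powi cocycle i j M) (ket (\<mu>, M + Poly_Mapping.single (i, j) \<sigma>))"
proof -
  have "(\<Sum>s=0..i - 1. \<Sum>t=0..n - 1. del s t M) + (\<Sum>t=0..j - 1. del i t M) = cocycle i j M"
    unfolding cocycle_def del_def using assms
    by (intro arg_cong2[of _ _ _ _ "(+)"] sum.cong refl) auto
  then show ?thesis using assms by (simp add: eeps_def)
qed

lemma cocycle_add_single:
  assumes "0 \<le> i" "i < m" "0 \<le> j" "j < n" "0 \<le> k" "k < m" "0 \<le> l" "l < n"
  shows "cocycle i j (M + Poly_Mapping.single (k, l) \<tau>) =
    cocycle i j M + (if k < i \<or> k = i \<and> l < j then \<tau> else 0)"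
proof -
  have "(\<Sum>t=0..b. if (k, l) = (s, t) then \<tau> else 0) = (if k = s \<and> l \<le> b then \<tau> else 0)" for s b
    using assms by (cases "k = s") auto
  moreover have "(\<Sum>s=0..i - 1. if k = s \<and> l \<le> n - 1 then \<tau> else 0) = (if k < i then \<tau> else 0)"
    using assms by (cases "l \<le> n - 1") auto
  ultimately show ?thesis
    using assms by (auto simp: cocycle_def lookup_add lookup_single when_def sum.distrib)
qed

lemma lin_eeps: "lin (eeps \<sigma> i j)"
  unfolding eeps_def by (rule lin_linext)

lemma eeps_inverse:
  assumes "0 \<le> i" "i < m" "0 \<le> j" "j < n"
  shows "eeps \<sigma> i j (eeps (- \<sigma>) i j v) = v"
proof -
  have "(eeps \<sigma> i j \<circ> eeps (- \<sigma>) i j) v = id v"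
  proof (rule lin_eqI[OF lin_comp[OF lin_eeps lin_eeps] lin_id])
    fix b :: state
    obtain \<mu> M where b: "b = (\<mu>, M)" by fastforce
    show "(eeps \<sigma> i j \<circ> eeps (- \<sigma>) i j) (ket b) = id (ket b)"
      using assms
      by (simp add: b eeps_ket module_hom.scale[OF lin_eeps] cocycle_add_single add.assoc
          neg_one_powi_square flip: single_add)
  qed
  then show ?thesis by simp
qed

text \<open>
  Of two different positions exactly one precedes the other, so exactly one of the two orders
  changes the sign exponent, by one.
\<close>

lemma eeps_swap:
  assumes "0 \<le> i" "i < m" "0 \<le> j" "j < n" "0 \<le> k" "k < m" "0 \<le> l" "l < n"
    and "\<sigma> = 1 \<or> \<sigma> = - 1" "\<tau> = 1 \<or> \<tau> = - 1"
  shows "eeps \<sigma> i j (eeps \<tau> k l v) =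
    scale (if (i, j) = (k, l) then 1 else - 1) (eeps \<tau> k l (eeps \<sigma> i j v))"
proof -
  have "(eeps \<sigma> i j \<circ> eeps \<tau> k l) v =
      ((if (i, j) = (k, l) then 1 else - 1) *\<^sub>o (eeps \<tau> k l \<circ> eeps \<sigma> i j)) v"
  proof (rule lin_eqI[OF lin_comp[OF lin_eeps lin_eeps] lin_oscale[OF lin_comp[OF lin_eeps lin_eeps]]])
    fix b :: state
    obtain \<mu> M where b: "b = (\<mu>, M)" by fastforce
    have "(- 1) powi (x + y) = - ((- 1 :: complex) powi x)" if "y = 1 \<or> y = - 1" for x y
      using that by (auto simp: power_int_add)
    then show "(eeps \<sigma> i j \<circ> eeps \<tau> k l) (ket b) =
       ((if (i, j) = (k, l) then 1 else - 1) *\<^sub>o (eeps \<tau> k l \<circ> eeps \<sigma> i j)) (ket b)"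
      using assms
      by (auto simp: b eeps_ket module_hom.scale[OF lin_eeps] cocycle_add_single oscale_def
          add_ac mult_ac)
  qed
  then show ?thesis by (simp add: oscale_def)
qed

lemma eeps_weight:
  assumes "0 \<le> i" "i < m" "0 \<le> j" "j < n" "v \<in> weight_space M"
  shows "eeps \<sigma> i j v \<in> weight_space (M + Poly_Mapping.single (i, j) \<sigma>)"
  unfolding eeps_def
proof (rule linext_in_subspace[OF subspace_weight_space])
  fix b assume "b \<in> Poly_Mapping.keys v"
  then obtain \<mu> where b: "b = (\<mu>, M)" using assms(5) by (cases b) (auto simp: weight_space_def)
  show "(case b of (\<mu>, M) \<Rightarrow>
     scale ((-1) powi ((\<Sum>s=0..i mod m - 1. \<Sum>t=0..n - 1. del s t M) +
                       (\<Sum>t=0..j mod n - 1. del i t M)))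
       (ket (\<mu>, M + Poly_Mapping.single (i mod m, j mod n) \<sigma>)))
     \<in> weight_space (M + Poly_Mapping.single (i, j) \<sigma>)"
    using assms by (simp add: b vec.subspace_scale[OF subspace_weight_space] ket_weight_space)
qed

end

section \<open>Oscillator modes\<close>

text \<open>
  Scalar commutators propagate through the linear combinations that define the families of modes.
\<close>

definition commutator_is :: "oper \<Rightarrow> oper \<Rightarrow> complex \<Rightarrow> bool" where
  "commutator_is X Y c \<longleftrightarrow> (\<forall>v. X (Y v) = Y (X v) + scale c v)"

lemma commutator_is_zero_right: "lin X \<Longrightarrow> commutator_is X 0 0"
  by (simp add: commutator_is_def module_hom.zero)

lemma commutator_is_add_right:
  "lin X \<Longrightarrow> commutator_is X Y c \<Longrightarrow> commutator_is X Z d \<Longrightarrow> commutator_is X (Y + Z) (c + d)"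
  by (simp add: commutator_is_def module_hom.add scale_add_left add_ac)

lemma commutator_is_diff_right:
  "lin X \<Longrightarrow> commutator_is X Y c \<Longrightarrow> commutator_is X Z d \<Longrightarrow> commutator_is X (Y - Z) (c - d)"
  by (simp add: commutator_is_def module_hom.diff vec.scale_left_diff_distrib)

lemma commutator_is_oscale_right:
  "lin X \<Longrightarrow> commutator_is X Y c \<Longrightarrow> commutator_is X (k *\<^sub>o Y) (k * c)"
  by (simp add: commutator_is_def module_hom.scale oscale_def scale_add_right)

lemma commutator_is_swap: "commutator_is X Y c \<Longrightarrow> commutator_is Y X (- c)"
  by (simp add: commutator_is_def vec.scale_minus_left)

lemma commutator_is_add_left:
  "lin Z \<Longrightarrow> commutator_is X Z c \<Longrightarrow> commutator_is Y Z d \<Longrightarrow> commutator_is (X + Y) Z (c + d)"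
  by (simp add: commutator_is_def module_hom.add scale_add_left add_ac)

lemma commutator_is_diff_left:
  "lin Z \<Longrightarrow> commutator_is X Z c \<Longrightarrow> commutator_is Y Z d \<Longrightarrow> commutator_is (X - Y) Z (c - d)"
  by (simp add: commutator_is_def module_hom.diff vec.scale_left_diff_distrib)

lemma commutator_is_oscale_left:
  "lin Z \<Longrightarrow> commutator_is X Z c \<Longrightarrow> commutator_is (k *\<^sub>o X) Z (k * c)"
  by (simp add: commutator_is_def module_hom.scale oscale_def scale_add_right)

lemma commutator_is_sum_right:
  assumes "lin X" "\<And>x. x \<in> S \<Longrightarrow> commutator_is X (f x) (c x)"
  shows "commutator_is X (\<Sum>x\<in>S. f x) (\<Sum>x\<in>S. c x)"
  using assms(2)
  by (induction S rule: infinite_finite_induct)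
     (simp_all add: commutator_is_zero_right commutator_is_add_right assms(1) del: plus_fun_apply)

lemma commutator_is_sum_left:
  assumes "lin Z" "\<And>x. x \<in> S \<Longrightarrow> commutator_is (f x) Z (c x)"
  shows "commutator_is (\<Sum>x\<in>S. f x) Z (\<Sum>x\<in>S. c x)"
  using commutator_is_swap[OF commutator_is_sum_right[OF assms(1) commutator_is_swap[OF assms(2)]]]
  by (simp add: sum_negf)

context toroidal_fock_pos
begin

lemma qint_uminus: "qint (- r) = - qint r"
  by (simp add: qint_def minus_divide_left)

lemma lin_a: "lin (a i j r)"
  unfolding a_def by (rule lin_linext)

lemma a_ket_neg:
  assumes "r < 0"
  shows "a i j r (ket (\<mu>, M)) = ket (\<mu> + Poly_Mapping.single (i mod m, j mod n, - r) 1, M)"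
  using assms by (simp add: a_def Let_def)

lemma a_ket_pos:
  assumes "r > 0"
  shows "a i j r (ket (\<mu>, M)) =
    scale (qint r ^ 2 / of_int r * of_nat (Poly_Mapping.lookup \<mu> (i mod m, j mod n, r)))
      (ket (\<mu> - Poly_Mapping.single (i mod m, j mod n, r) 1, M))"
  using assms by (simp add: a_def Let_def)

lemma commutator_is_a:
  assumes r: "r \<noteq> 0" and s: "s \<noteq> 0"
  shows "commutator_is (a i j r) (a k l s)
    (if i mod m = k mod m \<and> j mod n = l mod n \<and> r + s = 0 then qint r ^ 2 / of_int r else 0)"
proof -
  have *: "commutator_is (a i j r) (a k l s) c"
    if "\<And>x. a i j r (a k l s (ket x)) = a k l s (a i j r (ket x)) + scale c (ket x)" for i j r k l s c
  proof -
    have "(a i j r \<circ> a k l s) v = ((a k l s \<circ> a i j r) + c *\<^sub>o id) v" for v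
      by (rule lin_eqI[OF lin_comp[OF lin_a lin_a] lin_add[OF lin_comp[OF lin_a lin_a] lin_oscale[OF lin_id]]])
         (simp add: that oscale_def)
    then show ?thesis by (simp add: commutator_is_def oscale_def)
  qed
  have mod: "a i j r = a (i mod m) (j mod n) r" for i j r
    by (simp only: a_def mod_mod_trivial)
  have pn: "commutator_is (a i j r) (a k l s)
    (if i mod m = k mod m \<and> j mod n = l mod n \<and> r + s = 0 then qint r ^ 2 / of_int r else 0)"
    if "r > 0" "s < 0" for i j k l r s
  proof (rule *)
    fix x
    have "a (i mod m) (j mod n) r (a (k mod m) (l mod n) (- (- s)) (ket x)) -
        a (k mod m) (l mod n) (- (- s)) (a (i mod m) (j mod n) r (ket x)) =
      scale (if i mod m = k mod m \<and> j mod n = l mod n \<and> r = - s then qint r ^ 2 / of_int r else 0) (ket x)"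
      by (rule heisenberg) (use that m_pos n_pos in auto)
    then show "a i j r (a k l s (ket x)) = a k l s (a i j r (ket x)) +
       scale (if i mod m = k mod m \<and> j mod n = l mod n \<and> r + s = 0 then qint r ^ 2 / of_int r else 0) (ket x)"
      by (simp add: mod[symmetric] algebra_simps eq_neg_iff_add_eq_0)
  qed
  consider "r > 0" "s < 0" | "r < 0" "s > 0" | "r < 0" "s < 0" | "r > 0" "s > 0"
    using r s by linarith
  then show ?thesis
  proof cases
    case 1
    then show ?thesis by (rule pn)
  next
    case 2
    have "commutator_is (a i j r) (a k l s)
       (- (if k mod m = i mod m \<and> l mod n = j mod n \<and> s + r = 0 then qint s ^ 2 / of_int s else 0))"
      by (rule commutator_is_swap[OF pn]) (use 2 in auto)
    moreover have "- (if k mod m = i mod m \<and> l mod n = j mod n \<and> s + r = 0 then qint s ^ 2 / of_int s else 0) =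
       (if i mod m = k mod m \<and> j mod n = l mod n \<and> r + s = 0 then qint r ^ 2 / of_int r else 0)"
      by (auto simp: add_eq_0_iff qint_uminus)
    ultimately show ?thesis by simp
  next
    case 3
    show ?thesis
    proof (rule *)
      fix x :: state
      obtain \<mu> M where x: "x = (\<mu>, M)" by fastforce
      show "a i j r (a k l s (ket x)) = a k l s (a i j r (ket x)) +
       scale (if i mod m = k mod m \<and> j mod n = l mod n \<and> r + s = 0 then qint r ^ 2 / of_int r else 0) (ket x)"
        using 3 by (simp add: x a_ket_neg add_ac)
    qed
  next
    case 4
    show ?thesis
    proof (rule *)
      fix x :: state
      obtain \<mu> M where x: "x = (\<mu>, M)" by fastforce
      let ?x = "(i mod m, j mod n, r)" and ?y = "(k mod m, l mod n, s)"
      show "a i j r (a k l s (ket x)) = a k l s (a i j r (ket x)) +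
       scale (if i mod m = k mod m \<and> j mod n = l mod n \<and> r + s = 0 then qint r ^ 2 / of_int r else 0) (ket x)"
      proof (cases "?x = ?y")
        case True
        then have "a i j r = a k l s" using mod by (metis prod.inject)
        then show ?thesis using 4 by simp
      next
        case False
        then have "Poly_Mapping.lookup (\<mu> - Poly_Mapping.single ?y 1) ?x = Poly_Mapping.lookup \<mu> ?x"
          "Poly_Mapping.lookup (\<mu> - Poly_Mapping.single ?x 1) ?y = Poly_Mapping.lookup \<mu> ?y"
          by (auto simp: lookup_minus lookup_single when_def)
        then show ?thesis
          using 4 by (simp add: x a_ket_pos module_hom.scale[OF lin_a] diff_right_commute mult_ac)
      qed
    qed
  qed
qed

text \<open>
  All families of modes are linear combinations of the oscillators with the same index \<open>r\<close>; the
  general properties are inherited from \<open>a\<close>.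
\<close>

inductive_set mode_space :: "int \<Rightarrow> oper set" for r where
  zero: "0 \<in> mode_space r"
| a: "a i j r \<in> mode_space r"
| add: "X \<in> mode_space r \<Longrightarrow> Y \<in> mode_space r \<Longrightarrow> X + Y \<in> mode_space r"
| diff: "X \<in> mode_space r \<Longrightarrow> Y \<in> mode_space r \<Longrightarrow> X - Y \<in> mode_space r"
| oscale: "X \<in> mode_space r \<Longrightarrow> c *\<^sub>o X \<in> mode_space r"

lemma mode_space_sum: "(\<And>x. x \<in> S \<Longrightarrow> f x \<in> mode_space r) \<Longrightarrow> (\<Sum>x\<in>S. f x) \<in> mode_space r"
proof (induction S rule: infinite_finite_induct)
  case (insert x S)
  then show ?case unfolding sum.insert[OF insert.hyps] by (intro mode_space.add) auto
qed (simp_all only: sum.infinite sum.empty mode_space.zero not_False_eq_True)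

lemma lin_mode_space: "X \<in> mode_space r \<Longrightarrow> lin X"
  by (induction rule: mode_space.induct) (intro lin_zero lin_a lin_add lin_diff lin_oscale; assumption)+

lemma commutator_is_mode_space:
  assumes "X \<in> mode_space r" "Y \<in> mode_space s" "r \<noteq> 0" "s \<noteq> 0" "r + s \<noteq> 0"
  shows "commutator_is X Y 0"
proof -
  have *: "commutator_is (a i j r) Y 0" for i j
    using assms(2)
  proof (induction rule: mode_space.induct)
    case zero then show ?case by (rule commutator_is_zero_right[OF lin_a])
  next
    case (a k l) then show ?case using commutator_is_a[OF assms(3,4), of i j k l] assms(5) by simp
  next
    case (add X Y) then show ?case using commutator_is_add_right[OF lin_a add.IH] by (simp only: add_0_left diff_self mult_zero_right minus_zero)
  next
    case (diff X Y) then show ?case using commutator_is_diff_right[OF lin_a diff.IH] by (simp only: add_0_left diff_self mult_zero_right minus_zero)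
  next
    case (oscale X c) then show ?case using commutator_is_oscale_right[OF lin_a oscale.IH] by (simp only: add_0_left diff_self mult_zero_right minus_zero)
  qed
  note lin = lin_mode_space[OF assms(2)]
  show ?thesis
    using assms(1)
  proof (induction rule: mode_space.induct)
    case zero then show ?case using commutator_is_swap[OF commutator_is_zero_right[OF lin]] by (simp only: add_0_left diff_self mult_zero_right minus_zero)
  next
    case (a k l) then show ?case by (rule *)
  next
    case (add X Y) then show ?case using commutator_is_add_left[OF lin add.IH] by (simp only: add_0_left diff_self mult_zero_right minus_zero)
  next
    case (diff X Y) then show ?case using commutator_is_diff_left[OF lin diff.IH] by (simp only: add_0_left diff_self mult_zero_right minus_zero)
  next
    case (oscale X c) then show ?case using commutator_is_oscale_left[OF lin oscale.IH] by (simp only: add_0_left diff_self mult_zero_right minus_zero)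
  qed
qed

lemma mode_space_in_subspace:
  assumes "X \<in> mode_space r" "vec.subspace T" "\<And>i j. a i j r v \<in> T"
  shows "X v \<in> T"
  using assms(1)
  by (induction rule: mode_space.induct)
     (simp_all add: oscale_def assms(3) vec.subspace_0[OF assms(2)] vec.subspace_add[OF assms(2)]
       vec.subspace_diff[OF assms(2)] vec.subspace_scale[OF assms(2)])

lemma mode_space_commute:
  assumes "X \<in> mode_space r" "lin Z" "\<And>i j v. Z (a i j r v) = a i j r (Z v)"
  shows "Z (X v) = X (Z v)"
  using assms(1)
  by (induction rule: mode_space.induct)
     (simp_all add: oscale_def assms(3) module_hom.zero[OF assms(2)] module_hom.add[OF assms(2)]
       module_hom.diff[OF assms(2)] module_hom.scale[OF assms(2)])

lemma a_in_subspace: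
  assumes T: "vec.subspace T"
    and "\<And>\<mu> M. r < 0 \<Longrightarrow> (\<mu>, M) \<in> Poly_Mapping.keys v \<Longrightarrow>
      ket (\<mu> + Poly_Mapping.single (i mod m, j mod n, - r) 1, M) \<in> T"
    and "\<And>\<mu> M. r \<ge> 0 \<Longrightarrow> (\<mu>, M) \<in> Poly_Mapping.keys v \<Longrightarrow>
      Poly_Mapping.lookup \<mu> (i mod m, j mod n, r) > 0 \<Longrightarrow>
      ket (\<mu> - Poly_Mapping.single (i mod m, j mod n, r) 1, M) \<in> T"
  shows "a i j r v \<in> T"
  unfolding a_def
proof (rule linext_in_subspace[OF T])
  fix x assume x: "x \<in> Poly_Mapping.keys v"
  obtain \<mu> M where xe: "x = (\<mu>, M)" by fastforce
  show "(case x of (\<mu>, M) \<Rightarrow>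
     let x = Poly_Mapping.single (i mod m, j mod n, \<bar>r\<bar>) (1::nat) in
     if r < 0 then ket (\<mu> + x, M)
     else scale (qint r ^ 2 / of_int r * of_nat (Poly_Mapping.lookup \<mu> (i mod m, j mod n, r)))
            (ket (\<mu> - x, M))) \<in> T"
    using assms(2,3)[of \<mu> M] x vec.subspace_scale[OF T] vec.subspace_0[OF T]
    by (cases "Poly_Mapping.lookup \<mu> (i mod m, j mod n, r) = 0") (auto simp: xe Let_def)
qed

lemma mode_space_energy:
  assumes "X \<in> mode_space r" "r > 0" "v \<in> energy_le K"
  shows "X v \<in> energy_le (K - r)"
proof (rule mode_space_in_subspace[OF assms(1) subspace_energy_le],
    rule a_in_subspace[OF subspace_energy_le])
  fix i j \<mu> M assume "(\<mu>, M) \<in> Poly_Mapping.keys v"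
    "Poly_Mapping.lookup \<mu> (i mod m, j mod n, r) > 0"
  then show "ket (\<mu> - Poly_Mapping.single (i mod m, j mod n, r) 1, M) \<in> energy_le (K - r)"
    using assms(2,3)
    by (fastforce simp: energy_le_def ket_def weighted_sum_remove[unfolded One_nat_def])
qed (use assms(2) in simp)

lemma mode_space_weight:
  assumes "X \<in> mode_space r" "v \<in> weight_space M"
  shows "X v \<in> weight_space M"
  by (rule mode_space_in_subspace[OF assms(1) subspace_weight_space],
      rule a_in_subspace[OF subspace_weight_space])
     (use assms(2) in \<open>auto simp: weight_space_def ket_def\<close>)

lemma modes_mode_space:
  assumes "\<And>r. X r \<in> mode_space r"
  shows "modes X"
  unfolding modes_def
proof (intro conjI allI impI ballI)
  fix r s :: int and v assume "r * s > 0"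
  then have "r \<noteq> 0" "s \<noteq> 0" "r + s \<noteq> 0" by (auto simp: zero_less_mult_iff)
  from commutator_is_mode_space[OF assms assms this]
  show "X r (X s v) = X s (X r v)" by (simp add: commutator_is_def)
qed (use assms in \<open>auto intro: lin_mode_space mode_space_energy\<close>)

lemma eeps_a:
  assumes "0 \<le> k" "k < m" "0 \<le> l" "l < n" "r \<noteq> 0"
  shows "eeps \<sigma> k l (a i j r v) = a i j r (eeps \<sigma> k l v)"
proof -
  have "(eeps \<sigma> k l \<circ> a i j r) v = (a i j r \<circ> eeps \<sigma> k l) v"
  proof (rule lin_eqI[OF lin_comp[OF lin_eeps lin_a] lin_comp[OF lin_a lin_eeps]])
    fix x :: state
    obtain \<mu> M where x: "x = (\<mu>, M)" by fastforce
    show "(eeps \<sigma> k l \<circ> a i j r) (ket x) = (a i j r \<circ> eeps \<sigma> k l) (ket x)"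
      using assms
      by (cases "r > 0") (simp_all add: x eeps_ket a_ket_pos a_ket_neg module_hom.scale[OF lin_a]
          module_hom.scale[OF lin_eeps] mult_ac)
  qed
  then show ?thesis by simp
qed

lemma mode_space_eeps:
  assumes "X \<in> mode_space r" "0 \<le> k" "k < m" "0 \<le> l" "l < n" "r \<noteq> 0"
  shows "eeps \<sigma> k l (X v) = X (eeps \<sigma> k l v)"
  by (rule mode_space_commute[OF assms(1) lin_eeps eeps_a]) (use assms in auto)

lemma mode_space_b: "b i j r \<in> mode_space r" "bc i j r \<in> mode_space r"
  unfolding b_def bc_def by (auto intro!: mode_space.diff mode_space.oscale mode_space.a)

lemma mode_space_families:
  "A i j r \<in> mode_space r" "B i j r \<in> mode_space r"
  "Ac i j r \<in> mode_space r" "Bc i j r \<in> mode_space r"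
  unfolding A_def B_def Ac_def Bc_def Let_def
  by (auto intro!: mode_space.add mode_space.oscale mode_space_sum mode_space_b
      simp del: plus_fun_apply)

subsection \<open>Homogeneity with respect to the degree\<close>

lemma lin_D: "lin D"
  unfolding D_def by (rule lin_linext)

lemma Dc_eq_D: "Dc = D"
  by (simp add: D_def Dc_def)

lemma D_ket: "D (ket x) = scale (sq powi twice_deg x) (ket x)"
  by (simp add: D_def)

lemma twice_deg_eq: "twice_deg (\<mu>, M) = 2 * weighted_sum (\<lambda>(i, j, r). r) \<mu> +
    (\<Sum>s=0..m - 1. \<Sum>t=0..n - 1. (del s t M) ^ 2)"
  by (simp add: twice_deg_def weighted_sum_def case_prod_unfold)

lemma D_a:
  assumes "r \<noteq> 0" "sq \<noteq> 0"
  shows "D (a i j r v) = scale (q powi (- r)) (a i j r (D v))"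
proof -
  have q: "q powi k = sq powi (2 * k)" for k
    by (simp add: q_def power_int_mult)
  have "(D \<circ> a i j r) v = (q powi (- r) *\<^sub>o (a i j r \<circ> D)) v"
  proof (rule lin_eqI[OF lin_comp[OF lin_D lin_a] lin_oscale[OF lin_comp[OF lin_a lin_D]]])
    fix x :: state
    obtain \<mu> M where x: "x = (\<mu>, M)" by fastforce
    let ?x = "(i mod m, j mod n, r)"
    consider "r < 0" | "r > 0" "Poly_Mapping.lookup \<mu> ?x = 0" | "r > 0" "Poly_Mapping.lookup \<mu> ?x > 0"
      using assms by linarith
    then show "(D \<circ> a i j r) (ket x) = (q powi (- r) *\<^sub>o (a i j r \<circ> D)) (ket x)"
    proof cases
      case 1
      then show ?thesis
        using assms by (simp add: x a_ket_neg D_ket module_hom.scale[OF lin_a] oscale_def q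
            twice_deg_eq weighted_sum_add weighted_sum_single algebra_simps flip: power_int_add)
    next
      case 2
      then show ?thesis by (simp add: x a_ket_pos D_ket module_hom.scale[OF lin_a]
            module_hom.zero[OF lin_D] oscale_def)
    next
      case 3
      have "sq powi (twice_deg (\<mu> - Poly_Mapping.single ?x 1, M)) =
          sq powi (2 * (- r)) * sq powi (twice_deg (\<mu>, M))"
        using assms 3(2) by (simp add: twice_deg_eq weighted_sum_remove[unfolded One_nat_def] algebra_simps flip: power_int_add)
      then show ?thesis
        using 3(1) by (simp add: x a_ket_pos D_ket module_hom.scale[OF lin_a]
            module_hom.scale[OF lin_D] oscale_def q mult_ac)
    qed
  qed
  then show ?thesis by (simp add: oscale_def)
qed

lemma D_mode_space:
  assumes "X \<in> mode_space r" "r \<noteq> 0" "sq \<noteq> 0"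
  shows "D (X v) = scale (q powi (- r)) (X (D v))"
  using assms(1)
  by (induction rule: mode_space.induct)
     (simp_all add: oscale_def D_a assms(2,3) module_hom.zero[OF lin_D] module_hom.add[OF lin_D]
       module_hom.diff[OF lin_D] module_hom.scale[OF lin_D] scale_add_right
       vec.scale_right_diff_distrib mult_ac)

lemma D_nexp:
  assumes X: "\<And>r. X r \<in> mode_space r" and sq: "sq \<noteq> 0"
  shows "D (nexp X k v) = scale (q powi k) (nexp X k (D v))"
proof -
  note mX = modes_mode_space[OF X]
  have q0: "q \<noteq> 0" using sq by (simp add: q_def)
  have C: "D (creation X j w) = scale (q powi j) (creation X j (D w))" for j w
    using is_exp_creation[OF mX]
  proof (induction arbitrary: w rule: is_exp_induct)
    case (mult r j Y)
    then show ?case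
      using q0 by (simp add: D_mode_space[OF X _ sq] module_hom.scale[OF lin_mode_space[OF X]]
          power_int_add)
  qed (simp_all add: oscale_def module_hom.zero[OF lin_D] module_hom.add[OF lin_D]
      module_hom.scale[OF lin_D] scale_add_right mult_ac)
  have T: "D (annihilation X j w) = scale (q powi (- j)) (annihilation X j (D w))" for j w
    using is_exp_annihilation[OF mX]
  proof (induction arbitrary: w rule: is_exp_induct)
    case (mult r j Y)
    have "q powi (- (r + j)) = q powi (- r) * q powi (- j)"
      using q0 by (simp add: power_int_diff power_int_minus field_simps)
    with mult show ?case
      by (simp add: D_mode_space[OF X _ sq] module_hom.scale[OF lin_mode_space[OF X]])
  qed (simp_all add: oscale_def module_hom.zero[OF lin_D] module_hom.add[OF lin_D]
      module_hom.scale[OF lin_D] scale_add_right mult_ac)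
  obtain K where K: "v \<in> energy_le K" by (rule energy_le_exists)
  obtain L where L: "D v \<in> energy_le L" "K \<le> L" by (rule energy_le_exists)
  show ?thesis
    using q0
    by (simp add: nexp_finite[OF mX K L(2)] nexp_finite[OF mX L(1) order.refl]
        module_hom.sum[OF lin_D] C T module_hom.scale[OF lin_creation[OF mX]] vec.scale_sum_right
        flip: power_int_add)
qed

end

section \<open>Contractions between the two families of modes\<close>

lemma sum_adjacent_delta:
  fixes f :: "int \<Rightarrow> complex"
  assumes "finite S"
  shows "(\<Sum>t\<in>S. f t * (x * ((if t = l then a else 0) - (if t = l' then b else 0)))) =
    x * ((if l \<in> S then f l * a else 0) - (if l' \<in> S then f l' * b else 0))"
proof -
  have "(\<Sum>t\<in>S. f t * (x * ((if t = l then a else 0) - (if t = l' then b else 0)))) =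
     (\<Sum>t\<in>S. x * ((if t = l then f l * a else 0) - (if t = l' then f l' * b else 0)))"
    by (intro sum.cong refl) (auto simp: algebra_simps)
  also have "\<dots> = x * ((\<Sum>t\<in>S. if t = l then f l * a else 0) - (\<Sum>t\<in>S. if t = l' then f l' * b else 0))"
    by (simp only: sum_distrib_left[symmetric] sum_subtractf)
  also have "\<dots> = x * ((if l \<in> S then f l * a else 0) - (if l' \<in> S then f l' * b else 0))"
    using assms by (simp add: algebra_simps)
  finally show ?thesis .
qed

lemma commutator_is_eq: "commutator_is X Y c \<Longrightarrow> c = c' \<Longrightarrow> commutator_is X Y c'"
  by simp

text \<open>The shape of those modes of \<open>A\<close>, \<open>B\<close>, \<open>Ac\<close>, \<open>Bc\<close> whose definition contains a sum.\<close>

lemma commutator_is_tail_sum_left: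
  assumes "lin Z" "\<And>t. t \<in> insert j S \<Longrightarrow> commutator_is (f t) Z (w * h t)"
  shows "commutator_is (c *\<^sub>o (x j *\<^sub>o f j + y *\<^sub>o (\<Sum>t\<in>S. x t *\<^sub>o f t))) Z
    (w * (c * (x j * h j + y * (\<Sum>t\<in>S. x t * h t))))"
proof -
  have "commutator_is (c *\<^sub>o (x j *\<^sub>o f j + y *\<^sub>o (\<Sum>t\<in>S. x t *\<^sub>o f t))) Z
    (c * (x j * (w * h j) + y * (\<Sum>t\<in>S. x t * (w * h t))))"
    by (intro commutator_is_oscale_left commutator_is_add_left commutator_is_sum_left assms) auto
  then show ?thesis
    by (rule commutator_is_eq) (simp only: distrib_left sum_distrib_left mult_ac)
qed

lemma commutator_is_tail_sum_right:
  assumes "lin Z" "\<And>t. t \<in> insert j S \<Longrightarrow> commutator_is Z (f t) (w * h t)"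
  shows "commutator_is Z (c *\<^sub>o (x j *\<^sub>o f j + y *\<^sub>o (\<Sum>t\<in>S. x t *\<^sub>o f t)))
    (w * (c * (x j * h j + y * (\<Sum>t\<in>S. x t * h t))))"
proof -
  have "commutator_is Z (c *\<^sub>o (x j *\<^sub>o f j + y *\<^sub>o (\<Sum>t\<in>S. x t *\<^sub>o f t)))
    (c * (x j * (w * h j) + y * (\<Sum>t\<in>S. x t * (w * h t))))"
    by (intro commutator_is_oscale_right commutator_is_add_right commutator_is_sum_right assms) auto
  then show ?thesis
    by (rule commutator_is_eq) (simp only: distrib_left sum_distrib_left mult_ac)
qed

text \<open>
  Genericity enters through the invertibility of \<open>[r]\<close> for \<open>r \<noteq> 0\<close>: the modes contain the factor
  \<open>1/[r]\<close>, and two such factors have to cancel the \<open>[r]\<^sup>2\<close> in the Heisenberg relation.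
\<close>

locale toroidal_fock_generic = toroidal_fock_pos +
  assumes nonzero: "sq \<noteq> 0" "sd \<noteq> 0" "sdc \<noteq> 0"
    and q_not_root: "q powi k = 1 \<Longrightarrow> k = 0"
begin

lemma q_nonzero: "q \<noteq> 0"
  using nonzero by (simp add: q_def)

text \<open>
  All structure constants are integral powers of \<open>q\<close>, \<open>sd\<close> and \<open>sdc\<close>.  Written in this form,
  identities between them become linear identities between exponents.
\<close>

definition mon :: "int \<Rightarrow> int \<Rightarrow> int \<Rightarrow> complex" where
  "mon x y z = q powi x * sd powi y * sdc powi z"

lemma mon_nonzero: "mon x y z \<noteq> 0"
  using nonzero q_nonzero by (simp add: mon_def)

lemma mon_mult: "mon x y z * mon x' y' z' = mon (x + x') (y + y') (z + z')"
  using nonzero q_nonzero by (simp add: mon_def power_int_add)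

lemma mon_mult_left: "mon x y z * (mon x' y' z' * w) = mon (x + x') (y + y') (z + z') * w"
  by (simp add: mon_mult flip: mult.assoc)

lemma mon_powi: "mon x y z powi k = mon (x * k) (y * k) (z * k)"
  by (simp add: mon_def power_int_mult_distrib power_int_mult)

lemma powi_mon:
  "q powi k = mon k 0 0" "q1 powi k = mon (- k) (2 * k) 0" "q2 powi k = mon (2 * k) 0 0"
  "q3 powi k = mon (- k) (- 2 * k) 0" "q1c powi k = mon (- k) 0 (2 * k)"
  "q3c powi k = mon (- k) 0 (- 2 * k)"
proof -
  have "sd ^ 2 = sd powi 2" "sdc ^ 2 = sdc powi 2" "q ^ 2 = q powi 2" by simp_all
  moreover have "inverse x = x powi (- 1)" for x :: complex by (simp add: power_int_minus)
  ultimately have "q = mon 1 0 0" "q1 = mon (- 1) 2 0" "q2 = mon 2 0 0"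
    "q3 = mon (- 1) (- 2) 0" "q1c = mon (- 1) 0 2" "q3c = mon (- 1) 0 (- 2)"
    by (simp_all add: q1_def q2_def q3_def q1c_def q3c_def d_def dc_def mon_def power_int_minus)
  then show "q powi k = mon k 0 0" "q1 powi k = mon (- k) (2 * k) 0" "q2 powi k = mon (2 * k) 0 0"
    "q3 powi k = mon (- k) (- 2 * k) 0" "q1c powi k = mon (- k) 0 (2 * k)"
    "q3c powi k = mon (- k) 0 (- 2 * k)"
    by (simp_all add: mon_powi)
qed

lemma qint_nonzero:
  assumes "r \<noteq> 0" shows "qint r \<noteq> 0"
proof -
  have *: "q powi k - q powi (- k) \<noteq> 0" if "k \<noteq> 0" for k
  proof
    assume "q powi k - q powi (- k) = 0"
    then have "q powi k * q powi k = q powi k * q powi (- k)" by simp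
    then have "q powi k * q powi k = 1"
      using q_nonzero by (simp add: power_int_minus)
    then have "q powi (k + k) = 1"
      using q_nonzero power_int_add[of q k k] by simp
    then show False using q_not_root that by fastforce
  qed
  show ?thesis
    using *[OF assms] *[of 1] by (simp add: qint_def power_int_minus)
qed

definition osc :: "int \<Rightarrow> int \<Rightarrow> int \<Rightarrow> int \<Rightarrow> oper" where
  "osc sg i j = (if sg = 1 then A i j else B i j)"

definition oscc :: "int \<Rightarrow> int \<Rightarrow> int \<Rightarrow> int \<Rightarrow> oper" where
  "oscc sg i j = (if sg = 1 then Ac i j else Bc i j)"

text \<open>
  The exponents of \<open>q\<close> in the location of the pole: for \<open>sg = 1\<close> they come from
  \<open>q\<^sup>-\<^sup>n q3c\<^sup>-\<^sup>l\<close> and \<open>q\<^sup>-\<^sup>m q3\<^sup>-\<^sup>i\<close>, for \<open>sg = -1\<close> from \<open>q1c\<^sup>l\<close> and \<open>q1\<^sup>i\<close>.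
\<close>

definition qpos :: "int \<Rightarrow> int \<Rightarrow> int" where
  "qpos sg l = (if sg = 1 then l - n else - l)"

definition qposc :: "int \<Rightarrow> int \<Rightarrow> int" where
  "qposc sg i = (if sg = 1 then i - m else - i)"

text \<open>
  The coordinates of the simple root \<open>e\<^sub>l - e\<^sub>l\<^sub>-\<^sub>1\<close>.
\<close>

definition simple_root :: "int \<Rightarrow> int \<Rightarrow> int" where
  "simple_root l j = (if j = l then 1 else if j = l - 1 then - 1 else 0)"

text \<open>
  The coefficient of \<open>a\<close> at row \<open>s\<close> in \<open>b i t r\<close>; \<open>\<eta>\<close> is the coefficient of \<open>a\<close> at column \<open>t\<close> in
  \<open>bc s l (- r)\<close>.  The commutator of \<open>b\<close> with \<open>bc\<close> is the product of the two, as only the oscillator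
  at the position \<open>(s, t)\<close> contributes.
\<close>

definition \<xi> :: "int \<Rightarrow> int \<Rightarrow> int \<Rightarrow> complex" where
  "\<xi> i r s = (if r > 0
     then - (q powi r) * ((if s = i then 1 else 0) - (if s = i - 1 then q3 powi r else 0))
     else - 1 * ((if s = i then 1 else 0) - (if s = i - 1 then q1 powi (- r) else 0)))"

definition \<eta> :: "int \<Rightarrow> int \<Rightarrow> int \<Rightarrow> complex" where
  "\<eta> l r t = (if r > 0
     then 1 * ((if t = l then 1 else 0) - (if t = l - 1 then q1c powi r else 0))
     else q powi (- r) * ((if t = l then 1 else 0) - (if t = l - 1 then q3c powi (- r) else 0)))"

lemma commutator_is_a_range:
  assumes "r \<noteq> 0" "0 \<le> i" "i < m" "0 \<le> j" "j < n" "0 \<le> k" "k < m" "0 \<le> l" "l < n"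
  shows "commutator_is (a i j r) (a k l (- r)) (if i = k \<and> j = l then qint r ^ 2 / of_int r else 0)"
  using commutator_is_a[OF assms(1), of "- r" i j k l] assms by simp

lemma commutator_is_b_bc:
  assumes r: "r \<noteq> 0" and i: "1 \<le> i" "i < m" and t: "0 \<le> t" "t < n" and s: "0 \<le> s" "s < m"
    and l: "1 \<le> l" "l < n"
  shows "commutator_is (b i t r) (bc s l (- r)) (qint r ^ 2 / of_int r * \<eta> l r t * \<xi> i r s)"
proof -
  let ?N = "qint r ^ 2 / of_int r"
  note lin = lin_diff lin_oscale lin_a
  have com: "commutator_is (a i' t r) (a s l' (- r)) (if i' = s \<and> t = l' then ?N else 0)"
    if "i' = i - 1 \<or> i' = i" "l' = l - 1 \<or> l' = l" for i' l'
    by (rule commutator_is_a_range[OF r]) (use assms that in auto)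
  note rules = commutator_is_diff_left commutator_is_oscale_left commutator_is_diff_right
    commutator_is_oscale_right com[OF disjI1[OF refl] disjI1[OF refl]]
    com[OF disjI1[OF refl] disjI2[OF refl]] com[OF disjI2[OF refl] disjI1[OF refl]]
    com[OF disjI2[OF refl] disjI2[OF refl]]
  show ?thesis
  proof (cases "r > 0")
    case True
    then have b: "b i t r = q powi r *\<^sub>o (q3 powi r *\<^sub>o a (i - 1) t r - a i t r)"
      and bc: "bc s l (- r) = (- 1) *\<^sub>o (q1c powi r *\<^sub>o a s (l - 1) (- r) - a s l (- r))"
      by (simp_all add: b_def bc_def)
    show ?thesis
      unfolding b bc
      by (rule commutator_is_eq, (rule rules lin)+)
         (use assms True in \<open>auto simp: \<xi>_def \<eta>_def algebra_simps\<close>)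
  next
    case False
    then have b: "b i t r = q1 powi (- r) *\<^sub>o a (i - 1) t r - a i t r"
      and bc: "bc s l (- r) = (- (q powi (- r))) *\<^sub>o (q3c powi (- r) *\<^sub>o a s (l - 1) (- r) - a s l (- r))"
      using r by (simp_all add: b_def bc_def)
    show ?thesis
      unfolding b bc
      by (rule commutator_is_eq, (rule rules lin)+)
         (use assms False in \<open>auto simp: \<xi>_def \<eta>_def algebra_simps\<close>)
  qed
qed

lemmas mon_simps = powi_mon mon_mult mon_mult_left mon_powi

text \<open>
  The sums in the definitions of \<open>A\<close> and \<open>B\<close> are weighted so that the contributions of the columns
  \<open>l - 1\<close> and \<open>l\<close> cancel when both lie in the range of summation.  What is left is concentrated at
  \<open>j = l\<close> and \<open>j = l - 1\<close>.
\<close>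

lemma commutator_is_osc_bc:
  assumes r: "r \<noteq> 0" and i: "1 \<le> i" "i < m" and j: "0 \<le> j" "j < n" and s: "0 \<le> s" "s < m"
    and l: "1 \<le> l" "l < n" and sg: "sg = 1 \<or> sg = - 1"
  shows "commutator_is (osc sg i j r) (bc s l (- r))
    (qint r ^ 2 / of_int r * (- (of_int (sg * simple_root l j) / qint r) *
       mon ((sg * simple_root l j + qpos sg l) * r) 0 (2 * l * r)) * \<xi> i r s)"
proof -
  let ?N = "qint r ^ 2 / of_int r"
  note lin = lin_mode_space[OF mode_space_b(2)]
  have com: "commutator_is (b i t r) (bc s l (- r)) (?N * \<xi> i r s * \<eta> l r t)" if "t \<in> {0..n-1}" for t
    using commutator_is_b_bc[OF r i _ _ s l, of t] that by (auto simp: mult_ac)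
  consider "sg = 1" "r > 0" | "sg = 1" "r < 0" | "sg = - 1" "r > 0" | "sg = - 1" "r < 0"
    using sg r by linarith
  then have "\<exists>c. commutator_is (osc sg i j r) (bc s l (- r)) (?N * \<xi> i r s * c) \<and>
    c = - (of_int (sg * simple_root l j) / qint r) * mon ((sg * simple_root l j + qpos sg l) * r) 0 (2 * l * r)"
  proof cases
    case 1
    have A: "osc sg i j r = (- (1 / qint r * q powi (- (n - 1) * r) * q3c powi (- j * r))) *\<^sub>o b i j r"
      using 1 by (simp add: osc_def A_def)
    show ?thesis
    proof (intro exI conjI)
      show "commutator_is (osc sg i j r) (bc s l (- r)) (?N * \<xi> i r s *
          ((- (1 / qint r * q powi (- (n - 1) * r) * q3c powi (- j * r))) * \<eta> l r j))"
        unfolding A by (rule commutator_is_eq[OF commutator_is_oscale_left[OF lin com]])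
            (use j in simp, simp only: mult_ac)
      show "(- (1 / qint r * q powi (- (n - 1) * r) * q3c powi (- j * r))) * \<eta> l r j =
        - (of_int (sg * simple_root l j) / qint r) * mon ((sg * simple_root l j + qpos sg l) * r) 0 (2 * l * r)"
        using 1 by (auto simp: \<eta>_def simple_root_def qpos_def mon_simps algebra_simps minus_diff_commute)
    qed
  next
    case 2
    let ?p = "- r"
    have A: "osc sg i j r = (1 / qint ?p * q powi ((n - 2) * ?p)) *\<^sub>o
          (q3c powi (j * ?p) *\<^sub>o b i j r +
           (1 - q2 powi ?p) *\<^sub>o (\<Sum>t=j + 1..n - 1. q3c powi (t * ?p) *\<^sub>o b i t r))"
      using 2 by (simp add: osc_def A_def Let_def)
    let ?c = "(1 / qint ?p * q powi ((n - 2) * ?p)) *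
          (q3c powi (j * ?p) * \<eta> l r j +
           (1 - q2 powi ?p) * (\<Sum>t=j + 1..n - 1. q3c powi (t * ?p) * \<eta> l r t))"
    show ?thesis
    proof (intro exI conjI)
      show "commutator_is (osc sg i j r) (bc s l (- r)) (?N * \<xi> i r s * ?c)"
        unfolding A
        by (rule commutator_is_tail_sum_left[OF lin, where x = "\<lambda>t. q3c powi (t * ?p)" and f = "\<lambda>t. b i t r"])
           (rule com, use j in auto)
      have \<eta>: "\<eta> l r t = q powi ?p * ((if t = l then 1 else 0) - (if t = l - 1 then q3c powi ?p else 0))" for t
        using 2 by (simp add: \<eta>_def)
      have "(\<Sum>t=j + 1..n - 1. q3c powi (t * ?p) * \<eta> l r t) =
         q powi ?p * ((if l \<in> {j+1..n-1} then q3c powi (l * ?p) * 1 else 0) -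
          (if l - 1 \<in> {j+1..n-1} then q3c powi ((l - 1) * ?p) * q3c powi ?p else 0))"
        unfolding \<eta> by (rule sum_adjacent_delta[OF finite_atLeastAtMost_int])
      also have "\<dots> = (if j = l - 1 then q powi ?p * q3c powi (l * ?p) else 0)"
        using l by (auto simp: mon_simps algebra_simps minus_diff_commute)
      finally show "?c = - (of_int (sg * simple_root l j) / qint r) * mon ((sg * simple_root l j + qpos sg l) * r) 0 (2 * l * r)"
        using 2 by (auto simp: \<eta>_def simple_root_def qpos_def mon_simps algebra_simps minus_diff_commute qint_uminus)
    qed
  next
    case 3
    have A: "osc sg i j r = (1 / qint r * q powi r) *\<^sub>o
          (q1c powi (j * r) *\<^sub>o b i j r +
           (1 - q2 powi (- r)) *\<^sub>o (\<Sum>t=0..j - 1. q1c powi (t * r) *\<^sub>o b i t r))"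
      using 3 by (simp add: osc_def B_def)
    let ?c = "(1 / qint r * q powi r) *
          (q1c powi (j * r) * \<eta> l r j +
           (1 - q2 powi (- r)) * (\<Sum>t=0..j - 1. q1c powi (t * r) * \<eta> l r t))"
    show ?thesis
    proof (intro exI conjI)
      show "commutator_is (osc sg i j r) (bc s l (- r)) (?N * \<xi> i r s * ?c)"
        unfolding A
        by (rule commutator_is_tail_sum_left[OF lin, where x = "\<lambda>t. q1c powi (t * r)" and f = "\<lambda>t. b i t r"])
           (rule com, use j in auto)
      have "(\<Sum>t=0..j - 1. q1c powi (t * r) * \<eta> l r t) =
         1 * ((if l \<in> {0..j-1} then q1c powi (l * r) * 1 else 0) -
          (if l - 1 \<in> {0..j-1} then q1c powi ((l - 1) * r) * q1c powi r else 0))"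
        using 3 unfolding \<eta>_def by (simp only: if_True)
          (rule sum_adjacent_delta[OF finite_atLeastAtMost_int])
      also have "\<dots> = (if j = l then - (q1c powi (l * r)) else 0)"
        using l by (auto simp: mon_simps algebra_simps minus_diff_commute)
      finally show "?c = - (of_int (sg * simple_root l j) / qint r) * mon ((sg * simple_root l j + qpos sg l) * r) 0 (2 * l * r)"
        using 3 by (auto simp: \<eta>_def simple_root_def qpos_def mon_simps algebra_simps minus_diff_commute)
    qed
  next
    case 4
    have A: "osc sg i j r = (- (1 / qint (- r)) * q1c powi (- j * (- r))) *\<^sub>o b i j r"
      using 4 by (simp add: osc_def B_def Let_def)
    show ?thesis
    proof (intro exI conjI)
      show "commutator_is (osc sg i j r) (bc s l (- r)) (?N * \<xi> i r s *
          ((- (1 / qint (- r)) * q1c powi (- j * (- r))) * \<eta> l r j))"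
        unfolding A by (rule commutator_is_eq[OF commutator_is_oscale_left[OF lin com]])
            (use j in simp, simp only: mult_ac)
      show "(- (1 / qint (- r)) * q1c powi (- j * (- r))) * \<eta> l r j =
        - (of_int (sg * simple_root l j) / qint r) * mon ((sg * simple_root l j + qpos sg l) * r) 0 (2 * l * r)"
        using 4 by (auto simp: \<eta>_def simple_root_def qpos_def mon_simps algebra_simps minus_diff_commute qint_uminus)
    qed
  qed
  then show ?thesis by (auto simp: mult_ac)
qed

text \<open>
  The same cancellation for rows.  Together the two lemmas give a product of a factor depending on
  \<open>j, l\<close> and a factor depending on \<open>i, k\<close>.
\<close>

lemma commutator_is_oscc:
  assumes r: "r \<noteq> 0" and i: "1 \<le> i" "i < m" and k: "0 \<le> k" "k < m"
    and sg: "sg = 1 \<or> sg = - 1" and X: "lin X"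
    and com: "\<And>s. s \<in> {0..m-1} \<Longrightarrow> commutator_is X (bc s l (- r)) (w * \<xi> i r s)"
  shows "commutator_is X (oscc sg k l (- r))
    (w * (- (of_int (sg * simple_root i k) / qint r) * mon (- (sg * simple_root i k + qposc sg i) * r) (- 2 * i * r) 0))"
proof -
  consider "sg = 1" "r < 0" | "sg = 1" "r > 0" | "sg = - 1" "r < 0" | "sg = - 1" "r > 0"
    using sg r by linarith
  then have "\<exists>c. commutator_is X (oscc sg k l (- r)) (w * c) \<and>
    c = - (of_int (sg * simple_root i k) / qint r) * mon (- (sg * simple_root i k + qposc sg i) * r) (- 2 * i * r) 0"
  proof cases
    case 1
    let ?K = "- (1 / qint (- r) * q powi (- (m - 1) * (- r)) * q3 powi (- k * (- r)))"
    have A: "oscc sg k l (- r) = ?K *\<^sub>o bc k l (- r)"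
      using 1 by (simp add: oscc_def Ac_def)
    show ?thesis
    proof (intro exI conjI)
      show "commutator_is X (oscc sg k l (- r)) (w * (?K * \<xi> i r k))"
        unfolding A by (rule commutator_is_eq[OF commutator_is_oscale_right[OF X com]])
            (use k in simp, simp only: mult_ac)
      show "?K * \<xi> i r k =
        - (of_int (sg * simple_root i k) / qint r) * mon (- (sg * simple_root i k + qposc sg i) * r) (- 2 * i * r) 0"
        using 1 by (auto simp: \<xi>_def simple_root_def qposc_def mon_simps algebra_simps minus_diff_commute qint_uminus)
    qed
  next
    case 2
    let ?K = "1 / qint r * q powi ((m - 2) * r)"
    have A: "oscc sg k l (- r) = ?K *\<^sub>o
          (q3 powi (k * r) *\<^sub>o bc k l (- r) +
           (1 - q2 powi r) *\<^sub>o (\<Sum>s=k + 1..m - 1. q3 powi (s * r) *\<^sub>o bc s l (- r)))"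
      using 2 by (simp add: oscc_def Ac_def Let_def)
    let ?c = "?K * (q3 powi (k * r) * \<xi> i r k +
           (1 - q2 powi r) * (\<Sum>s=k + 1..m - 1. q3 powi (s * r) * \<xi> i r s))"
    show ?thesis
    proof (intro exI conjI)
      show "commutator_is X (oscc sg k l (- r)) (w * ?c)"
        unfolding A
        by (rule commutator_is_tail_sum_right[OF X, where x = "\<lambda>t. q3 powi (t * r)" and f = "\<lambda>t. bc t l (- r)"])
           (rule com, use k in auto)
      have \<xi>: "\<xi> i r s = - (q powi r) * ((if s = i then 1 else 0) - (if s = i - 1 then q3 powi r else 0))" for s
        using 2 by (simp add: \<xi>_def)
      have "(\<Sum>s=k + 1..m - 1. q3 powi (s * r) * \<xi> i r s) =
         - (q powi r) * ((if i \<in> {k+1..m-1} then q3 powi (i * r) * 1 else 0) -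
          (if i - 1 \<in> {k+1..m-1} then q3 powi ((i - 1) * r) * q3 powi r else 0))"
        unfolding \<xi> by (rule sum_adjacent_delta[OF finite_atLeastAtMost_int])
      also have "\<dots> = (if k = i - 1 then - (q powi r) * q3 powi (i * r) else 0)"
        using i by (auto simp: mon_simps algebra_simps minus_diff_commute)
      finally show "?c = - (of_int (sg * simple_root i k) / qint r) *
          mon (- (sg * simple_root i k + qposc sg i) * r) (- 2 * i * r) 0"
        using 2 by (auto simp: \<xi> simple_root_def qposc_def mon_simps algebra_simps minus_diff_commute)
    qed
  next
    case 3
    let ?p = "- r"
    let ?K = "1 / qint ?p * q powi ?p"
    have A: "oscc sg k l (- r) = ?K *\<^sub>o
          (q1 powi (k * ?p) *\<^sub>o bc k l (- r) +
           (1 - q2 powi (- ?p)) *\<^sub>o (\<Sum>s=0..k - 1. q1 powi (s * ?p) *\<^sub>o bc s l (- r)))"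
      using 3 by (simp add: oscc_def Bc_def)
    let ?c = "?K * (q1 powi (k * ?p) * \<xi> i r k +
           (1 - q2 powi (- ?p)) * (\<Sum>s=0..k - 1. q1 powi (s * ?p) * \<xi> i r s))"
    show ?thesis
    proof (intro exI conjI)
      show "commutator_is X (oscc sg k l (- r)) (w * ?c)"
        unfolding A
        by (rule commutator_is_tail_sum_right[OF X, where x = "\<lambda>t. q1 powi (t * ?p)" and f = "\<lambda>t. bc t l (- r)"])
           (rule com, use k in auto)
      have \<xi>: "\<xi> i r s = - 1 * ((if s = i then 1 else 0) - (if s = i - 1 then q1 powi ?p else 0))" for s
        using 3 by (simp add: \<xi>_def)
      have "(\<Sum>s=0..k - 1. q1 powi (s * ?p) * \<xi> i r s) =
         - 1 * ((if i \<in> {0..k-1} then q1 powi (i * ?p) * 1 else 0) -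
          (if i - 1 \<in> {0..k-1} then q1 powi ((i - 1) * ?p) * q1 powi ?p else 0))"
        unfolding \<xi> by (rule sum_adjacent_delta[OF finite_atLeastAtMost_int])
      also have "\<dots> = (if k = i then q1 powi (i * ?p) else 0)"
        using i by (auto simp: mon_simps algebra_simps minus_diff_commute)
      finally show "?c = - (of_int (sg * simple_root i k) / qint r) *
          mon (- (sg * simple_root i k + qposc sg i) * r) (- 2 * i * r) 0"
        using 3 by (auto simp: \<xi> simple_root_def qposc_def mon_simps algebra_simps minus_diff_commute qint_uminus)
    qed
  next
    case 4
    let ?K = "- (1 / qint r) * q1 powi (- k * r)"
    have A: "oscc sg k l (- r) = ?K *\<^sub>o bc k l (- r)"
      using 4 by (simp add: oscc_def Bc_def Let_def)
    show ?thesis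
    proof (intro exI conjI)
      show "commutator_is X (oscc sg k l (- r)) (w * (?K * \<xi> i r k))"
        unfolding A by (rule commutator_is_eq[OF commutator_is_oscale_right[OF X com]])
            (use k in simp, simp only: mult_ac)
      show "?K * \<xi> i r k =
        - (of_int (sg * simple_root i k) / qint r) * mon (- (sg * simple_root i k + qposc sg i) * r) (- 2 * i * r) 0"
        using 4 by (auto simp: \<xi>_def simple_root_def qposc_def mon_simps algebra_simps minus_diff_commute)
    qed
  qed
  then show ?thesis by auto
qed

text \<open>
  The number \<open>c\<close> for which the product of the two vertex operators has the factor \<open>(1 - c w/z)\<^sup>\<nu>\<close>.
\<close>

definition pole :: "int \<Rightarrow> int \<Rightarrow> int \<Rightarrow> int \<Rightarrow> int \<Rightarrow> int \<Rightarrow> complex" where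
  "pole sg sg' i j k l =
    mon (sg * simple_root l j - sg' * simple_root i k + qpos sg l - qposc sg' i) (- 2 * i) (2 * l)"

lemma mode_space_osc: "osc sg i j r \<in> mode_space r" "oscc sg i j r \<in> mode_space r"
  by (simp_all add: osc_def oscc_def mode_space_families)

lemma vertex_pairing_osc_oscc:
  assumes i: "1 \<le> i" "i < m" and j: "0 \<le> j" "j < n" and k: "0 \<le> k" "k < m"
    and l: "1 \<le> l" "l < n" and sg: "sg = 1 \<or> sg = - 1" and sg': "sg' = 1 \<or> sg' = - 1"
  shows "vertex_pairing (osc sg i j) (oscc sg' k l) (- (sg * sg' * simple_root l j * simple_root i k)) (pole sg sg' i j k l)"
  unfolding vertex_pairing_def pairing_def
proof (intro allI impI)
  fix r s :: int and v assume r: "r \<noteq> 0" and s: "s \<noteq> 0"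
  let ?h = "- (of_int (- (sg * sg' * simple_root l j * simple_root i k)) * pole sg sg' i j k l powi r / of_int r)"
  show "osc sg i j r (oscc sg' k l s v) = oscc sg' k l s (osc sg i j r v) +
     (if r + s = 0 then scale ?h v else 0)"
  proof (cases "r + s = 0")
    case False
    then show ?thesis
      using commutator_is_mode_space[OF mode_space_osc r s, of sg i j sg' k l]
      by (simp add: commutator_is_def)
  next
    case True
    then have s: "s = - r" by simp
    let ?w = "qint r ^ 2 / of_int r * (- (of_int (sg * simple_root l j) / qint r) *
       mon ((sg * simple_root l j + qpos sg l) * r) 0 (2 * l * r))"
    have "commutator_is (osc sg i j r) (oscc sg' k l (- r)) (?w *
       (- (of_int (sg' * simple_root i k) / qint r) * mon (- (sg' * simple_root i k + qposc sg' i) * r) (- 2 * i * r) 0))"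
      by (rule commutator_is_oscc[OF r i k sg' lin_mode_space[OF mode_space_osc(1)]])
         (rule commutator_is_osc_bc[OF r i j _ _ l sg], auto)
    moreover have "?w * (- (of_int (sg' * simple_root i k) / qint r) *
        mon (- (sg' * simple_root i k + qposc sg' i) * r) (- 2 * i * r) 0) =
      (qint r / qint r) ^ 2 * (of_int (sg * simple_root l j) * of_int (sg' * simple_root i k) *
        (mon ((sg * simple_root l j + qpos sg l) * r) 0 (2 * l * r) *
         mon (- (sg' * simple_root i k + qposc sg' i) * r) (- 2 * i * r) 0)) / of_int r"
      by (simp add: power2_eq_square)
    moreover have "\<dots> = ?h"
      using qint_nonzero[OF r] by (simp add: mon_mult pole_def mon_powi algebra_simps)
    ultimately show ?thesis using s by (simp add: commutator_is_def)
  qed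
qed

end

section \<open>Fused modes at the pole\<close>

lemma sum_split_first: "(l::int) \<le> b \<Longrightarrow> sum F {l - 1 + 1..b} = F l + sum F {l + 1..b}"
  for F :: "int \<Rightarrow> 'a::comm_monoid_add"
proof -
  assume "l \<le> b"
  then have "{l - 1 + 1..b} = insert l {l + 1..b}" by auto
  then show ?thesis by simp
qed

lemma sum_split_last: "(a::int) \<le> l - 1 \<Longrightarrow> sum F {a..l - 1} = sum F {a..l - 1 - 1} + F (l - 1)"
  for F :: "int \<Rightarrow> 'a::comm_monoid_add"
proof -
  assume "a \<le> l - 1"
  then have "{a..l - 1} = insert (l - 1) {a..l - 1 - 1}" by auto
  then show ?thesis by (simp add: add.commute)
qed

lemma nexp_cong:
  assumes "\<And>r. r \<noteq> 0 \<Longrightarrow> X r = Y r"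
  shows "nexp X = nexp Y"
proof -
  have "(\<lambda>k. if k > 0 then X (- k) else 0) = (\<lambda>k. if k > 0 then Y (- k) else 0)"
    "(\<lambda>k. if k < 0 then X (- k) else 0) = (\<lambda>k. if k < 0 then Y (- k) else 0)"
    using assms by (auto simp: fun_eq_iff)
  then show ?thesis unfolding nexp_def by simp
qed

context toroidal_fock_generic
begin

text \<open>
  The common value, up to scalars, of \<open>b i l - x b i (l - 1)\<close> and \<open>bc i l - y bc (i - 1) l\<close> for the
  appropriate powers \<open>x, y\<close>.  The factor \<open>q2\<^sup>r\<close> for \<open>r > 0\<close> makes the scalars in the next two
  lemmas uniform in the sign of \<open>r\<close>.
\<close>

definition \<Omega> :: "int \<Rightarrow> int \<Rightarrow> int \<Rightarrow> oper" where
  "\<Omega> i l r = (if r > 0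
     then q2 powi r *\<^sub>o ((q3 powi r * q3c powi r) *\<^sub>o a (i - 1) (l - 1) r - q3 powi r *\<^sub>o a (i - 1) l r
       - q3c powi r *\<^sub>o a i (l - 1) r + a i l r)
     else (q1 powi (- r) * q1c powi (- r)) *\<^sub>o a (i - 1) (l - 1) r - q1 powi (- r) *\<^sub>o a (i - 1) l r
       - q1c powi (- r) *\<^sub>o a i (l - 1) r + a i l r)"

lemmas lookup_simps = oscale_def lookup_add lookup_minus fun_diff_def

lemma osc_diff:
  assumes r: "r \<noteq> 0" and l: "1 \<le> l" "l < n" and sg: "sg = 1 \<or> sg = - 1"
  shows "osc sg i l r v - osc sg i (l - 1) r v =
    scale (of_int sg / qint r * mon (qpos sg l * r) 0 (2 * l * r)) (\<Omega> i l r v)"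
proof (rule poly_mapping_eqI)
  fix x
  consider "sg = 1" "r > 0" | "sg = 1" "r < 0" | "sg = - 1" "r > 0" | "sg = - 1" "r < 0"
    using sg r by linarith
  then show "Poly_Mapping.lookup (osc sg i l r v - osc sg i (l - 1) r v) x =
    Poly_Mapping.lookup (scale (of_int sg / qint r * mon (qpos sg l * r) 0 (2 * l * r)) (\<Omega> i l r v)) x"
  proof cases
    case 1
    then show ?thesis
      by (simp add: osc_def A_def b_def qpos_def \<Omega>_def lookup_simps mon_simps algebra_simps minus_diff_commute)
  next
    case 2
    have split: "(\<Sum>t=l - 1 + 1..n - 1. F t) = F l + (\<Sum>t=l + 1..n - 1. F t)" for F :: "int \<Rightarrow> oper"
      by (rule sum_split_first) (use l in simp)
    have form: "osc sg i j r = (1 / qint (- r) * q powi ((n - 2) * (- r))) *\<^sub>o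
        (q3c powi (j * (- r)) *\<^sub>o b i j r +
          (1 - q2 powi (- r)) *\<^sub>o (\<Sum>t=j + 1..n - 1. q3c powi (t * (- r)) *\<^sub>o b i t r))" for j
      using 2 by (simp add: osc_def A_def Let_def)
    define S where "S = (\<Sum>t=l + 1..n - 1. q3c powi (t * (- r)) *\<^sub>o b i t r)"
    have "osc sg i l r = (1 / qint (- r) * q powi ((n - 2) * (- r))) *\<^sub>o
          (q3c powi (l * (- r)) *\<^sub>o b i l r + (1 - q2 powi (- r)) *\<^sub>o S)"
      and "osc sg i (l - 1) r = (1 / qint (- r) * q powi ((n - 2) * (- r))) *\<^sub>o
          (q3c powi ((l - 1) * (- r)) *\<^sub>o b i (l - 1) r +
            (1 - q2 powi (- r)) *\<^sub>o (q3c powi (l * (- r)) *\<^sub>o b i l r + S))"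
      unfolding form split S_def by (rule refl)+
    then show ?thesis
      using 2 by (simp add: b_def qpos_def \<Omega>_def lookup_simps mon_simps algebra_simps minus_diff_commute
          qint_uminus)
  next
    case 3
    have split: "(\<Sum>t=0..l - 1. F t) = (\<Sum>t=0..l - 1 - 1. F t) + F (l - 1)" for F :: "int \<Rightarrow> oper"
      by (rule sum_split_last) (use l in simp)
    have form: "osc sg i j r = (1 / qint r * q powi r) *\<^sub>o
        (q1c powi (j * r) *\<^sub>o b i j r +
          (1 - q2 powi (- r)) *\<^sub>o (\<Sum>t=0..j - 1. q1c powi (t * r) *\<^sub>o b i t r))" for j
      using 3 by (simp add: osc_def B_def)
    define S where "S = (\<Sum>t=0..l - 1 - 1. q1c powi (t * r) *\<^sub>o b i t r)"
    have "osc sg i l r = (1 / qint r * q powi r) *\<^sub>o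
          (q1c powi (l * r) *\<^sub>o b i l r + (1 - q2 powi (- r)) *\<^sub>o (S + q1c powi ((l - 1) * r) *\<^sub>o b i (l - 1) r))"
      and "osc sg i (l - 1) r = (1 / qint r * q powi r) *\<^sub>o
          (q1c powi ((l - 1) * r) *\<^sub>o b i (l - 1) r + (1 - q2 powi (- r)) *\<^sub>o S)"
      unfolding form[of l] form[of "l - 1"] split S_def by (rule refl)+
    then show ?thesis
      using 3 by (simp add: b_def qpos_def \<Omega>_def lookup_simps mon_simps algebra_simps minus_diff_commute)
  next
    case 4
    then show ?thesis
      by (simp add: osc_def B_def Let_def b_def qpos_def \<Omega>_def lookup_simps mon_simps algebra_simps
          minus_diff_commute qint_uminus)
  qed
qed

lemma oscc_diff:
  assumes r: "r \<noteq> 0" and i: "1 \<le> i" "i < m" and sg: "sg = 1 \<or> sg = - 1"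
  shows "oscc sg (i - 1) l r v - oscc sg i l r v =
    scale (of_int sg / qint r * mon (qposc sg i * r) (2 * i * r) 0) (\<Omega> i l r v)"
proof (rule poly_mapping_eqI)
  fix x
  consider "sg = 1" "r > 0" | "sg = 1" "r < 0" | "sg = - 1" "r > 0" | "sg = - 1" "r < 0"
    using sg r by linarith
  then show "Poly_Mapping.lookup (oscc sg (i - 1) l r v - oscc sg i l r v) x =
    Poly_Mapping.lookup (scale (of_int sg / qint r * mon (qposc sg i * r) (2 * i * r) 0) (\<Omega> i l r v)) x"
  proof cases
    case 1
    then show ?thesis
      by (simp add: oscc_def Ac_def bc_def qposc_def \<Omega>_def lookup_simps mon_simps algebra_simps minus_diff_commute)
  next
    case 2
    have split: "(\<Sum>t=i - 1 + 1..m - 1. F t) = F i + (\<Sum>t=i + 1..m - 1. F t)" for F :: "int \<Rightarrow> oper"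
      by (rule sum_split_first) (use i in simp)
    have form: "oscc sg j l r = (1 / qint (- r) * q powi ((m - 2) * (- r))) *\<^sub>o
        (q3 powi (j * (- r)) *\<^sub>o bc j l r +
          (1 - q2 powi (- r)) *\<^sub>o (\<Sum>s=j + 1..m - 1. q3 powi (s * (- r)) *\<^sub>o bc s l r))" for j
      using 2 by (simp add: oscc_def Ac_def Let_def)
    define S where "S = (\<Sum>s=i + 1..m - 1. q3 powi (s * (- r)) *\<^sub>o bc s l r)"
    have "oscc sg i l r = (1 / qint (- r) * q powi ((m - 2) * (- r))) *\<^sub>o
          (q3 powi (i * (- r)) *\<^sub>o bc i l r + (1 - q2 powi (- r)) *\<^sub>o S)"
      and "oscc sg (i - 1) l r = (1 / qint (- r) * q powi ((m - 2) * (- r))) *\<^sub>o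
          (q3 powi ((i - 1) * (- r)) *\<^sub>o bc (i - 1) l r +
            (1 - q2 powi (- r)) *\<^sub>o (q3 powi (i * (- r)) *\<^sub>o bc i l r + S))"
      unfolding form split S_def by (rule refl)+
    then show ?thesis
      using 2 by (simp add: bc_def qposc_def \<Omega>_def lookup_simps mon_simps algebra_simps minus_diff_commute
          qint_uminus)
  next
    case 3
    have split: "(\<Sum>t=0..i - 1. F t) = (\<Sum>t=0..i - 1 - 1. F t) + F (i - 1)" for F :: "int \<Rightarrow> oper"
      by (rule sum_split_last) (use i in simp)
    have form: "oscc sg j l r = (1 / qint r * q powi r) *\<^sub>o
        (q1 powi (j * r) *\<^sub>o bc j l r +
          (1 - q2 powi (- r)) *\<^sub>o (\<Sum>s=0..j - 1. q1 powi (s * r) *\<^sub>o bc s l r))" for j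
      using 3 by (simp add: oscc_def Bc_def)
    define S where "S = (\<Sum>s=0..i - 1 - 1. q1 powi (s * r) *\<^sub>o bc s l r)"
    have "oscc sg i l r = (1 / qint r * q powi r) *\<^sub>o
          (q1 powi (i * r) *\<^sub>o bc i l r + (1 - q2 powi (- r)) *\<^sub>o (S + q1 powi ((i - 1) * r) *\<^sub>o bc (i - 1) l r))"
      and "oscc sg (i - 1) l r = (1 / qint r * q powi r) *\<^sub>o
          (q1 powi ((i - 1) * r) *\<^sub>o bc (i - 1) l r + (1 - q2 powi (- r)) *\<^sub>o S)"
      unfolding form[of i] form[of "i - 1"] split S_def by (rule refl)+
    then show ?thesis
      using 3 by (simp add: bc_def qposc_def \<Omega>_def lookup_simps mon_simps algebra_simps minus_diff_commute)
  next
    case 4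
    then show ?thesis
      by (simp add: oscc_def Bc_def Let_def bc_def qposc_def \<Omega>_def lookup_simps mon_simps algebra_simps
          minus_diff_commute qint_uminus)
  qed
qed

text \<open>
  Passing from \<open>l\<close> to \<open>l - 1\<close> changes the first family by a multiple of \<open>\<Omega>\<close>, passing from \<open>k\<close> to \<open>k'\<close>
  changes the second family by a multiple of \<open>\<Omega>\<close>.  The number \<open>c\<close> is the ratio of the scalars.
\<close>

lemma fused_pole:
  assumes r: "r \<noteq> 0" and i: "1 \<le> i" "i < m" and l: "1 \<le> l" "l < n"
    and sg: "sg = 1 \<or> sg = - 1" "sg' = 1 \<or> sg' = - 1"
    and k: "k = (if sg = sg' then i else i - 1)" "k' = (if sg = sg' then i - 1 else i)"
  defines "c \<equiv> mon (qpos sg l - qposc sg' i) (- 2 * i) (2 * l)"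
  shows "fused c (osc sg i l) (oscc sg' k l) r = fused c (osc sg i (l - 1)) (oscc sg' k' l) r"
proof
  fix v
  have "c powi (- r) * mon (qpos sg l * r) 0 (2 * l * r) = mon (qposc sg' i * r) (2 * i * r) 0"
    by (simp add: c_def mon_simps algebra_simps)
  then have c: "c powi (- r) * (of_int sg / qint r * mon (qpos sg l * r) 0 (2 * l * r)) =
      of_int sg / qint r * mon (qposc sg' i * r) (2 * i * r) 0" by simp
  have "scale (c powi (- r)) (osc sg i l r v - osc sg i (l - 1) r v) =
      scale (of_int sg / qint r * mon (qposc sg' i * r) (2 * i * r) 0) (\<Omega> i l r v)"
    unfolding osc_diff[OF r l sg(1)] scale_scale c ..
  also have "\<dots> = oscc sg' k' l r v - oscc sg' k l r v"
  proof (cases "sg = sg'")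
    case True
    then show ?thesis using oscc_diff[OF r i sg(2)] k by simp
  next
    case False
    then have "sg = - sg'" using sg by auto
    then have "scale (of_int sg / qint r * mon (qposc sg' i * r) (2 * i * r) 0) (\<Omega> i l r v) =
        - (oscc sg' (i - 1) l r v - oscc sg' i l r v)"
      unfolding oscc_diff[OF r i sg(2)] by (simp add: vec.scale_minus_left)
    then show ?thesis using False k by simp
  qed
  finally show "fused c (osc sg i l) (oscc sg' k l) r v = fused c (osc sg i (l - 1)) (oscc sg' k' l) r v"
    by (simp add: fused_def oscale_def vec.scale_right_diff_distrib algebra_simps)
qed

end

section \<open>The zero modes of the currents\<close>

context toroidal_fock_generic
begin

definition rowdiff :: "int \<Rightarrow> int \<Rightarrow> lattice \<Rightarrow> int" where
  "rowdiff i t M = Poly_Mapping.lookup M (i - 1, t) - Poly_Mapping.lookup M (i, t)"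

definition coldiff :: "int \<Rightarrow> int \<Rightarrow> lattice \<Rightarrow> int" where
  "coldiff l s M = Poly_Mapping.lookup M (s, l - 1) - Poly_Mapping.lookup M (s, l)"

text \<open>
  The range of the sum in the exponent of \<open>q\<close> of a zero mode, where \<open>h\<close> is the number of columns or
  rows.  Its number of elements, \<open>offset\<close>, is the exponent of \<open>q\<close> that accompanies \<open>z\<close>.
\<close>

definition after :: "int \<Rightarrow> int \<Rightarrow> int \<Rightarrow> int set" where
  "after sg h j = (if sg = 1 then {j + 1..h - 1} else {0..j - 1})"

definition offset :: "int \<Rightarrow> int \<Rightarrow> int \<Rightarrow> int" where
  "offset sg h j = (if sg = 1 then h - 1 - j else j)"

text \<open>
  The exponent of \<open>z\<close> in a zero mode.  It is the increase of half the squared length of the lattice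
  point, which is also why the currents are homogeneous.
\<close>

definition zdeg :: "int \<Rightarrow> int \<Rightarrow> int \<Rightarrow> lattice \<Rightarrow> int" where
  "zdeg sg i j M = sg * rowdiff i j M + 1"

definition zdegc :: "int \<Rightarrow> int \<Rightarrow> int \<Rightarrow> lattice \<Rightarrow> int" where
  "zdegc sg k l M = - sg * coldiff l k M + 1"

text \<open>
  The scalar of a zero mode is a product of a power of \<open>q\<close> and a power of \<open>sd\<close> or \<open>sdc\<close>; these are
  the exponents.
\<close>

definition qexp :: "int \<Rightarrow> int \<Rightarrow> int \<Rightarrow> lattice \<Rightarrow> int" where
  "qexp sg i j M = offset sg n j * zdeg sg i j M - sg * (\<Sum>t\<in>after sg n j. rowdiff i t M)"

definition qexpc :: "int \<Rightarrow> int \<Rightarrow> int \<Rightarrow> lattice \<Rightarrow> int" where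
  "qexpc sg k l M = offset sg m k * zdegc sg k l M + sg * (\<Sum>s\<in>after sg m k. coldiff l s M)"

definition dexp :: "int \<Rightarrow> int \<Rightarrow> int \<Rightarrow> lattice \<Rightarrow> int" where
  "dexp sg i j M = sg * ((1 - 2 * i) * e (i - 1) M + (1 + 2 * i) * e i M + 2 * i * rowdiff i j M)"

definition dexpc :: "int \<Rightarrow> int \<Rightarrow> int \<Rightarrow> lattice \<Rightarrow> int" where
  "dexpc sg k l M = sg * ((1 - 2 * l) * ec (l - 1) M + (1 + 2 * l) * ec l M - 2 * l * coldiff l k M)"

definition zmode :: "int \<Rightarrow> int \<Rightarrow> int \<Rightarrow> current" where
  "zmode sg i j = (if sg = 1 then U i j else V i j)"

definition zmodec :: "int \<Rightarrow> int \<Rightarrow> int \<Rightarrow> current" where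
  "zmodec sg k l = (if sg = 1 then Uc k l else Vc k l)"

text \<open>
  The factor \<open>sg\<close> accounts for the order of the two lattice operators, which in \<open>V\<close> and \<open>Vc\<close> is
  opposite to the one obtained from \<open>U\<close> and \<open>Uc\<close> by reversing the signs.
\<close>

definition \<sigma> :: "int \<Rightarrow> int \<Rightarrow> int \<Rightarrow> oper" where
  "\<sigma> sg i j = of_int sg *\<^sub>o (eeps (- sg) i j \<circ> eeps sg (i - 1) j)"

definition \<sigma>c :: "int \<Rightarrow> int \<Rightarrow> int \<Rightarrow> oper" where
  "\<sigma>c sg k l = of_int sg *\<^sub>o (eeps sg k l \<circ> eeps (- sg) k (l - 1))"

definition \<delta> :: "int \<Rightarrow> int \<Rightarrow> int \<Rightarrow> lattice" where
  "\<delta> sg i j = Poly_Mapping.single (i - 1, j) sg + Poly_Mapping.single (i, j) (- sg)"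

definition \<delta>c :: "int \<Rightarrow> int \<Rightarrow> int \<Rightarrow> lattice" where
  "\<delta>c sg k l = Poly_Mapping.single (k, l - 1) (- sg) + Poly_Mapping.single (k, l) sg"

lemma diag_weight_space:
  assumes "v \<in> weight_space M"
  shows "diag f v = scale (f M) v"
proof -
  have "diag f v = (f M *\<^sub>o id) v"
    by (rule lin_eqI_weight_space[OF _ lin_oscale[OF lin_id] _ assms])
       (auto simp: diag_def oscale_def)
  then show ?thesis by (simp add: oscale_def)
qed

lemma zpow_weight_space:
  assumes "v \<in> weight_space M"
  shows "zpow c N k v = (if k = N M then scale (c powi k) v else 0)"
  unfolding zpow_def diag_weight_space[OF assms] by simp

lemma rowdiff_del: "1 \<le> i \<Longrightarrow> i < m \<Longrightarrow> 0 \<le> t \<Longrightarrow> t < n \<Longrightarrow> del (i - 1) t M - del i t M = rowdiff i t M"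
  by (simp add: del_def rowdiff_def)

lemma coldiff_del: "0 \<le> s \<Longrightarrow> s < m \<Longrightarrow> 1 \<le> l \<Longrightarrow> l < n \<Longrightarrow> del s (l - 1) M - del s l M = coldiff l s M"
  by (simp add: del_def coldiff_def)

lemma zmode_eq:
  assumes i: "1 \<le> i" "i < m" and j: "0 \<le> j" "j < n" and sg: "sg = 1 \<or> sg = - 1"
    and v: "v \<in> weight_space M"
  shows "zmode sg i j k v =
    (if k = zdeg sg i j M then scale (mon (qexp sg i j M) (dexp sg i j M) 0) (\<sigma> sg i j v) else 0)"
proof -
  note ws = vec.subspace_scale[OF subspace_weight_space]
  note row = rowdiff_del[OF i]
  note ex = diag_weight_space[OF v] diag_weight_space[OF ws[OF v]]
    diag_weight_space[OF ws[OF ws[OF v]]] zpow_weight_space[OF v] zpow_weight_space[OF ws[OF v]]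
    module_hom.scale[OF lin_eeps] module_hom.zero[OF lin_eeps] module_hom.zero[OF lin_oscale]
  show ?thesis
  proof (cases "sg = 1")
    case True
    have s: "(\<Sum>t=j + 1..n - 1. del (i - 1) t M - del i t M) = (\<Sum>t\<in>after sg n j. rowdiff i t M)" for M
      unfolding after_def using True j by (auto intro!: sum.cong row)
    have N: "del (i - 1) j M - del i j M + 1 = zdeg sg i j M" for M
      using True by (simp only: zdeg_def row[OF j])
    have d: "(1 - 2 * i) * e (i - 1) M + (1 + 2 * i) * e i M + 2 * i * (del (i - 1) j M - del i j M) =
        dexp sg i j M" for M
      unfolding dexp_def row[OF j] True by simp
    have U: "zmode sg i j k = eeps (- 1) i j \<circ> eeps 1 (i - 1) j \<circ>
        zpow (q powi (n - 1 - j)) (\<lambda>M. zdeg sg i j M) k \<circ> diag (\<lambda>M. sd powi dexp sg i j M) \<circ>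
        diag (\<lambda>M. q powi (- (\<Sum>t\<in>after sg n j. rowdiff i t M)))"
      unfolding N[symmetric] d[symmetric] s[symmetric] zmode_def U_def using True by simp
    have "zmode sg i j k v = (if k = zdeg sg i j M then scale ((q powi (n - 1 - j)) powi zdeg sg i j M *
       (sd powi dexp sg i j M * q powi (- (\<Sum>t\<in>after sg n j. rowdiff i t M))))
       (eeps (- 1) i j (eeps 1 (i - 1) j v)) else 0)"
      by (simp add: U ex mult_ac)
    also have "(q powi (n - 1 - j)) powi zdeg sg i j M *
       (sd powi dexp sg i j M * q powi (- (\<Sum>t\<in>after sg n j. rowdiff i t M))) =
       mon (qexp sg i j M) (dexp sg i j M) 0"
      using True q_nonzero power_int_add[of q "offset sg n j * zdeg sg i j M" "- (\<Sum>t\<in>after sg n j. rowdiff i t M)"]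
      by (simp add: mon_def qexp_def offset_def power_int_mult)
    finally show ?thesis using True by (simp add: \<sigma>_def oscale_def)
  next
    case False
    then have sg: "sg = - 1" using sg by simp
    have s: "(\<Sum>t=0..j - 1. del (i - 1) t M - del i t M) = (\<Sum>t\<in>after sg n j. rowdiff i t M)" for M
      unfolding after_def using False j by (auto intro!: sum.cong row)
    have N: "- del (i - 1) j M + del i j M + 1 = zdeg sg i j M" for M
      using sg row[OF j, of M] by (simp add: zdeg_def)
    have d: "- (1 - 2 * i) * e (i - 1) M - (1 + 2 * i) * e i M - 2 * i * (del (i - 1) j M - del i j M) =
        dexp sg i j M" for M
      unfolding dexp_def row[OF j] sg by (simp add: algebra_simps)
    have V: "zmode sg i j k = eeps (- 1) (i - 1) j \<circ> eeps 1 i j \<circ>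
        zpow (q powi j) (\<lambda>M. zdeg sg i j M) k \<circ> diag (\<lambda>M. sd powi dexp sg i j M) \<circ>
        diag (\<lambda>M. q powi (\<Sum>t\<in>after sg n j. rowdiff i t M))"
      unfolding N[symmetric] d[symmetric] s[symmetric] zmode_def V_def using False by simp
    have swap: "eeps (- 1) (i - 1) j (eeps 1 i j w) = scale (- 1) (eeps 1 i j (eeps (- 1) (i - 1) j w))" for w
      by (subst eeps_swap) (use i j in auto)
    have "zmode sg i j k v = (if k = zdeg sg i j M then scale ((q powi j) powi zdeg sg i j M *
       (sd powi dexp sg i j M * q powi (\<Sum>t\<in>after sg n j. rowdiff i t M)))
       (eeps (- 1) (i - 1) j (eeps 1 i j v)) else 0)"
      by (simp add: V ex mult_ac)
    also have "(q powi j) powi zdeg sg i j M *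
       (sd powi dexp sg i j M * q powi (\<Sum>t\<in>after sg n j. rowdiff i t M)) =
       mon (qexp sg i j M) (dexp sg i j M) 0"
      using sg q_nonzero
      by (simp add: mon_def qexp_def offset_def power_int_mult[symmetric] power_int_add)
    finally show ?thesis by (simp add: sg \<sigma>_def oscale_def swap mult_ac)
  qed
qed

lemma zmodec_eq:
  assumes k: "0 \<le> k" "k < m" and l: "1 \<le> l" "l < n" and sg: "sg = 1 \<or> sg = - 1"
    and v: "v \<in> weight_space M"
  shows "zmodec sg k l p v =
    (if p = zdegc sg k l M then scale (mon (qexpc sg k l M) 0 (dexpc sg k l M)) (\<sigma>c sg k l v) else 0)"
proof -
  note ws = vec.subspace_scale[OF subspace_weight_space]
  note col = coldiff_del[OF _ _ l]
  note ex = diag_weight_space[OF v] diag_weight_space[OF ws[OF v]]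
    diag_weight_space[OF ws[OF ws[OF v]]] zpow_weight_space[OF v] zpow_weight_space[OF ws[OF v]]
    module_hom.scale[OF lin_eeps] module_hom.zero[OF lin_eeps] module_hom.zero[OF lin_oscale]
  show ?thesis
  proof (cases "sg = 1")
    case True
    have s: "(\<Sum>s=k + 1..m - 1. del s (l - 1) M - del s l M) = (\<Sum>s\<in>after sg m k. coldiff l s M)" for M
      unfolding after_def using True k by (auto intro!: sum.cong col)
    have N: "- del k (l - 1) M + del k l M + 1 = zdegc sg k l M" for M
      using True col[OF k, of M] by (simp add: zdegc_def)
    have d: "(1 - 2 * l) * ec (l - 1) M + (1 + 2 * l) * ec l M - 2 * l * (del k (l - 1) M - del k l M) =
        dexpc sg k l M" for M
      unfolding dexpc_def col[OF k] True by simp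
    have U: "zmodec sg k l p = eeps 1 k l \<circ> eeps (- 1) k (l - 1) \<circ>
        zpow (q powi (m - 1 - k)) (\<lambda>M. zdegc sg k l M) p \<circ> diag (\<lambda>M. sdc powi dexpc sg k l M) \<circ>
        diag (\<lambda>M. q powi (\<Sum>s\<in>after sg m k. coldiff l s M))"
      unfolding N[symmetric] d[symmetric] s[symmetric] zmodec_def Uc_def using True by simp
    have "zmodec sg k l p v = (if p = zdegc sg k l M then scale ((q powi (m - 1 - k)) powi zdegc sg k l M *
       (sdc powi dexpc sg k l M * q powi (\<Sum>s\<in>after sg m k. coldiff l s M)))
       (eeps 1 k l (eeps (- 1) k (l - 1) v)) else 0)"
      by (simp add: U ex mult_ac)
    also have "(q powi (m - 1 - k)) powi zdegc sg k l M *
       (sdc powi dexpc sg k l M * q powi (\<Sum>s\<in>after sg m k. coldiff l s M)) =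
       mon (qexpc sg k l M) 0 (dexpc sg k l M)"
      using True q_nonzero
      by (simp add: mon_def qexpc_def offset_def power_int_mult[symmetric] power_int_add)
    finally show ?thesis using True by (simp add: \<sigma>c_def oscale_def)
  next
    case False
    then have sg: "sg = - 1" using sg by simp
    have s: "(\<Sum>s=0..k - 1. del s (l - 1) M - del s l M) = (\<Sum>s\<in>after sg m k. coldiff l s M)" for M
      unfolding after_def using False k by (auto intro!: sum.cong col)
    have N: "del k (l - 1) M - del k l M + 1 = zdegc sg k l M" for M
      using sg col[OF k, of M] by (simp add: zdegc_def)
    have d: "- (1 - 2 * l) * ec (l - 1) M - (1 + 2 * l) * ec l M + 2 * l * (del k (l - 1) M - del k l M) =
        dexpc sg k l M" for M
      unfolding dexpc_def col[OF k] sg by (simp add: algebra_simps)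
    have V: "zmodec sg k l p = eeps 1 k (l - 1) \<circ> eeps (- 1) k l \<circ>
        zpow (q powi k) (\<lambda>M. zdegc sg k l M) p \<circ> diag (\<lambda>M. sdc powi dexpc sg k l M) \<circ>
        diag (\<lambda>M. q powi (- (\<Sum>s\<in>after sg m k. coldiff l s M)))"
      unfolding N[symmetric] d[symmetric] s[symmetric] zmodec_def Vc_def using False by simp
    have swap: "eeps 1 k (l - 1) (eeps (- 1) k l w) = scale (- 1) (eeps (- 1) k l (eeps 1 k (l - 1) w))" for w
      by (subst eeps_swap) (use k l in auto)
    have "zmodec sg k l p v = (if p = zdegc sg k l M then scale ((q powi k) powi zdegc sg k l M *
       (sdc powi dexpc sg k l M * q powi (- (\<Sum>s\<in>after sg m k. coldiff l s M))))
       (eeps 1 k (l - 1) (eeps (- 1) k l v)) else 0)"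
      by (simp add: V ex mult_ac)
    also have "(q powi k) powi zdegc sg k l M *
       (sdc powi dexpc sg k l M * q powi (- (\<Sum>s\<in>after sg m k. coldiff l s M))) =
       mon (qexpc sg k l M) 0 (dexpc sg k l M)"
      using sg q_nonzero power_int_add[of q "offset sg m k * zdegc sg k l M" "- (\<Sum>s\<in>after sg m k. coldiff l s M)"]
      by (simp add: mon_def qexpc_def offset_def power_int_mult)
    finally show ?thesis by (simp add: sg \<sigma>c_def oscale_def swap mult_ac)
  qed
qed

lemma nexp_zero_mode:
  assumes "modes X" "\<And>k. Z k v = (if k = N then scale f w else 0)"
  shows "(nexp X \<odot> Z) k v = scale f (nexp X (k - N) w)"
proof -
  have "nexp X (k - p) (Z p v) = (if p = N then scale f (nexp X (k - p) w) else 0)" for p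
    by (simp add: assms(2) module_hom.scale[OF lin_nexp[OF assms(1)]]
        module_hom.zero[OF lin_nexp[OF assms(1)]])
  then show ?thesis by (simp add: cmult_def)
qed

lemma lin_\<sigma>: "lin (\<sigma> sg i j)" "lin (\<sigma>c sg i j)"
  unfolding \<sigma>_def \<sigma>c_def by (intro lin_oscale lin_comp lin_eeps)+

lemma modes_osc: "modes (osc sg i j)" "modes (oscc sg i j)"
  by (intro modes_mode_space mode_space_osc)+

lemma vertex_op_osc:
  assumes i: "1 \<le> i" "i < m" and j: "0 \<le> j" "j < n" and sg: "sg = 1 \<or> sg = - 1"
  shows "vertex_op (osc sg i j) (\<sigma> sg i j) (\<delta> sg i j) (\<lambda>M. mon (qexp sg i j M) (dexp sg i j M) 0)
    (zdeg sg i j) (nexp (osc sg i j) \<odot> zmode sg i j)"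
proof
  fix v M assume v: "v \<in> weight_space M"
  have "eeps (- sg) i j (eeps sg (i - 1) j v) \<in>
      weight_space (M + Poly_Mapping.single (i - 1, j) sg + Poly_Mapping.single (i, j) (- sg))"
    by (intro eeps_weight v) (use i j in auto)
  then show "\<sigma> sg i j v \<in> weight_space (M + \<delta> sg i j)"
    by (simp add: \<sigma>_def \<delta>_def oscale_def add.assoc vec.subspace_scale[OF subspace_weight_space])
  show "(nexp (osc sg i j) \<odot> zmode sg i j) k v = scale (mon (qexp sg i j M) (dexp sg i j M) 0)
       (nexp (osc sg i j) (k - zdeg sg i j M) (\<sigma> sg i j v))" for k
    by (rule nexp_zero_mode[OF modes_osc(1)]) (rule zmode_eq[OF assms v])
qed (auto intro: modes_osc mode_space_weight[OF mode_space_osc(1)]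
    simp: module_hom.add[OF lin_\<sigma>(1)] module_hom.scale[OF lin_\<sigma>(1)])

lemma vertex_op_oscc:
  assumes k: "0 \<le> k" "k < m" and l: "1 \<le> l" "l < n" and sg: "sg = 1 \<or> sg = - 1"
  shows "vertex_op (oscc sg k l) (\<sigma>c sg k l) (\<delta>c sg k l) (\<lambda>M. mon (qexpc sg k l M) 0 (dexpc sg k l M))
    (zdegc sg k l) (nexp (oscc sg k l) \<odot> zmodec sg k l)"
proof
  fix v M assume v: "v \<in> weight_space M"
  have "eeps sg k l (eeps (- sg) k (l - 1) v) \<in>
      weight_space (M + Poly_Mapping.single (k, l - 1) (- sg) + Poly_Mapping.single (k, l) sg)"
    by (intro eeps_weight v) (use k l in auto)
  then show "\<sigma>c sg k l v \<in> weight_space (M + \<delta>c sg k l)"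
    by (simp add: \<sigma>c_def \<delta>c_def oscale_def add.assoc vec.subspace_scale[OF subspace_weight_space])
  show "(nexp (oscc sg k l) \<odot> zmodec sg k l) p v = scale (mon (qexpc sg k l M) 0 (dexpc sg k l M))
       (nexp (oscc sg k l) (p - zdegc sg k l M) (\<sigma>c sg k l v))" for p
    by (rule nexp_zero_mode[OF modes_osc(2)]) (rule zmodec_eq[OF assms v])
qed (auto intro: modes_osc mode_space_weight[OF mode_space_osc(2)]
    simp: module_hom.add[OF lin_\<sigma>(2)] module_hom.scale[OF lin_\<sigma>(2)])

end

section \<open>Matching the zero modes with the contractions\<close>

lemma sum_if_adjacent:
  fixes l x y :: int
  assumes "finite S"
  shows "(\<Sum>t\<in>S. if t = l then x else if t = l - 1 then y else 0) =
    (if l \<in> S then x else 0) + (if l - 1 \<in> S then y else 0)"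
proof -
  have "(\<Sum>t\<in>S. if t = l then x else if t = l - 1 then y else 0) =
      (\<Sum>t\<in>S. (if t = l then x else 0) + (if t = l - 1 then y else 0))"
    by (intro sum.cong refl) auto
  then show ?thesis using assms by (simp add: sum.distrib)
qed

text \<open>
  Stated with operator variables, since for concrete lattice operators the exchange rules may have
  equal left-hand and right-hand sides and would not terminate as rewrite rules.
\<close>

lemma move_pair_past_pair:
  assumes "lin P" "lin R" "lin S" "lin Q"
    and "\<And>w. P (R w) = scale t1 (R (P w))" "\<And>w. P (S w) = scale t2 (S (P w))"
    and "\<And>w. Q (R w) = scale t3 (R (Q w))" "\<And>w. Q (S w) = scale t4 (S (Q w))"
  shows "P (Q (R (S v))) = scale (t1 * t2 * t3 * t4) (R (S (P (Q v))))"
  using assms(1-4) by (simp add: assms(5-8) module_hom.scale mult_ac)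

context toroidal_fock_generic
begin

lemma simple_root_cases: obtains "simple_root l j = 1" "j = l" | "simple_root l j = - 1" "j = l - 1"
  | "simple_root l j = 0" "j \<noteq> l" "j \<noteq> l - 1"
  by (auto simp: simple_root_def)

lemma rowdiff_shift:
  "rowdiff i t (M + \<delta>c sg k l) = rowdiff i t M - sg * simple_root l t * simple_root i k"
  by (auto simp: rowdiff_def \<delta>c_def simple_root_def lookup_add lookup_single when_def)

lemma coldiff_shift:
  "coldiff l s (M + \<delta> sg i j) = coldiff l s M + sg * simple_root i s * simple_root l j"
  by (auto simp: coldiff_def \<delta>_def simple_root_def lookup_add lookup_single when_def)

text \<open>The shift \<open>\<delta>c\<close> has row sums \<open>0\<close>.\<close>

lemma e_shift:
  assumes l: "1 \<le> l" "l < n"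
  shows "e i (M + \<delta>c sg k l) = e i M"
proof -
  have "e i (M + \<delta>c sg k l) = e i M +
      (\<Sum>t=0..n - 1. if t = l then (if i mod m = k then sg else 0) else
        if t = l - 1 then (if i mod m = k then - sg else 0) else 0)"
    unfolding e_def sum.distrib[symmetric]
    by (rule sum.cong[OF refl]) (auto simp: del_def \<delta>c_def lookup_add lookup_single when_def)
  also have "\<dots> = e i M"
    using l by (subst sum_if_adjacent) auto
  finally show ?thesis .
qed

text \<open>The shift \<open>\<delta>\<close> has column sums \<open>0\<close>.\<close>

lemma ec_shift:
  assumes i: "1 \<le> i" "i < m"
  shows "ec l (M + \<delta> sg i j) = ec l M"
proof -
  have "(\<Sum>s=0..m - 1. del s l (M + \<delta> sg i j)) = (\<Sum>s=0..m - 1. del s l M) +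
      (\<Sum>s=0..m - 1. if s = i then (if l mod n = j then - sg else 0) else
        if s = i - 1 then (if l mod n = j then sg else 0) else 0)"
    unfolding sum.distrib[symmetric]
    by (rule sum.cong[OF refl]) (auto simp: del_def \<delta>_def lookup_add lookup_single when_def)
  also have "\<dots> = (\<Sum>s=0..m - 1. del s l M)"
    using i by (subst sum_if_adjacent) auto
  finally show ?thesis by (simp add: ec_def)
qed

text \<open>The sum of the coordinates of a simple root over \<open>after\<close>.\<close>

definition root_after :: "int \<Rightarrow> int \<Rightarrow> int \<Rightarrow> int" where
  "root_after sg l j = (if sg = 1 then (if j = l - 1 then 1 else 0) else (if j = l then - 1 else 0))"

lemma sum_simple_root_after:
  assumes "1 \<le> l" "l < h"
  shows "(\<Sum>t\<in>after sg h j. simple_root l t) = root_after sg l j"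
  unfolding simple_root_def using assms
  by (subst sum_if_adjacent) (auto simp: after_def root_after_def)

lemma zdeg_shift: "zdeg sg i j (M + \<delta>c sg' k l) = zdeg sg i j M + - (sg * sg' * simple_root l j * simple_root i k)"
  by (simp add: zdeg_def rowdiff_shift algebra_simps)

lemma zdegc_shift: "zdegc sg' k l (M + \<delta> sg i j) = zdegc sg' k l M + - (sg * sg' * simple_root l j * simple_root i k)"
  by (simp add: zdegc_def coldiff_shift algebra_simps)

lemma qexp_shift:
  assumes l: "1 \<le> l" "l < n"
  shows "qexp sg i j (M + \<delta>c sg' k l) = qexp sg i j M -
    sg * sg' * simple_root i k * (offset sg n j * simple_root l j - root_after sg l j)"
proof -
  have "(\<Sum>t\<in>after sg n j. rowdiff i t (M + \<delta>c sg' k l)) =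
      (\<Sum>t\<in>after sg n j. rowdiff i t M) - sg' * simple_root i k * root_after sg l j"
    unfolding rowdiff_shift sum_simple_root_after[OF l, symmetric]
    by (simp add: sum_subtractf sum_distrib_left mult_ac)
  then show ?thesis unfolding qexp_def zdeg_shift by (simp only:) (simp add: algebra_simps)
qed

lemma qexpc_shift:
  assumes i: "1 \<le> i" "i < m"
  shows "qexpc sg' k l (M + \<delta> sg i j) = qexpc sg' k l M -
    sg * sg' * simple_root l j * (offset sg' m k * simple_root i k - root_after sg' i k)"
proof -
  have "(\<Sum>s\<in>after sg' m k. coldiff l s (M + \<delta> sg i j)) =
      (\<Sum>s\<in>after sg' m k. coldiff l s M) + sg * simple_root l j * root_after sg' i k"
    unfolding coldiff_shift sum_simple_root_after[OF i, symmetric]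
    by (simp add: sum.distrib sum_distrib_left mult_ac)
  then show ?thesis unfolding qexpc_def zdegc_shift by (simp only:) (simp add: algebra_simps)
qed

lemma dexp_shift:
  assumes l: "1 \<le> l" "l < n"
  shows "dexp sg i j (M + \<delta>c sg' k l) = dexp sg i j M - 2 * i * (sg * sg' * simple_root l j * simple_root i k)"
  by (simp add: dexp_def e_shift[OF l] rowdiff_shift algebra_simps)

lemma dexpc_shift:
  assumes i: "1 \<le> i" "i < m"
  shows "dexpc sg' k l (M + \<delta> sg i j) = dexpc sg' k l M - 2 * l * (sg * sg' * simple_root l j * simple_root i k)"
  by (simp add: dexpc_def ec_shift[OF i] coldiff_shift algebra_simps)

lemma mode_space_\<sigma>:
  assumes "X \<in> mode_space r" "r \<noteq> 0" "1 \<le> i" "i < m" "0 \<le> j" "j < n"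
  shows "\<sigma> sg i j (X v) = X (\<sigma> sg i j v)"
  using assms
  by (simp add: \<sigma>_def oscale_def mode_space_eeps module_hom.scale[OF lin_mode_space])

lemma mode_space_\<sigma>c:
  assumes "X \<in> mode_space r" "r \<noteq> 0" "0 \<le> k" "k < m" "1 \<le> l" "l < n"
  shows "\<sigma>c sg k l (X v) = X (\<sigma>c sg k l v)"
  using assms
  by (simp add: \<sigma>c_def oscale_def mode_space_eeps module_hom.scale[OF lin_mode_space])

text \<open>
  The positions of the two pairs of lattice operators lie in one column and in one row, so they have
  at most one position in common, and they have one exactly when \<open>\<nu> \<noteq> 0\<close>.
\<close>

lemma \<sigma>_swap:
  assumes i: "1 \<le> i" "i < m" and j: "0 \<le> j" "j < n" and k: "0 \<le> k" "k < m"
    and l: "1 \<le> l" "l < n" and sg: "sg = 1 \<or> sg = - 1" and sg': "sg' = 1 \<or> sg' = - 1"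
  shows "\<sigma>c sg' k l (\<sigma> sg i j v) =
    scale ((- 1) powi (- (sg * sg' * simple_root l j * simple_root i k))) (\<sigma> sg i j (\<sigma>c sg' k l v))"
proof -
  let ?t = "\<lambda>x y. if x = y then 1 else - 1 :: complex"
  have "eeps sg' k l (eeps (- sg') k (l - 1) (eeps (- sg) i j (eeps sg (i - 1) j v))) =
    scale (?t (k, l) (i, j) * ?t (k, l) (i - 1, j) * ?t (k, l - 1) (i, j) * ?t (k, l - 1) (i - 1, j))
     (eeps (- sg) i j (eeps sg (i - 1) j (eeps sg' k l (eeps (- sg') k (l - 1) v))))"
    by (rule move_pair_past_pair; (rule lin_eeps)?; (rule eeps_swap)?) (use assms in auto)
  moreover have "?t (k, l) (i, j) * ?t (k, l) (i - 1, j) * ?t (k, l - 1) (i, j) * ?t (k, l - 1) (i - 1, j) =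
      (- 1) powi (- (sg * sg' * simple_root l j * simple_root i k))"
    using sg sg' by (auto simp: simple_root_def)
  ultimately show ?thesis
    by (simp add: \<sigma>_def \<sigma>c_def oscale_def module_hom.scale[OF lin_eeps] mult_ac)
qed

text \<open>
  After the shift rules, the condition on the scalars is an identity between exponents for each of
  the cases for \<open>j\<close> relative to \<open>l\<close> and \<open>k\<close> relative to \<open>i\<close>.
\<close>

lemma vertex_op_pair_osc_oscc:
  assumes i: "1 \<le> i" "i < m" and j: "0 \<le> j" "j < n" and k: "0 \<le> k" "k < m"
    and l: "1 \<le> l" "l < n" and sg: "sg = 1 \<or> sg = - 1" and sg': "sg' = 1 \<or> sg' = - 1"
  shows "vertex_op_pair (osc sg i j) (\<sigma> sg i j) (\<delta> sg i j) (\<lambda>M. mon (qexp sg i j M) (dexp sg i j M) 0)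
    (zdeg sg i j) (nexp (osc sg i j) \<odot> zmode sg i j)
    (oscc sg' k l) (\<sigma>c sg' k l) (\<delta>c sg' k l) (\<lambda>M. mon (qexpc sg' k l M) 0 (dexpc sg' k l M))
    (zdegc sg' k l) (nexp (oscc sg' k l) \<odot> zmodec sg' k l)
    (- (sg * sg' * simple_root l j * simple_root i k)) (pole sg sg' i j k l)"
proof (intro vertex_op_pair.intro vertex_op_osc vertex_op_oscc assms vertex_op_pair_axioms.intro)
  let ?\<nu> = "- (sg * sg' * simple_root l j * simple_root i k)"
  show "vertex_pairing (osc sg i j) (oscc sg' k l) ?\<nu> (pole sg sg' i j k l)"
    by (rule vertex_pairing_osc_oscc[OF assms])
  show "pole sg sg' i j k l \<noteq> 0" by (simp add: pole_def mon_nonzero)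
  fix M
  have q: "qexpc sg' k l M + qexp sg i j (M + \<delta>c sg' k l) =
    (sg * simple_root l j - sg' * simple_root i k + qpos sg l - qposc sg' i) * (- ?\<nu>) +
      (qexp sg i j M + qexpc sg' k l (M + \<delta> sg i j))"
    unfolding qexp_shift[OF l] qexpc_shift[OF i]
    by (cases rule: simple_root_cases[of l j]; cases rule: simple_root_cases[of i k]; rule disjE[OF sg]; rule disjE[OF sg'])
      (simp_all add: root_after_def offset_def qpos_def qposc_def)
  show "mon (qexpc sg' k l M) 0 (dexpc sg' k l M) *
      mon (qexp sg i j (M + \<delta>c sg' k l)) (dexp sg i j (M + \<delta>c sg' k l)) 0 =
    pole sg sg' i j k l powi (- ?\<nu>) * (mon (qexp sg i j M) (dexp sg i j M) 0 *
      mon (qexpc sg' k l (M + \<delta> sg i j)) 0 (dexpc sg' k l (M + \<delta> sg i j)))"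
    unfolding mon_mult pole_def mon_powi
    by (intro arg_cong3[of _ _ _ _ _ _ mon] q)
       (simp_all add: dexp_shift[OF l] dexpc_shift[OF i] algebra_simps)
qed (use assms in \<open>simp_all only: zdeg_shift zdegc_shift \<sigma>_swap mode_space_\<sigma>[OF mode_space_osc(2)]
       mode_space_\<sigma>c[OF mode_space_osc(1)] simp_thms\<close>)

section \<open>Cancellation at the poles\<close>

lemma eeps_anticommute:
  assumes "0 \<le> i" "i < m" "0 \<le> j" "j < n" "0 \<le> k" "k < m" "0 \<le> l" "l < n"
    and "s = 1 \<or> s = - 1" "t = 1 \<or> t = - 1" and "i \<noteq> k \<or> j \<noteq> l"
  shows "eeps s i j (eeps t k l v) = - eeps t k l (eeps s i j v)"
  using eeps_swap[OF assms(1-10)] assms(11) by (auto simp: vec.scale_minus_left)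

text \<open>
  In each product two of the four lattice operators are inverse to each other and cancel.  What
  remains are the same two operators in both products, and the exchanges needed to get there differ
  by one in parity.
\<close>

lemma \<sigma>_pole:
  assumes i: "1 \<le> i" "i < m" and l: "1 \<le> l" "l < n"
    and sg: "sg = 1 \<or> sg = - 1" and sg': "sg' = 1 \<or> sg' = - 1"
    and k: "k = (if sg = sg' then i else i - 1)" "k' = (if sg = sg' then i - 1 else i)"
  shows "\<sigma> sg i l (\<sigma>c sg' k l v) = - \<sigma> sg i (l - 1) (\<sigma>c sg' k' l v)"
proof -
  have r: "0 \<le> i" "0 \<le> i - 1" "i - 1 < m" "0 \<le> l" "0 \<le> l - 1" "l - 1 < n"
    using i l by auto
  have s: "- sg = 1 \<or> - sg = - 1" using sg by auto
  note neg = module_hom.neg[OF lin_eeps]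
  have inv: "eeps sg s t (eeps (- sg) s t v) = v" "eeps (- sg) s t (eeps sg s t v) = v"
    if "0 \<le> s" "s < m" "0 \<le> t" "t < n" for s t v
    using eeps_inverse[OF that, of sg] eeps_inverse[OF that, of "- sg"] by simp_all
  have sg2: "of_int sg * of_int sg = (1::complex)" using sg by auto
  show ?thesis
  proof (cases "sg = sg'")
    case True
    have 1: "eeps sg (i - 1) l (eeps sg i l w) = - eeps sg i l (eeps sg (i - 1) l w)" for w
      by (rule eeps_anticommute) (use r i l sg s in auto)
    have 2: "eeps sg (i - 1) l (eeps (- sg) (i - 1) (l - 1) w) =
        - eeps (- sg) (i - 1) (l - 1) (eeps sg (i - 1) l w)" for w
      by (rule eeps_anticommute) (use r i l sg s in auto)
    have 3: "eeps (- sg) i (l - 1) (eeps sg (i - 1) l w) = - eeps sg (i - 1) l (eeps (- sg) i (l - 1) w)" for w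
      by (rule eeps_anticommute) (use r i l sg s in auto)
    have "eeps (- sg) i l (eeps sg (i - 1) l (eeps sg i l (eeps (- sg) i (l - 1) v))) =
        - eeps sg (i - 1) l (eeps (- sg) i (l - 1) v)"
      using r i l by (simp add: 1 neg inv)
    moreover have "eeps (- sg) i (l - 1) (eeps sg (i - 1) (l - 1)
        (eeps sg (i - 1) l (eeps (- sg) (i - 1) (l - 1) v))) =
        eeps sg (i - 1) l (eeps (- sg) i (l - 1) v)"
      using r i l by (simp add: 2 neg inv) (simp add: 3)
    ultimately show ?thesis
      using True k sg2 by (simp add: \<sigma>_def \<sigma>c_def oscale_def module_hom.scale[OF lin_eeps])
  next
    case False
    then have sg'': "sg' = - sg" using sg sg' by auto
    have 1: "eeps (- sg) i l (eeps sg i (l - 1) w) = - eeps sg i (l - 1) (eeps (- sg) i l w)" for w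
      by (rule eeps_anticommute) (use r i l sg s in auto)
    have 2: "eeps sg (i - 1) (l - 1) (eeps sg i (l - 1) w) =
        - eeps sg i (l - 1) (eeps sg (i - 1) (l - 1) w)" for w
      by (rule eeps_anticommute) (use r i l sg s in auto)
    have 3: "eeps sg (i - 1) (l - 1) (eeps (- sg) i l w) = - eeps (- sg) i l (eeps sg (i - 1) (l - 1) w)" for w
      by (rule eeps_anticommute) (use r i l sg s in auto)
    have "eeps (- sg) i l (eeps sg (i - 1) l (eeps (- sg) (i - 1) l (eeps sg (i - 1) (l - 1) v))) =
        eeps (- sg) i l (eeps sg (i - 1) (l - 1) v)"
      using r i l by (simp add: inv)
    moreover have "eeps (- sg) i (l - 1) (eeps sg (i - 1) (l - 1)
        (eeps (- sg) i l (eeps sg i (l - 1) v))) =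
        - eeps (- sg) i l (eeps sg (i - 1) (l - 1) v)"
      using r i l by (simp add: 1 2 neg inv) (simp add: 3)
    ultimately show ?thesis
      using False k sg2 by (simp add: sg'' \<sigma>_def \<sigma>c_def oscale_def module_hom.scale[OF lin_eeps]
          vec.scale_minus_left neg)
  qed
qed

lemma sum_after_pred:
  fixes F :: "int \<Rightarrow> int"
  assumes "1 \<le> l" "l < h"
  shows "(\<Sum>t\<in>after sg h (l - 1). F t) = (\<Sum>t\<in>after sg h l. F t) + (if sg = 1 then F l else - F (l - 1))"
  using sum_split_first[of l "h - 1" F] sum_split_last[of 0 l F] assms by (auto simp: after_def)

text \<open>
  The exponents of \<open>w\<close>, and of \<open>q\<close>, \<open>sd\<close>, \<open>sdc\<close> in \<open>f M * f' (M + \<delta>) * c\<close> to the power \<open>N M\<close>, agree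
  for the two pairs with a pole.
\<close>

lemma pole_exponents:
  assumes i: "1 \<le> i" "i < m" and l: "1 \<le> l" "l < n"
    and sg: "sg = 1 \<or> sg = - 1" and sg': "sg' = 1 \<or> sg' = - 1"
    and k: "k = (if sg = sg' then i else i - 1)" "k' = (if sg = sg' then i - 1 else i)"
  shows "zdeg sg i l M + zdegc sg' k l M = zdeg sg i (l - 1) M + zdegc sg' k' l M" (is ?N)
    and "qexp sg i l M + qexpc sg' k l (M + \<delta> sg i l) + (qpos sg l - qposc sg' i) * zdeg sg i l M =
     qexp sg i (l - 1) M + qexpc sg' k' l (M + \<delta> sg i (l - 1)) + (qpos sg l - qposc sg' i) * zdeg sg i (l - 1) M" (is ?q)
    and "dexp sg i l M - 2 * i * zdeg sg i l M = dexp sg i (l - 1) M - 2 * i * zdeg sg i (l - 1) M" (is ?d)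
    and "dexpc sg' k l (M + \<delta> sg i l) + 2 * l * zdeg sg i l M =
     dexpc sg' k' l (M + \<delta> sg i (l - 1)) + 2 * l * zdeg sg i (l - 1) M" (is ?dc)
proof -
  have simple_root: "simple_root l l = 1" "simple_root l (l - 1) = - 1" "simple_root i i = 1" "simple_root i (i - 1) = - 1"
    by (simp_all add: simple_root_def)
  show ?N ?d ?dc
    unfolding dexpc_shift[OF i] k
    using sg sg' by (auto simp: zdeg_def zdegc_def dexp_def dexpc_def rowdiff_def coldiff_def simple_root algebra_simps)
  show ?q
    unfolding qexpc_shift[OF i] unfolding qexp_def qexpc_def sum_after_pred[OF l] k
    using sg sg' by (auto simp: sum_after_pred[OF i] zdeg_def zdegc_def rowdiff_def coldiff_def simple_root
        root_after_def offset_def qpos_def qposc_def algebra_simps)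
qed

lemma pole_pair_cancel:
  assumes i: "1 \<le> i" "i < m" and l: "1 \<le> l" "l < n"
    and sg: "sg = 1 \<or> sg = - 1" and sg': "sg' = 1 \<or> sg' = - 1"
    and k: "k = (if sg = sg' then i else i - 1)" "k' = (if sg = sg' then i - 1 else i)"
    and v: "v \<in> weight_space M"
  defines "W \<equiv> \<lambda>j. nexp (osc sg i j) \<odot> zmode sg i j" and "W' \<equiv> \<lambda>k. nexp (oscc sg' k l) \<odot> zmodec sg' k l"
  shows "W l p (W' k p' v) - W' k p' (W l p v) = - (W (l - 1) p (W' k' p' v) - W' k' p' (W (l - 1) p v))"
proof -
  define c where "c = mon (qpos sg l - qposc sg' i) (- 2 * i) (2 * l)"
  have c: "pole sg sg' i l k l = c" "pole sg sg' i (l - 1) k' l = c"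
    using sg sg' by (auto simp: pole_def c_def simple_root_def k)
  have \<nu>: "- (sg * sg' * simple_root l l * simple_root i k) = - 1" "- (sg * sg' * simple_root l (l - 1) * simple_root i k') = - 1"
    using sg sg' by (auto simp: simple_root_def k)
  have r: "0 \<le> k" "k < m" "0 \<le> k'" "k' < m" "0 \<le> l" "0 \<le> l - 1" "l - 1 < n"
    using i l k by auto
  interpret P: vertex_op_pair "osc sg i l" "\<sigma> sg i l" "\<delta> sg i l" "\<lambda>M. mon (qexp sg i l M) (dexp sg i l M) 0"
    "zdeg sg i l" "W l" "oscc sg' k l" "\<sigma>c sg' k l" "\<delta>c sg' k l"
    "\<lambda>M. mon (qexpc sg' k l M) 0 (dexpc sg' k l M)" "zdegc sg' k l" "W' k"
    "- (sg * sg' * simple_root l l * simple_root i k)" "pole sg sg' i l k l"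
    unfolding W_def W'_def by (rule vertex_op_pair_osc_oscc) (use i l r sg sg' in auto)
  interpret P': vertex_op_pair "osc sg i (l - 1)" "\<sigma> sg i (l - 1)" "\<delta> sg i (l - 1)"
    "\<lambda>M. mon (qexp sg i (l - 1) M) (dexp sg i (l - 1) M) 0"
    "zdeg sg i (l - 1)" "W (l - 1)" "oscc sg' k' l" "\<sigma>c sg' k' l" "\<delta>c sg' k' l"
    "\<lambda>M. mon (qexpc sg' k' l M) 0 (dexpc sg' k' l M)" "zdegc sg' k' l" "W' k'"
    "- (sg * sg' * simple_root l (l - 1) * simple_root i k')" "pole sg sg' i (l - 1) k' l"
    unfolding W_def W'_def by (rule vertex_op_pair_osc_oscc) (use i l r sg sg' in auto)
  note pe = pole_exponents[OF i l sg sg' k, of M]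
  have fused: "nexp (fused c (osc sg i l) (oscc sg' k l)) = nexp (fused c (osc sg i (l - 1)) (oscc sg' k' l))"
    unfolding c_def by (rule nexp_cong) (rule fused_pole[OF _ i l sg sg' k])
  have scalars: "mon (qexp sg i l M) (dexp sg i l M) 0 *
      mon (qexpc sg' k l (M + \<delta> sg i l)) 0 (dexpc sg' k l (M + \<delta> sg i l)) * c powi (zdeg sg i l M - p) =
    mon (qexp sg i (l - 1) M) (dexp sg i (l - 1) M) 0 *
      mon (qexpc sg' k' l (M + \<delta> sg i (l - 1))) 0 (dexpc sg' k' l (M + \<delta> sg i (l - 1))) *
      c powi (zdeg sg i (l - 1) M - p)"
    unfolding c_def mon_mult mon_powi
    by (rule arg_cong3[of _ _ _ _ _ _ mon]) (use pe(2-4) in \<open>simp_all add: algebra_simps\<close>)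
  show ?thesis
    unfolding P.commutator[OF \<nu>(1) v] P'.commutator[OF \<nu>(2) v] c scalars fused pe(1)
      \<sigma>_pole[OF i l sg sg' k]
    using module_hom.neg[OF lin_nexp[OF modes_fused[OF modes_osc(1) modes_osc(2) P'.pairing[unfolded vertex_pairing_def]]]]
    by simp
qed

end

section \<open>Commuting algebras\<close>

text \<open>
  Zero modes have one nonzero coefficient on each ket, hence finitely many on each vector.  This is
  what makes the coefficients of the product with an exponential linear.
\<close>

lemma finite_support_lin:
  assumes "\<And>p. lin (Z p)" "\<And>b. finite {p. Z p (ket b) \<noteq> 0}"
  shows "finite {p. Z p v \<noteq> 0}"
proof (rule finite_subset)
  show "{p. Z p v \<noteq> 0} \<subseteq> (\<Union>b\<in>Poly_Mapping.keys v. {p. Z p (ket b) \<noteq> 0})"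
  proof
    fix p assume p: "p \<in> {p. Z p v \<noteq> 0}"
    then have "(\<Sum>b\<in>Poly_Mapping.keys v. scale (Poly_Mapping.lookup v b) (Z p (ket b))) \<noteq> 0"
      using lin_expand[OF assms(1), of p v] by simp
    then obtain b where "b \<in> Poly_Mapping.keys v" "Z p (ket b) \<noteq> 0"
      by (metis (no_types, lifting) scale_zero_right sum.neutral)
    then show "p \<in> (\<Union>b\<in>Poly_Mapping.keys v. {p. Z p (ket b) \<noteq> 0})" by blast
  qed
qed (use assms in simp)

lemma lin_cmult:
  assumes X: "\<And>k. lin (X k)" and Z: "\<And>k. lin (Z k)" "\<And>v. finite {p. Z p v \<noteq> 0}"
  shows "lin ((X \<odot> Z) k)"
proof (rule linI)
  have eq: "(X \<odot> Z) k v = (\<Sum>p\<in>S. X (k - p) (Z p v))" if "finite S" "{p. Z p v \<noteq> 0} \<subseteq> S" for S v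
    unfolding cmult_def
    by (rule Sum_any.expand_superset) (use that in \<open>auto simp: module_hom.zero[OF X]\<close>)
  fix v w c
  let ?S = "{p. Z p v \<noteq> 0} \<union> {p. Z p w \<noteq> 0} \<union> {p. Z p (v + w) \<noteq> 0}"
  have "finite ?S" using Z(2) by auto
  then show "(X \<odot> Z) k (v + w) = (X \<odot> Z) k v + (X \<odot> Z) k w"
    by (subst (1 2 3) eq[of ?S])
       (auto simp: module_hom.add[OF X] module_hom.add[OF Z(1)] sum.distrib)
  let ?T = "{p. Z p v \<noteq> 0} \<union> {p. Z p (scale c v) \<noteq> 0}"
  have "finite ?T" using Z(2) by auto
  then show "(X \<odot> Z) k (scale c v) = scale c ((X \<odot> Z) k v)"
    by (subst (1 2) eq[of ?T])
       (auto simp: module_hom.scale[OF X] module_hom.scale[OF Z(1)] vec.scale_sum_right)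
qed

lemma lin_op_algebra:
  assumes "X \<in> op_algebra G" "\<And>Y. Y \<in> G \<Longrightarrow> lin Y"
  shows "lin X"
  using assms(1)
  by (induction rule: op_algebra.induct) (simp_all only: assms(2) lin_id lin_add lin_oscale lin_comp)

lemma op_algebra_commute:
  assumes G: "\<And>X. X \<in> G \<Longrightarrow> lin X" and H: "\<And>Y. Y \<in> H \<Longrightarrow> lin Y"
    and GH: "\<And>X Y v. X \<in> G \<Longrightarrow> Y \<in> H \<Longrightarrow> X (Y v) = Y (X v)"
    and X: "X \<in> op_algebra G" and Y: "Y \<in> op_algebra H"
  shows "X (Y v) = Y (X v)"
proof -
  have *: "X (Y v) = Y (X v)" if "X \<in> G" for X v
    using Y
    by (induction arbitrary: v rule: op_algebra.induct)
       (simp_all add: GH[OF that] module_hom.add[OF G[OF that]] module_hom.scale[OF G[OF that]] oscale_def)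
  note linY = lin_op_algebra[OF Y H]
  show ?thesis
    using X
    by (induction arbitrary: v rule: op_algebra.induct)
       (simp_all add: * module_hom.add[OF linY] module_hom.scale[OF linY] oscale_def)
qed

context toroidal_fock_generic
begin

definition vertex :: "int \<Rightarrow> int \<Rightarrow> int \<Rightarrow> current" where
  "vertex sg i j = nexp (osc sg i j) \<odot> zmode sg i j"

definition vertexc :: "int \<Rightarrow> int \<Rightarrow> int \<Rightarrow> current" where
  "vertexc sg k l = nexp (oscc sg k l) \<odot> zmodec sg k l"

lemma E_F_sum:
  "E i p v = (\<Sum>j=0..n - 1. vertex 1 i j p v)" "F i p v = (\<Sum>j=0..n - 1. vertex (- 1) i j p v)"
  by (simp_all add: E_def F_def sum_current sum_apply vertex_def osc_def zmode_def)

lemma Ec_Fc_sum: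
  "Ec l p v = (\<Sum>k=0..m - 1. vertexc 1 k l p v)" "Fc l p v = (\<Sum>k=0..m - 1. vertexc (- 1) k l p v)"
  by (simp_all add: Ec_def Fc_def sum_current sum_apply vertexc_def oscc_def zmodec_def)

lemma lin_diag: "lin (diag f)"
  unfolding diag_def by (rule lin_linext)

lemma lin_zmode: "lin (zmode sg i j k)" "lin (zmodec sg i j k)"
  by (auto simp: zmode_def zmodec_def U_def V_def Uc_def Vc_def zpow_def simp del: o_apply
      intro!: lin_comp lin_eeps lin_diag)

lemma lin_vertex:
  assumes "1 \<le> i" "i < m" "0 \<le> j" "j < n" "sg = 1 \<or> sg = - 1"
  shows "lin (vertex sg i j p)"
  unfolding vertex_def
proof (rule lin_cmult[OF lin_nexp[OF modes_osc(1)] lin_zmode(1) finite_support_lin[OF lin_zmode(1)]])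
  fix b :: state
  from zmode_eq[OF assms ket_weight_space_snd] have "{p. zmode sg i j p (ket b) \<noteq> 0} \<subseteq> {zdeg sg i j (snd b)}"
    by (auto split: if_splits)
  then show "finite {p. zmode sg i j p (ket b) \<noteq> 0}" by (rule finite_subset) simp
qed

lemma lin_vertexc:
  assumes "0 \<le> k" "k < m" "1 \<le> l" "l < n" "sg = 1 \<or> sg = - 1"
  shows "lin (vertexc sg k l p)"
  unfolding vertexc_def
proof (rule lin_cmult[OF lin_nexp[OF modes_osc(2)] lin_zmode(2) finite_support_lin[OF lin_zmode(2)]])
  fix b :: state
  from zmodec_eq[OF assms ket_weight_space_snd] have "{p. zmodec sg k l p (ket b) \<noteq> 0} \<subseteq> {zdegc sg k l (snd b)}"
    by (auto split: if_splits)
  then show "finite {p. zmodec sg k l p (ket b) \<noteq> 0}" by (rule finite_subset) simp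
qed

text \<open>
  Of all the commutators of \<open>vertex sg i j\<close> with \<open>vertexc sg' k l\<close> only those for \<open>(l, k1)\<close> and
  \<open>(l - 1, k2)\<close> can be nonzero, and these two are opposite.
\<close>

lemma vertex_sums_commute:
  assumes i: "1 \<le> i" "i < m" and l: "1 \<le> l" "l < n"
    and sg: "sg = 1 \<or> sg = - 1" and sg': "sg' = 1 \<or> sg' = - 1"
  shows "(\<Sum>j=0..n - 1. vertex sg i j p (\<Sum>k=0..m - 1. vertexc sg' k l p' v)) =
    (\<Sum>k=0..m - 1. vertexc sg' k l p' (\<Sum>j=0..n - 1. vertex sg i j p v))"
proof -
  let ?X = "\<Sum>j=0..n - 1. vertex sg i j p" and ?Y = "\<Sum>k=0..m - 1. vertexc sg' k l p'"
  have linV: "lin (vertex sg i j p)" if "j \<in> {0..n - 1}" for j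
    by (rule lin_vertex) (use i sg that in auto)
  have linVc: "lin (vertexc sg' k l p')" if "k \<in> {0..m - 1}" for k
    by (rule lin_vertexc) (use l sg' that in auto)
  have X: "lin ?X" by (rule lin_sum) (rule linV)
  have Y: "lin ?Y" by (rule lin_sum) (rule linVc)
  have "(?X \<circ> ?Y) v = (?Y \<circ> ?X) v"
  proof (rule lin_eqI[OF lin_comp[OF X Y] lin_comp[OF Y X]])
    fix b :: state
    have b: "ket b \<in> weight_space (snd b)" by (rule ket_weight_space_snd)
    let ?c = "\<lambda>j k. vertex sg i j p (vertexc sg' k l p' (ket b)) - vertexc sg' k l p' (vertex sg i j p (ket b))"
    define k1 k2 where "k1 = (if sg = sg' then i else i - 1)" and "k2 = (if sg = sg' then i - 1 else i)"
    have k: "k1 \<in> {0..m - 1}" "k2 \<in> {0..m - 1}" using i by (auto simp: k1_def k2_def)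
    have zero: "?c j k = 0"
      if "j \<in> {0..n - 1}" "k \<in> {0..m - 1}" "(j, k) \<noteq> (l, k1)" "(j, k) \<noteq> (l - 1, k2)" for j k
    proof -
      have r: "0 \<le> j" "j < n" "0 \<le> k" "k < m" using that by auto
      interpret vertex_op_pair "osc sg i j" "\<sigma> sg i j" "\<delta> sg i j" "\<lambda>M. mon (qexp sg i j M) (dexp sg i j M) 0"
        "zdeg sg i j" "vertex sg i j" "oscc sg' k l" "\<sigma>c sg' k l" "\<delta>c sg' k l"
        "\<lambda>M. mon (qexpc sg' k l M) 0 (dexpc sg' k l M)" "zdegc sg' k l" "vertexc sg' k l"
        "- (sg * sg' * simple_root l j * simple_root i k)" "pole sg sg' i j k l"
        unfolding vertex_def vertexc_def by (rule vertex_op_pair_osc_oscc[OF i r(1,2) r(3,4) l sg sg'])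
      have "- (sg * sg' * simple_root l j * simple_root i k) = 0 \<or> - (sg * sg' * simple_root l j * simple_root i k) = 1"
        using that(3,4) sg sg' by (auto simp: simple_root_def k1_def k2_def)
      then show ?thesis using commute[OF _ b] by simp
    qed
    have "(?X \<circ> ?Y) (ket b) - (?Y \<circ> ?X) (ket b) = (\<Sum>j=0..n - 1. \<Sum>k=0..m - 1. ?c j k)"
      unfolding o_apply sum_apply sum_subtractf
      by (simp add: module_hom.sum[OF linV] module_hom.sum[OF linVc] sum.swap[of _ "{0..m - 1}"])
    also have "\<dots> = (\<Sum>(j, k)\<in>{0..n - 1} \<times> {0..m - 1}. ?c j k)"
      by (rule sum.cartesian_product)
    also have "\<dots> = (\<Sum>(j, k)\<in>{(l, k1), (l - 1, k2)}. ?c j k)"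
    proof (rule sum.mono_neutral_right)
      show "\<forall>x\<in>{0..n - 1} \<times> {0..m - 1} - {(l, k1), (l - 1, k2)}. (case x of (j, k) \<Rightarrow> ?c j k) = 0"
      proof
        fix x assume x: "x \<in> {0..n - 1} \<times> {0..m - 1} - {(l, k1), (l - 1, k2)}"
        obtain j k where "x = (j, k)" by fastforce
        then show "(case x of (j, k) \<Rightarrow> ?c j k) = 0"
          using zero[of j k] x by simp
      qed
    qed (use k l in auto)
    also have "\<dots> = ?c l k1 + ?c (l - 1) k2" by simp
    also have "\<dots> = 0"
      unfolding vertex_def vertexc_def pole_pair_cancel[OF i l sg sg' k1_def k2_def b] by simp
    finally show "(?X \<circ> ?Y) (ket b) = (?Y \<circ> ?X) (ket b)" by simp
  qed
  then show ?thesis by (simp add: sum_apply)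
qed

lemma E_F_Ec_Fc_commute:
  assumes i: "1 \<le> i" "i < m" and l: "1 \<le> l" "l < n"
    and "X \<in> {E i p, F i p}" "Y \<in> {Ec l p', Fc l p'}"
  shows "X (Y v) = Y (X v)"
  using vertex_sums_commute[OF i l, of 1 1] vertex_sums_commute[OF i l, of 1 "- 1"]
    vertex_sums_commute[OF i l, of "- 1" 1] vertex_sums_commute[OF i l, of "- 1" "- 1"] assms(5,6)
  by (auto simp: E_F_sum Ec_Fc_sum)

lemma lin_currents:
  assumes "1 \<le> i" "i < m"
  shows "lin (E i p)" "lin (F i p)"
  unfolding E_def F_def sum_current
  using lin_vertex[OF assms, of _ 1 p] lin_vertex[OF assms, of _ "- 1" p]
  by (auto simp: vertex_def osc_def zmode_def intro!: lin_sum)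

lemma lin_check_currents:
  assumes "1 \<le> l" "l < n"
  shows "lin (Ec l p)" "lin (Fc l p)"
  unfolding Ec_def Fc_def sum_current
  using lin_vertexc[OF _ _ assms, of _ 1 p] lin_vertexc[OF _ _ assms, of _ "- 1" p]
  by (auto simp: vertexc_def oscc_def zmodec_def intro!: lin_sum)

lemma Um_Un_commute:
  assumes "X \<in> Um_currents" "Y \<in> Un_currents"
  shows "X (Y v) = Y (X v)"
  using assms unfolding Um_currents_def Un_currents_def
proof (rule op_algebra_commute[rotated 3])
  fix X Y v assume "X \<in> (\<Union>i\<in>{1..m - 1}. range (E i) \<union> range (F i))"
    "Y \<in> (\<Union>l\<in>{1..n - 1}. range (Ec l) \<union> range (Fc l))"
  then obtain i l p p' where "1 \<le> i" "i < m" "1 \<le> l" "l < n" "X \<in> {E i p, F i p}" "Y \<in> {Ec l p', Fc l p'}"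
    by fastforce
  then show "X (Y v) = Y (X v)" by (rule E_F_Ec_Fc_commute)
qed (auto simp: lin_currents lin_check_currents)

section \<open>Homogeneity of the currents\<close>

lemma twice_deg_add_single:
  assumes "0 \<le> i" "i < m" "0 \<le> j" "j < n"
  shows "twice_deg (\<mu>, M + Poly_Mapping.single (i, j) s) =
    twice_deg (\<mu>, M) + 2 * s * Poly_Mapping.lookup M (i, j) + s ^ 2"
proof -
  have "(del s' t (M + Poly_Mapping.single (i, j) s)) ^ 2 = (del s' t M) ^ 2 +
      (if s' = i then if t = j then 2 * s * Poly_Mapping.lookup M (i, j) + s ^ 2 else 0 else 0)"
    if "s' \<in> {0..m - 1}" "t \<in> {0..n - 1}" for s' t
    using that by (auto simp: del_def lookup_add lookup_single when_def power2_eq_square algebra_simps)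
  then have "(\<Sum>s'=0..m - 1. \<Sum>t=0..n - 1. (del s' t (M + Poly_Mapping.single (i, j) s)) ^ 2) =
     (\<Sum>s'=0..m - 1. \<Sum>t=0..n - 1. (del s' t M) ^ 2 +
      (if s' = i then if t = j then 2 * s * Poly_Mapping.lookup M (i, j) + s ^ 2 else 0 else 0))"
    by simp
  also have "\<dots> = (\<Sum>s'=0..m - 1. (\<Sum>t=0..n - 1. (del s' t M) ^ 2) +
      (if s' = i then 2 * s * Poly_Mapping.lookup M (i, j) + s ^ 2 else 0))"
    using assms by (intro sum.cong refl) (auto simp: sum.distrib)
  also have "\<dots> = (\<Sum>s'=0..m - 1. \<Sum>t=0..n - 1. (del s' t M) ^ 2) +
      2 * s * Poly_Mapping.lookup M (i, j) + s ^ 2"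
    using assms by (auto simp: sum.distrib)
  finally show ?thesis by (simp add: twice_deg_eq)
qed

text \<open>
  The exponential coefficient of index \<open>k - N M\<close> has degree \<open>k - N M\<close>, and the lattice shift has
  degree \<open>N M\<close>.
\<close>

lemma D_vertex_op:
  assumes "vertex_op X \<sigma>' \<delta>' f N Z" and X: "\<And>r. X r \<in> mode_space r"
    and ket: "\<sigma>' (ket (\<mu>, M)) = scale s (ket (\<mu>, M + \<delta>'))"
    and deg: "twice_deg (\<mu>, M + \<delta>') = twice_deg (\<mu>, M) + 2 * N M"
  shows "D (Z k (ket (\<mu>, M))) = scale (q powi k) (Z k (D (ket (\<mu>, M))))"
proof -
  interpret vertex_op X \<sigma>' \<delta>' f N Z by fact
  have Z: "Z k v = scale (f M) (nexp X (k - N M) (\<sigma>' v))" if "v \<in> weight_space M" for v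
    by (rule W_eq[OF that])
  have "sq powi (2 * N M) = q powi N M" by (simp add: q_def power_int_mult)
  then have "D (\<sigma>' (ket (\<mu>, M))) = scale (q powi N M) (\<sigma>' (D (ket (\<mu>, M))))"
    using nonzero by (simp add: ket D_ket deg module_hom.scale[OF lin_D] module_hom.scale[OF lin_\<sigma>]
        power_int_add mult_ac)
  moreover have "q powi k = q powi (k - N M) * q powi N M"
    using q_nonzero by (simp flip: power_int_add)
  ultimately show ?thesis
    by (simp add: Z ket_weight_space D_ket[of "(\<mu>, M)"] vec.subspace_scale[OF subspace_weight_space]
        module_hom.scale[OF lin_D] D_nexp[OF X nonzero(1)] module_hom.scale[OF lin_nexp[OF modes]]
        module_hom.scale[OF lin_\<sigma>] mult_ac)
qed

lemma D_commute_lin: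
  assumes "lin X" "\<And>\<mu> M. D (X (ket (\<mu>, M))) = scale c (X (D (ket (\<mu>, M))))"
  shows "D (X v) = scale c (X (D v))"
proof -
  have "(D \<circ> X) v = (c *\<^sub>o (X \<circ> D)) v"
    by (rule lin_eqI[OF lin_comp[OF lin_D assms(1)] lin_oscale[OF lin_comp[OF assms(1) lin_D]]])
       (use assms(2) in \<open>auto simp: oscale_def\<close>)
  then show ?thesis by (simp add: oscale_def)
qed

lemma D_vertex:
  assumes "1 \<le> i" "i < m" "0 \<le> j" "j < n" "sg = 1 \<or> sg = - 1"
  shows "D (vertex sg i j p v) = scale (q powi p) (vertex sg i j p (D v))"
proof (rule D_commute_lin[OF lin_vertex[OF assms]])
  fix \<mu> M
  have r: "0 \<le> i" "0 \<le> i - 1" "i - 1 < m" using assms by auto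
  have deg: "twice_deg (\<mu>, M + \<delta> sg i j) = twice_deg (\<mu>, M) + 2 * zdeg sg i j M"
    unfolding \<delta>_def add.assoc[symmetric] using assms r
    by (simp add: twice_deg_add_single lookup_add lookup_single zdeg_def rowdiff_def)
       (auto simp: algebra_simps)
  have "\<exists>s. \<sigma> sg i j (ket (\<mu>, M)) = scale s (ket (\<mu>, M + \<delta> sg i j))"
    using assms r by (auto simp: \<sigma>_def \<delta>_def oscale_def eeps_ket module_hom.scale[OF lin_eeps] add.assoc)
  then show "D (vertex sg i j p (ket (\<mu>, M))) = scale (q powi p) (vertex sg i j p (D (ket (\<mu>, M))))"
    unfolding vertex_def using D_vertex_op[OF vertex_op_osc[OF assms] mode_space_osc(1) _ deg] by blast
qed

lemma D_vertexc:
  assumes "0 \<le> k" "k < m" "1 \<le> l" "l < n" "sg = 1 \<or> sg = - 1"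
  shows "D (vertexc sg k l p v) = scale (q powi p) (vertexc sg k l p (D v))"
proof (rule D_commute_lin[OF lin_vertexc[OF assms]])
  fix \<mu> M
  have r: "0 \<le> l" "0 \<le> l - 1" "l - 1 < n" using assms by auto
  have deg: "twice_deg (\<mu>, M + \<delta>c sg k l) = twice_deg (\<mu>, M) + 2 * zdegc sg k l M"
    unfolding \<delta>c_def add.assoc[symmetric] using assms r
    by (simp add: twice_deg_add_single lookup_add lookup_single zdegc_def coldiff_def)
       (auto simp: algebra_simps)
  have "\<exists>s. \<sigma>c sg k l (ket (\<mu>, M)) = scale s (ket (\<mu>, M + \<delta>c sg k l))"
    using assms r by (auto simp: \<sigma>c_def \<delta>c_def oscale_def eeps_ket module_hom.scale[OF lin_eeps] add.assoc)
  then show "D (vertexc sg k l p (ket (\<mu>, M))) = scale (q powi p) (vertexc sg k l p (D (ket (\<mu>, M))))"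
    unfolding vertexc_def using D_vertex_op[OF vertex_op_oscc[OF assms] mode_space_osc(2) _ deg] by blast
qed

lemma D_E_F:
  assumes "1 \<le> i" "i < m"
  shows "D (E i p v) = scale (q powi p) (E i p (D v))" "D (F i p v) = scale (q powi p) (F i p (D v))"
  unfolding E_F_sum module_hom.sum[OF lin_D] vec.scale_sum_right
  by (intro sum.cong refl D_vertex; use assms in simp)+

lemma D_Ec_Fc:
  assumes "1 \<le> l" "l < n"
  shows "D (Ec l p v) = scale (q powi p) (Ec l p (D v))" "D (Fc l p v) = scale (q powi p) (Fc l p (D v))"
  unfolding Ec_Fc_sum module_hom.sum[OF lin_D] vec.scale_sum_right
  by (intro sum.cong refl D_vertexc; use assms in simp)+

end

theorem theorem3p6:
  fixes m n :: int and q d dc sq sd sdc :: complex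
  assumes "m \<ge> 2" and "n \<ge> 2"
    and "q \<noteq> 0" and "d \<noteq> 0" and "dc \<noteq> 0"
    and "sq ^ 2 = q" and "sd ^ 2 = d" and "sdc ^ 2 = dc"
    and "generic (inverse q * d) (q ^ 2) (inverse q * inverse d)"
    and "generic (inverse q * dc) (q ^ 2) (inverse q * inverse dc)"
  shows
    "(\<forall>X \<in> toroidal_fock.Um_currents m n sq sd sdc.
      \<forall>Y \<in> toroidal_fock.Un_currents m n sq sd sdc.
      \<forall>v \<in> toroidal_fock.Fock m n. X (Y v) = Y (X v)) \<and>
     (\<forall>v \<in> toroidal_fock.Fock m n.
        toroidal_fock.D m n sq (toroidal_fock.Dc m n sq v) =
          toroidal_fock.Dc m n sq (toroidal_fock.D m n sq v)) \<and>
     (\<forall>l \<in> {1..n - 1}. \<forall>k. \<forall>v \<in> toroidal_fock.Fock m n.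
        toroidal_fock.D m n sq (toroidal_fock.Ec m n sq sd sdc l k v) =
          scale (q powi k) (toroidal_fock.Ec m n sq sd sdc l k (toroidal_fock.D m n sq v)) \<and>
        toroidal_fock.D m n sq (toroidal_fock.Fc m n sq sd sdc l k v) =
          scale (q powi k) (toroidal_fock.Fc m n sq sd sdc l k (toroidal_fock.D m n sq v))) \<and>
     (\<forall>i \<in> {1..m - 1}. \<forall>k. \<forall>v \<in> toroidal_fock.Fock m n.
        toroidal_fock.Dc m n sq (toroidal_fock.E m n sq sd sdc i k v) =
          scale (q powi k) (toroidal_fock.E m n sq sd sdc i k (toroidal_fock.Dc m n sq v)) \<and>
        toroidal_fock.Dc m n sq (toroidal_fock.F m n sq sd sdc i k v) =
          scale (q powi k) (toroidal_fock.F m n sq sd sdc i k (toroidal_fock.Dc m n sq v)))"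
proof -
  interpret T: toroidal_fock_generic m n sq sd sdc
  proof
    fix k :: int assume "toroidal_fock.q sq powi k = 1"
    then have "q powi k * q powi k = 1"
      using assms(6) by (simp add: toroidal_fock.q_def)
    (* an instance of genericity with exponents 0, k, 0 *)
    then have "(inverse q * d) powi 0 * (q ^ 2) powi k * (inverse q * inverse d) powi 0 = 1"
      by (simp add: power2_eq_square power_int_mult_distrib)
    with assms(9) show "k = 0" unfolding generic_def by blast
  qed (use assms in auto)
  have q: "T.q = q" using assms(6) by (simp add: T.q_def)
  show ?thesis
    by (intro conjI ballI allI; (rule T.Um_Un_commute; assumption)?)
       (simp_all add: T.D_E_F T.D_Ec_Fc T.Dc_eq_D flip: q)
qed

end
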